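(* There exists a polynomial function $f$ such that the following holds. Let $n,p \in \mathbb{Z}_{++}$ with $p \le n$, let $H \in \mathbb{Q}^{n\times n}$ be symmetric, $c \in \mathbb{Q}^n$, $d \in \mathbb{Q}$, $A \in \mathbb{Q}^{m\times n}$, $b \in \mathbb{Q}^m$, and let $\phi$ be the complexity of $\{H,c,d,A,b\}$. Let $$\mathcal{F}(H,c,d,A,b) = \{x \in \mathbb{Z}^p \times \mathbb{R}^{n-p} : x^\top H x + c^\top x + d \le 0,\ Ax \le b\}.$$ If $\mathcal{F}(H,c,d,A,b)$ is non-empty, then there exists $x^0 \in \mathcal{F}(H,c,d,A,b)$ whose complexity is at most $f(\phi)$.
   Context: The complexity of a rational vector or matrix is the bit-size of its smallest binary encoding; the complexity of a finite set of objects is the sum of the complexities of its constituents. The polynomial $f$ does not depend on the instance. *)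

theory Defs
  imports
    "Jordan_Normal_Form.Matrix"
    "HOL-Computational_Algebra.Polynomial"
    "HOL-Library.Log_Nat"
begin

text \<open>
  The binary encodings are the usual ones of linear programming theory (Schrijver, \<^emph>\<open>Theory of
  Linear and Integer Programming\<close>): a rational number is written as a sign bit, a binary
  numerator and a binary denominator (least significant bit first). Neither reducedness of the
  fraction nor absence of leading zeros is required of an encoding, hence the minimum in the
  definition of complexity. A vector is the list of its entries and a matrix the list of its rows,
  with one additional bit per entry. The lemmas \<open>rat_complexity_eq\<close>, \<open>vec_complexity_eq\<close> and
  \<open>mat_complexity_eq\<close> recover Schrijver's closed formulas for the size.
\<close>

type_synonym rat_code = "bool \<times> bool list \<times> bool list"

definition bits_val :: "bool list \<Rightarrow> nat" where
  "bits_val bs = horner_sum of_bool 2 bs"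

fun encodes_rat :: "rat_code \<Rightarrow> rat \<Rightarrow> bool" where
  "encodes_rat (s, N, D) r \<longleftrightarrow>
     bits_val D \<noteq> 0 \<and> r = (if s then - 1 else 1) * (of_nat (bits_val N) / of_nat (bits_val D))"

fun rat_code_size :: "rat_code \<Rightarrow> nat" where
  "rat_code_size (s, N, D) = 1 + length N + length D"

definition encodes_vec :: "rat_code list \<Rightarrow> rat vec \<Rightarrow> bool" where
  "encodes_vec es v \<longleftrightarrow> list_all2 encodes_rat es (list_of_vec v)"

definition vec_code_size :: "rat_code list \<Rightarrow> nat" where
  "vec_code_size es = (\<Sum>e\<leftarrow>es. 1 + rat_code_size e)"

definition encodes_mat :: "rat_code list list \<Rightarrow> rat mat \<Rightarrow> bool" where
  "encodes_mat ess M \<longleftrightarrow> list_all2 encodes_vec ess (rows M)"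

definition mat_code_size :: "rat_code list list \<Rightarrow> nat" where
  "mat_code_size ess = (\<Sum>es\<leftarrow>ess. vec_code_size es)"

definition rat_complexity :: "rat \<Rightarrow> nat" where
  "rat_complexity r = (LEAST k. \<exists>e. encodes_rat e r \<and> rat_code_size e = k)"

definition vec_complexity :: "rat vec \<Rightarrow> nat" where
  "vec_complexity v = (LEAST k. \<exists>es. encodes_vec es v \<and> vec_code_size es = k)"

definition mat_complexity :: "rat mat \<Rightarrow> nat" where
  "mat_complexity M = (LEAST k. \<exists>ess. encodes_mat ess M \<and> mat_code_size ess = k)"

text \<open>The data \<open>H, c, d, A, b\<close> are counted with multiplicity, even if two of them coincide.\<close>

definition miqp_complexity ::
  "rat mat \<Rightarrow> rat vec \<Rightarrow> rat \<Rightarrow> rat mat \<Rightarrow> rat vec \<Rightarrow> nat" where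
  "miqp_complexity H c d A b =
     mat_complexity H + vec_complexity c + rat_complexity d + mat_complexity A + vec_complexity b"

definition miqp_feasible ::
  "nat \<Rightarrow> nat \<Rightarrow> rat mat \<Rightarrow> rat vec \<Rightarrow> rat \<Rightarrow> rat mat \<Rightarrow> rat vec \<Rightarrow> real vec set" where
  "miqp_feasible n p H c d A b =
     {x \<in> carrier_vec n.
        (\<forall>i<p. x $ i \<in> \<int>) \<and>
        x \<bullet> (map_mat of_rat H *\<^sub>v x) + map_vec of_rat c \<bullet> x + of_rat d \<le> 0 \<and>
        map_mat of_rat A *\<^sub>v x \<le> map_vec of_rat b}"


lemma floorlog_bits_val_le: "floorlog 2 (bits_val bs) \<le> length bs"
proof -
  have "bits_val bs < 2 ^ length bs"
    unfolding bits_val_def by (rule horner_sum_of_bool_2_less)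
  then show ?thesis
    by (simp add: floorlog_le_iff)
qed

lemma ex_bits_val: "\<exists>bs. bits_val bs = k \<and> length bs = floorlog 2 k"
proof -
  define L where "L = floorlog 2 k"
  have "k < 2 ^ L"
    using floorlog_le_iff[of 2 k L] by (simp add: L_def)
  then have "bits_val (map (bit k) [0..<L]) = k"
    by (simp add: bits_val_def horner_sum_bit_eq_take_bit take_bit_nat_eq_self)
  moreover have "length (map (bit k) [0..<L]) = floorlog 2 k"
    by (simp add: L_def)
  ultimately show ?thesis by blast
qed

lemma Least_sum_list:
  fixes size :: "'e \<Rightarrow> nat"
  assumes ex: "\<And>y. \<exists>e. enc e y"
  shows "(LEAST k. \<exists>es. list_all2 enc es ys \<and> (\<Sum>e\<leftarrow>es. size e) = k) =
         (\<Sum>y\<leftarrow>ys. LEAST k. \<exists>e. enc e y \<and> size e = k)"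
proof (rule Least_equality)
  let ?m = "\<lambda>y. LEAST k. \<exists>e. enc e y \<and> size e = k"
  show "\<exists>es. list_all2 enc es ys \<and> (\<Sum>e\<leftarrow>es. size e) = (\<Sum>y\<leftarrow>ys. ?m y)"
  proof (induction ys)
    case Nil
    show ?case by simp
  next
    case (Cons y ys)
    then obtain es where "list_all2 enc es ys" "(\<Sum>e\<leftarrow>es. size e) = (\<Sum>y\<leftarrow>ys. ?m y)"
      by blast
    moreover have "\<exists>e. enc e y \<and> size e = ?m y"
      by (rule LeastI_ex) (use ex in blast)
    then obtain e where "enc e y" "size e = ?m y" by blast
    ultimately have "list_all2 enc (e # es) (y # ys) \<and>
        (\<Sum>e\<leftarrow>e # es. size e) = (\<Sum>y\<leftarrow>y # ys. ?m y)" by simp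
    then show ?case by blast
  qed
next
  let ?m = "\<lambda>y. LEAST k. \<exists>e. enc e y \<and> size e = k"
  fix k
  assume "\<exists>es. list_all2 enc es ys \<and> (\<Sum>e\<leftarrow>es. size e) = k"
  then obtain es where "list_all2 enc es ys" and k: "(\<Sum>e\<leftarrow>es. size e) = k" by blast
  then have "(\<Sum>y\<leftarrow>ys. ?m y) \<le> (\<Sum>e\<leftarrow>es. size e)"
  proof (induction es ys arbitrary: k rule: list_all2_induct)
    case Nil
    show ?case by simp
  next
    case (Cons e es y ys)
    have "?m y \<le> size e"
      by (rule Least_le) (use Cons.hyps in blast)
    with Cons.IH show ?case by (simp add: add_mono)
  qed
  with k show "(\<Sum>y\<leftarrow>ys. ?m y) \<le> k" by simp
qed

lemma rat_complexity_eq: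
  assumes "quotient_of r = (a, q)"
  shows "rat_complexity r = 1 + floorlog 2 (nat \<bar>a\<bar>) + floorlog 2 (nat q)"
  unfolding rat_complexity_def
proof (rule Least_equality)
  have q: "q > 0" and cop: "coprime a q" and r: "r = of_int a / of_int q"
    using assms by (auto intro: quotient_of_denom_pos quotient_of_coprime quotient_of_div)
  obtain N where N: "bits_val N = nat \<bar>a\<bar>" "length N = floorlog 2 (nat \<bar>a\<bar>)"
    using ex_bits_val by blast
  obtain D where D: "bits_val D = nat q" "length D = floorlog 2 (nat q)"
    using ex_bits_val by blast
  have "encodes_rat (a < 0, N, D) r"
    using q r N D by (simp add: of_nat_nat)
  then show "\<exists>e. encodes_rat e r \<and>
      rat_code_size e = 1 + floorlog 2 (nat \<bar>a\<bar>) + floorlog 2 (nat q)"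
    using N D by (intro exI[of _ "(a < 0, N, D)"]) simp
next
  have q: "q > 0" and cop: "coprime a q" and r: "r = of_int a / of_int q"
    using assms by (auto intro: quotient_of_denom_pos quotient_of_coprime quotient_of_div)
  fix k
  assume "\<exists>e. encodes_rat e r \<and> rat_code_size e = k"
  then obtain s N D where e: "encodes_rat (s, N, D) r" and k: "k = 1 + length N + length D"
    by (metis prod_cases3 rat_code_size.simps)
  define x where "x = nat \<bar>a\<bar>"
  define y where "y = nat q"
  have D0: "bits_val D > 0" using e by simp
  have y0: "y > 0" using q by (simp add: y_def)
  have "\<bar>r\<bar> = of_nat (bits_val N) / of_nat (bits_val D)"
    using e by (auto simp: abs_mult)
  moreover have "\<bar>r\<bar> = of_nat x / of_nat y"
    using r q by (simp add: x_def y_def of_nat_nat)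
  ultimately have "(of_nat (x * bits_val D) :: rat) = of_nat (bits_val N * y)"
    using D0 y0 by (simp add: field_simps)
  then have eq: "x * bits_val D = bits_val N * y"
    by (simp only: of_nat_eq_iff)
  have cop': "coprime x y"
    using cop q by (simp add: x_def y_def coprime_int_iff[symmetric])
  have "y dvd x * bits_val D" by (simp add: eq)
  then have "y dvd bits_val D"
    using cop' by (simp add: coprime_commute coprime_dvd_mult_right_iff)
  then have yD: "y \<le> bits_val D" using D0 by (rule dvd_imp_le)
  have xN: "x \<le> bits_val N"
  proof -
    have "x * y \<le> bits_val N * y" using yD eq by (metis mult_le_mono2)
    then show ?thesis using y0 by simp
  qed
  have "floorlog 2 x \<le> length N"
    using floorlog_mono[OF xN] floorlog_bits_val_le order_trans by blast
  moreover have "floorlog 2 y \<le> length D"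
    using floorlog_mono[OF yD] floorlog_bits_val_le order_trans by blast
  ultimately show "1 + floorlog 2 (nat \<bar>a\<bar>) + floorlog 2 (nat q) \<le> k"
    by (simp add: k x_def y_def)
qed

lemma ex_encodes_rat: "\<exists>e. encodes_rat e r"
proof -
  obtain a q where aq: "quotient_of r = (a, q)" by fastforce
  have q: "q > 0" and r: "r = of_int a / of_int q"
    using aq by (auto intro: quotient_of_denom_pos quotient_of_div)
  obtain N D where "bits_val N = nat \<bar>a\<bar>" "bits_val D = nat q"
    using ex_bits_val by meson
  then have "encodes_rat (a < 0, N, D) r"
    using q r by (simp add: of_nat_nat)
  then show ?thesis by blast
qed

lemma Least_Suc_rat:
  "(LEAST k. \<exists>e. encodes_rat e r \<and> 1 + rat_code_size e = k) = 1 + rat_complexity r"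
proof (rule Least_equality)
  have "\<exists>e. encodes_rat e r \<and> rat_code_size e = rat_complexity r"
    unfolding rat_complexity_def by (rule LeastI_ex) (use ex_encodes_rat in blast)
  then show "\<exists>e. encodes_rat e r \<and> 1 + rat_code_size e = 1 + rat_complexity r" by auto
next
  fix k
  assume "\<exists>e. encodes_rat e r \<and> 1 + rat_code_size e = k"
  then obtain e where "encodes_rat e r" "k = 1 + rat_code_size e" by blast
  moreover from this have "rat_complexity r \<le> rat_code_size e"
    unfolding rat_complexity_def by (intro Least_le) blast
  ultimately show "1 + rat_complexity r \<le> k" by simp
qed

lemma vec_complexity_list: "vec_complexity v = (\<Sum>r\<leftarrow>list_of_vec v. 1 + rat_complexity r)"
  unfolding vec_complexity_def encodes_vec_def vec_code_size_def
  by (subst Least_sum_list[OF ex_encodes_rat]) (simp add: Least_Suc_rat[simplified])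

lemma vec_complexity_eq:
  "vec_complexity v = dim_vec v + (\<Sum>i<dim_vec v. rat_complexity (v $ i))"
  by (simp add: vec_complexity_list list_of_vec_map comp_def
      interv_sum_list_conv_sum_set_nat atLeast0LessThan sum_Suc)

lemma ex_encodes_vec: "\<exists>es. encodes_vec es v"
proof -
  have "\<exists>es. list_all2 encodes_rat es rs" for rs
    by (induction rs) (use ex_encodes_rat in \<open>auto simp: list_all2_Cons2\<close>)
  then show ?thesis by (simp add: encodes_vec_def)
qed

lemma mat_complexity_list: "mat_complexity M = (\<Sum>v\<leftarrow>rows M. vec_complexity v)"
  unfolding mat_complexity_def encodes_mat_def mat_code_size_def vec_complexity_def
  by (rule Least_sum_list[OF ex_encodes_vec])

lemma mat_complexity_eq:
  "mat_complexity M = dim_row M * dim_col M +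
     (\<Sum>i<dim_row M. \<Sum>j<dim_col M. rat_complexity (M $$ (i, j)))"
  by (simp add: mat_complexity_list rows_def vec_complexity_eq comp_def
      interv_sum_list_conv_sum_set_nat atLeast0LessThan sum.distrib)

end

theory Submission
  imports Defs "HOL-Analysis.Function_Topology"
begin

text \<open>
  All bounds come from one fact: on a polytope with integer data of bit size \<open>s\<close>, a quadratic
  function attains its minimum at a rational point of size polynomial in \<open>s\<close> and the number of
  variables and constraints.

  A feasible \<open>x\<close> is written as \<open>z + \<Sum>\<^sub>r K\<^sub>r r\<close> with natural numbers \<open>K\<^sub>r\<close>, small integral recession
  directions \<open>r\<close>, and a mixed-integer point \<open>z\<close> of the polyhedron of small norm. The quadratic part
  induces a form on the coefficient vectors, whose minimizers over the faces of the standard simplex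
  are small. If some minimum is negative, or some minimum is zero and the objective decreases along
  the corresponding direction from some small \<open>z\<close>, then following this direction from a small point
  reaches a small feasible point. Otherwise take \<open>\<Sum>\<^sub>r K\<^sub>r\<close> minimal and let \<open>J\<close> be the set of rays
  with large \<open>K\<^sub>r\<close>. A zero of the form supported in \<open>J\<close> could be subtracted from \<open>K\<close> without
  increasing the objective, so the form is strictly copositive on \<open>J\<close>, with a quantitative lower
  bound, and this bounds \<open>K\<close>. Hence \<open>x\<close> is bounded; fixing its integer coordinates leaves a
  quadratic program on a polytope.
\<close>

section \<open>Linear forms\<close>

type_synonym 'v "constraint" = "('v \<Rightarrow> int) \<times> int"

definition lin_form :: "'v set \<Rightarrow> ('v \<Rightarrow> int) \<Rightarrow> ('v \<Rightarrow> 'a) \<Rightarrow> 'a :: comm_ring_1" where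
  "lin_form V a x = (\<Sum>v\<in>V. of_int (a v) * x v)"

lemma lin_form_cong: "(\<And>v. v \<in> V \<Longrightarrow> x v = y v) \<Longrightarrow> lin_form V a x = lin_form V a y"
  by (simp add: lin_form_def)

lemma lin_form_zero_left [simp]: "lin_form V (\<lambda>v. 0) x = 0"
  by (simp add: lin_form_def)

lemma lin_form_minus_left: "lin_form V (\<lambda>v. - a v) x = - lin_form V a x"
  by (simp add: lin_form_def sum_negf)

lemma lin_form_minus: "lin_form V a (\<lambda>v. - x v) = - lin_form V a x"
  by (simp add: lin_form_def sum_negf)

lemma lin_form_add: "lin_form V a (\<lambda>v. x v + y v) = lin_form V a x + lin_form V a y"
  by (simp add: lin_form_def distrib_left sum.distrib)

lemma lin_form_diff: "lin_form V a (\<lambda>v. x v - y v) = lin_form V a x - lin_form V a y"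
  by (simp add: lin_form_def right_diff_distrib sum_subtractf)

lemma lin_form_scale: "lin_form V a (\<lambda>v. s * x v) = s * lin_form V a x"
  by (simp add: lin_form_def sum_distrib_left mult_ac)

lemma lin_form_sum: "lin_form V a (\<lambda>v. \<Sum>i\<in>I. f i v) = (\<Sum>i\<in>I. lin_form V a (f i))"
  by (simp add: lin_form_def sum_distrib_left sum.swap[of _ V I])

lemma of_int_lin_form: "of_int (lin_form V a y) = lin_form V a (\<lambda>v. of_int (y v))"
  by (simp add: lin_form_def)

lemma lin_form_support:
  assumes "finite V" "J \<subseteq> V" "\<And>v. v \<in> V - J \<Longrightarrow> x v = 0"
  shows "lin_form V a x = lin_form J a x"
  unfolding lin_form_def using assms by (intro sum.mono_neutral_right) auto

definition unit_form :: "'v \<Rightarrow> 'v \<Rightarrow> int" where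
  "unit_form u v = (if v = u then 1 else 0)"

lemma lin_form_unit_form:
  assumes "finite V" "u \<in> V"
  shows "lin_form V (unit_form u) x = x u"
  using assms
  by (simp add: lin_form_def unit_form_def if_distrib[of of_int] if_distrib[of "\<lambda>a. a * _"]
      cong: if_cong)

definition option_set :: "'v set \<Rightarrow> 'v option set" where
  "option_set V = insert None (Some ` V)"

lemma option_set_simps [simp]:
  "None \<in> option_set V" "Some v \<in> option_set V \<longleftrightarrow> v \<in> V" "finite (option_set V) \<longleftrightarrow> finite V"
  by (auto simp: option_set_def finite_image_iff)

lemma card_option_set: "finite V \<Longrightarrow> card (option_set V) = card V + 1"
  by (simp add: option_set_def card_image card_insert_if)

definition homogenize :: "'v constraint \<Rightarrow> 'v option \<Rightarrow> int" where
  "homogenize c w = (case w of None \<Rightarrow> - snd c | Some v \<Rightarrow> fst c v)"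

lemma lin_form_homogenize:
  assumes "finite V"
  shows "lin_form (option_set V) (homogenize c) y =
    lin_form V (fst c) (\<lambda>v. y (Some v)) - of_int (snd c) * y None"
  using assms by (simp add: lin_form_def option_set_def homogenize_def sum.reindex)

lemma abs_homogenize_le:
  assumes "w \<in> option_set V" "\<And>v. v \<in> V \<Longrightarrow> \<bar>fst c v\<bar> \<le> B" "\<bar>snd c\<bar> \<le> B"
  shows "\<bar>homogenize c w\<bar> \<le> B"
  using assms by (cases w) (auto simp: homogenize_def)

section \<open>Small solutions of integer linear systems\<close>

lemma lin_form_box:
  fixes a y :: "'v \<Rightarrow> int"
  assumes a: "\<And>v. v \<in> V \<Longrightarrow> \<bar>a v\<bar> \<le> C" and y: "\<And>v. v \<in> V \<Longrightarrow> y v \<in> {0..X}"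
  defines "l \<equiv> (\<Sum>v\<in>V. min (a v) 0 * X)"
  shows "lin_form V a y \<in> {l..l + int (card V) * (C * X)}"
proof -
  have term_bounds: "min (a v) 0 * X \<le> a v * y v \<and> a v * y v \<le> min (a v) 0 * X + C * X"
    if v: "v \<in> V" for v
  proof (cases "a v \<ge> 0")
    case True
    then show ?thesis using a[OF v] y[OF v] by (auto intro: mult_mono)
  next
    case False
    then have "a v * y v \<le> 0" "0 \<le> (a v + C) * X" "a v * X \<le> a v * y v"
      using a[OF v] y[OF v] by (auto simp: mult_nonpos_nonneg intro: mult_left_mono_neg)
    then show ?thesis using False by (simp add: distrib_right)
  qed
  have "l \<le> (\<Sum>v\<in>V. a v * y v)"
    unfolding l_def using term_bounds by (intro sum_mono) auto
  moreover have "(\<Sum>v\<in>V. a v * y v) \<le> (\<Sum>v\<in>V. min (a v) 0 * X + C * X)"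
    using term_bounds by (intro sum_mono) auto
  ultimately show ?thesis by (simp add: lin_form_def l_def sum.distrib)
qed

lemma lin_forms_collision:
  fixes a :: "'i \<Rightarrow> 'v \<Rightarrow> int" and C :: nat
  assumes fin: "finite V" "finite I" and card: "card I < card V"
    and C: "1 \<le> C" and a: "\<And>i v. i \<in> I \<Longrightarrow> v \<in> V \<Longrightarrow> \<bar>a i v\<bar> \<le> int C"
  defines "X \<equiv> (card V * C) ^ card I"
  obtains y y' where "y \<in> V \<rightarrow>\<^sub>E {0..int X}" "y' \<in> V \<rightarrow>\<^sub>E {0..int X}" "y \<noteq> y'"
    "\<And>i. i \<in> I \<Longrightarrow> lin_form V (a i) y = lin_form V (a i) y'"
proof -
  let ?box = "V \<rightarrow>\<^sub>E {0..int X}"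
  let ?values = "\<lambda>y. \<lambda>i\<in>I. lin_form V (a i) y"
  define l where "l i = (\<Sum>v\<in>V. min (a i v) 0 * int X)" for i
  define R where "R = (\<Pi>\<^sub>E i\<in>I. {l i..l i + int (card V * C * X)})"
  have values_in: "?values ` ?box \<subseteq> R"
  proof (clarsimp simp: R_def simp del: atLeastAtMost_iff)
    fix y i assume "y \<in> ?box" "i \<in> I"
    then show "lin_form V (a i) y \<in> {l i..l i + int (card V) * int C * int X}"
      using lin_form_box[of V "a i" "int C" y "int X"] a
      by (auto simp: l_def PiE_def Pi_def mult.assoc)
  qed
  have "finite R" using fin by (simp add: R_def finite_PiE)
  then have "card (?values ` ?box) \<le> card R" using values_in by (rule card_mono)
  also have "card R = (card V * C * X + 1) ^ card I"
    using fin by (simp add: R_def card_PiE nat_add_distrib nat_mult_distrib)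
  also have "\<dots> \<le> (card V * C * (X + 1)) ^ card I"
    using card C by (intro power_mono) (auto simp: Suc_le_eq)
  also have "\<dots> = X * (X + 1) ^ card I" by (simp only: X_def power_mult_distrib)
  also have "\<dots> < (X + 1) ^ (card I + 1)" by simp
  also have "\<dots> \<le> (X + 1) ^ card V" using card by (intro power_increasing) auto
  also have "\<dots> = card ?box" using fin by (simp add: card_PiE nat_add_distrib)
  finally have "\<not> inj_on ?values ?box" by (rule pigeonhole)
  then obtain y y' where "y \<in> ?box" "y' \<in> ?box" "y \<noteq> y'" "?values y = ?values y'"
    by (auto simp: inj_on_def)
  then show thesis
    by (intro that[of y y']) (auto dest: fun_cong simp: restrict_def split: if_splits)
qed

lemma siegel:
  fixes a :: "'i \<Rightarrow> 'v \<Rightarrow> int" and C :: nat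
  assumes fin: "finite V" "finite I" and card: "card I < card V"
    and C: "1 \<le> C" and a: "\<And>i v. i \<in> I \<Longrightarrow> v \<in> V \<Longrightarrow> \<bar>a i v\<bar> \<le> int C"
  obtains y :: "'v \<Rightarrow> int" where "\<exists>v\<in>V. y v \<noteq> 0" "\<And>i. i \<in> I \<Longrightarrow> lin_form V (a i) y = 0"
    "\<And>v. v \<in> V \<Longrightarrow> \<bar>y v\<bar> \<le> int ((card V * C) ^ card I)"
proof -
  define X where "X = (card V * C) ^ card I"
  obtain y y' where box: "y \<in> V \<rightarrow>\<^sub>E {0..int X}" "y' \<in> V \<rightarrow>\<^sub>E {0..int X}" and neq: "y \<noteq> y'"
    and same: "\<And>i. i \<in> I \<Longrightarrow> lin_form V (a i) y = lin_form V (a i) y'"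
    unfolding X_def using lin_forms_collision[OF fin card C, of a] a by blast
  show thesis
  proof (rule that[of "\<lambda>v. y v - y' v"])
    show "\<exists>v\<in>V. y v - y' v \<noteq> 0"
    proof (rule ccontr)
      assume "\<not> ?thesis"
      then have "y = y'" by (intro PiE_ext[OF box]) simp
      with neq show False ..
    qed
    show "lin_form V (a i) (\<lambda>v. y v - y' v) = 0" if "i \<in> I" for i
      using same[OF that] by (simp add: lin_form_diff)
    show "\<bar>y v - y' v\<bar> \<le> int ((card V * C) ^ card I)" if "v \<in> V" for v
    proof -
      have "y v \<in> {0..int X}" "y' v \<in> {0..int X}" using box that by auto
      then show ?thesis unfolding X_def[symmetric] by auto
    qed
  qed
qed

lemma normal_equations_kernel:
  fixes z :: "'v \<Rightarrow> real"
  assumes "finite I" "i \<in> I"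
    and normal: "\<And>u. u \<in> V \<Longrightarrow> (\<Sum>i\<in>I. of_int (a i u) * lin_form V (a i) z) = 0"
  shows "lin_form V (a i) z = 0"
proof -
  have "(\<Sum>i\<in>I. (lin_form V (a i) z)\<^sup>2) = (\<Sum>u\<in>V. z u * (\<Sum>i\<in>I. of_int (a i u) * lin_form V (a i) z))"
    by (simp add: lin_form_def power2_eq_square sum_distrib_left sum_distrib_right
        sum.swap[of _ V I] mult_ac)
  also have "\<dots> = 0" using normal by simp
  finally show ?thesis using assms(1,2) by (simp add: sum_nonneg_eq_0_iff)
qed

definition height_le :: "'v set \<Rightarrow> nat \<Rightarrow> ('v \<Rightarrow> real) \<Rightarrow> bool" where
  "height_le V B x \<longleftrightarrow> (\<exists>(t::int) n. 1 \<le> t \<and> t \<le> int B \<and>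
     (\<forall>v\<in>V. \<bar>n v\<bar> \<le> int B \<and> x v = of_int (n v) / of_int t))"

lemma height_leE:
  assumes "height_le V B x"
  obtains t :: int and n where "1 \<le> t" "t \<le> int B" "\<forall>v\<in>V. \<bar>n v\<bar> \<le> int B"
    "\<forall>v\<in>V. x v = of_int (n v) / of_int t"
  using assms unfolding height_le_def by blast

lemma height_le_mono:
  assumes "height_le V B x" "B \<le> B'"
  shows "height_le V B' x"
proof -
  have "int B \<le> int B'" using assms(2) by simp
  then show ?thesis using assms(1) unfolding height_le_def by (meson order_trans)
qed

lemma height_le_cong: "(\<And>v. v \<in> V \<Longrightarrow> x v = y v) \<Longrightarrow> height_le V B x \<longleftrightarrow> height_le V B y"
  by (simp add: height_le_def)

definition system_height :: "nat \<Rightarrow> nat \<Rightarrow> nat \<Rightarrow> nat" where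
  "system_height n m B = ((n + 1) * ((m + 1) * B\<^sup>2)) ^ n"

lemma system_height_mono:
  assumes "n \<le> n'" "1 \<le> B"
  shows "system_height n m B \<le> system_height n' m B"
proof -
  have "system_height n m B \<le> ((n' + 1) * ((m + 1) * B\<^sup>2)) ^ n"
    unfolding system_height_def using assms(1) by (intro power_mono mult_right_mono) auto
  also have "\<dots> \<le> system_height n' m B"
    unfolding system_height_def using assms by (intro power_increasing) (auto simp: Suc_le_eq)
  finally show ?thesis .
qed

definition normal_row :: "('i \<Rightarrow> 'v constraint) \<Rightarrow> 'i set \<Rightarrow> 'v \<Rightarrow> 'v option \<Rightarrow> int" where
  "normal_row c I u w = (\<Sum>i\<in>I. fst (c i) u * homogenize (c i) w)"

lemma lin_form_normal_row:
  fixes y :: "'v option \<Rightarrow> int"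
  shows "lin_form W (normal_row c I u) y = (\<Sum>i\<in>I. fst (c i) u * lin_form W (homogenize (c i)) y)"
  by (simp add: lin_form_def normal_row_def sum_distrib_left sum_distrib_right sum.swap[of _ W I]
    mult_ac)

lemma abs_normal_row_le:
  assumes "\<And>i v. i \<in> I \<Longrightarrow> v \<in> V \<Longrightarrow> \<bar>fst (c i) v\<bar> \<le> int B" "\<And>i. i \<in> I \<Longrightarrow> \<bar>snd (c i)\<bar> \<le> int B"
    and "u \<in> V" "w \<in> option_set V"
  shows "\<bar>normal_row c I u w\<bar> \<le> int ((card I + 1) * B\<^sup>2)"
proof -
  have "\<bar>normal_row c I u w\<bar> \<le> (\<Sum>i\<in>I. \<bar>fst (c i) u * homogenize (c i) w\<bar>)"
    unfolding normal_row_def by (rule sum_abs)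
  also have "\<dots> \<le> (\<Sum>i\<in>I. int B * int B)"
    unfolding abs_mult using assms by (intro sum_mono mult_mono abs_homogenize_le) auto
  also have "\<dots> \<le> int ((card I + 1) * B\<^sup>2)" by (simp add: power2_eq_square distrib_right)
  finally show ?thesis .
qed

text \<open>The normal equations form a square system, so after homogenization there is one more unknown
  than there are equations and Siegel's lemma applies.\<close>

lemma unique_solution_height:
  fixes c :: "'i \<Rightarrow> 'v constraint" and B :: nat and x :: "'v \<Rightarrow> real"
  assumes fin: "finite V" "finite I" and B: "1 \<le> B"
    and coeffs: "\<And>i v. i \<in> I \<Longrightarrow> v \<in> V \<Longrightarrow> \<bar>fst (c i) v\<bar> \<le> int B" "\<And>i. i \<in> I \<Longrightarrow> \<bar>snd (c i)\<bar> \<le> int B"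
    and solution: "\<And>i. i \<in> I \<Longrightarrow> lin_form V (fst (c i)) x = of_int (snd (c i))"
    and unique: "\<And>z :: 'v \<Rightarrow> real. (\<And>i. i \<in> I \<Longrightarrow> lin_form V (fst (c i)) z = 0) \<Longrightarrow>
      (\<And>v. v \<in> V \<Longrightarrow> z v = 0)"
  shows "height_le V (system_height (card V) (card I) B) x"
proof -
  define X where "X = system_height (card V) (card I) B"
  obtain y where nonzero: "\<exists>w\<in>option_set V. y w \<noteq> 0"
    and gram: "\<And>u. u \<in> V \<Longrightarrow> lin_form (option_set V) (normal_row c I u) y = 0"
    and y_bound: "\<And>w. w \<in> option_set V \<Longrightarrow> \<bar>y w\<bar> \<le> int X"
  proof (rule siegel[of "option_set V" V "(card I + 1) * B\<^sup>2" "normal_row c I"])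
    show "card V < card (option_set V)" using fin by (simp add: card_option_set)
    show "1 \<le> (card I + 1) * B\<^sup>2" using B by (simp add: Suc_le_eq)
  qed (use fin abs_normal_row_le[of I V c B] coeffs in
      \<open>simp_all only: option_set_simps X_def system_height_def card_option_set\<close>)
  define t where "t = y None"
  define z where "z v = y (Some v) - t * x v" for v
  have lin_z: "lin_form V (fst (c i)) z = lin_form (option_set V) (homogenize (c i)) y"
    if "i \<in> I" for i
    using fin by (simp add: z_def[abs_def] lin_form_diff lin_form_scale solution[OF that]
        lin_form_homogenize of_int_lin_form t_def)
  have z_zero: "z v = 0" if "v \<in> V" for v
  proof (rule unique[OF normal_equations_kernel[OF fin(2), where a = "\<lambda>i. fst (c i)"] that])
    fix u assume "u \<in> V"
    then have "real_of_int (\<Sum>i\<in>I. fst (c i) u * lin_form (option_set V) (homogenize (c i)) y) = 0"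
      using gram by (simp flip: lin_form_normal_row)
    then show "(\<Sum>i\<in>I. of_int (fst (c i) u) * lin_form V (fst (c i)) z) = 0"
      by (simp add: lin_z)
  qed
  have "t \<noteq> 0"
  proof
    assume "t = 0"
    then have "y w = 0" if "w \<in> option_set V" for w
      using that z_zero by (cases w) (auto simp: z_def t_def)
    then show False using nonzero by blast
  qed
  then have "1 \<le> \<bar>t\<bar>" "\<bar>t\<bar> \<le> int X" using y_bound[of None] by (auto simp: t_def)
  moreover have "\<bar>sgn t * y (Some v)\<bar> \<le> int X \<and> x v = of_int (sgn t * y (Some v)) / of_int \<bar>t\<bar>"
    if "v \<in> V" for v
    using y_bound[of "Some v"] z_zero[OF that] that \<open>t \<noteq> 0\<close>
    by (auto simp: z_def abs_mult sgn_if field_simps)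
  ultimately show ?thesis
    unfolding height_le_def X_def[symmetric]
    by (intro exI[of _ "\<bar>t\<bar>"] exI[of _ "\<lambda>v. sgn t * y (Some v)"]) blast
qed

lemma minimal_support_kernel:
  fixes V :: "'v set" and y z :: "'v \<Rightarrow> real"
  defines "J \<equiv> {v \<in> V. y v \<noteq> 0}"
  assumes "finite V"
    and minimal: "\<And>y'. (\<And>i. i \<in> I \<Longrightarrow> lin_form V (a i) y' = lin_form V (a i) y) \<Longrightarrow>
      card J \<le> card {v \<in> V. y' v \<noteq> 0}"
    and kernel: "\<And>i. i \<in> I \<Longrightarrow> lin_form J (a i) z = 0" and v: "v \<in> J"
  shows "z v = 0"
proof (rule ccontr)
  assume "z v \<noteq> 0"
  define z' where "z' u = (if u \<in> J then z u else 0)" for u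
  define y' where "y' u = y u - (y v / z v) * z' u" for u
  have "lin_form V (a i) y' = lin_form V (a i) y" if "i \<in> I" for i
  proof -
    have "lin_form V (a i) z' = lin_form J (a i) z'"
      using \<open>finite V\<close> by (intro lin_form_support) (auto simp: z'_def J_def)
    also have "\<dots> = lin_form J (a i) z" by (rule lin_form_cong) (simp add: z'_def)
    also have "\<dots> = 0" using kernel[OF that] .
    finally show ?thesis unfolding y'_def[abs_def] lin_form_diff lin_form_scale by simp
  qed
  then have "card J \<le> card {v \<in> V. y' v \<noteq> 0}" by (rule minimal)
  have "{v \<in> V. y' v \<noteq> 0} \<subseteq> J" by (auto simp: y'_def z'_def J_def split: if_splits)
  moreover have "v \<notin> {v \<in> V. y' v \<noteq> 0}" using v \<open>z v \<noteq> 0\<close> by (simp add: y'_def z'_def)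
  ultimately have "{v \<in> V. y' v \<noteq> 0} \<subset> J" using v by (intro psubsetI) auto
  moreover have "finite J" using \<open>finite V\<close> unfolding J_def by (rule finite_subset[rotated]) auto
  ultimately have "card {v \<in> V. y' v \<noteq> 0} < card J" by (intro psubset_card_mono)
  then show False using \<open>card J \<le> card {v \<in> V. y' v \<noteq> 0}\<close> by linarith
qed

lemma linear_system_height:
  fixes c :: "'i \<Rightarrow> 'v constraint" and B :: nat and x :: "'v \<Rightarrow> real"
  assumes fin: "finite V" "finite I" and B: "1 \<le> B"
    and coeffs: "\<And>i v. i \<in> I \<Longrightarrow> v \<in> V \<Longrightarrow> \<bar>fst (c i) v\<bar> \<le> int B" "\<And>i. i \<in> I \<Longrightarrow> \<bar>snd (c i)\<bar> \<le> int B"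
    and solution: "\<And>i. i \<in> I \<Longrightarrow> lin_form V (fst (c i)) x = of_int (snd (c i))"
  obtains y where "height_le V (system_height (card V) (card I) B) y"
    "\<And>i. i \<in> I \<Longrightarrow> lin_form V (fst (c i)) y = of_int (snd (c i))"
proof -
  define sol where "sol y \<longleftrightarrow> (\<forall>i\<in>I. lin_form V (fst (c i)) y = of_int (snd (c i)))"
    for y :: "'v \<Rightarrow> real"
  obtain y where y: "sol y"
    and minimal: "\<And>y'. sol y' \<Longrightarrow> card {v \<in> V. y v \<noteq> 0} \<le> card {v \<in> V. y' v \<noteq> 0}"
    using ex_has_least_nat[of sol x "\<lambda>y. card {v \<in> V. y v \<noteq> 0}"] solution unfolding sol_def by blast
  define J where "J = {v \<in> V. y v \<noteq> 0}"
  have J: "finite J" "J \<subseteq> V" using fin by (auto simp: J_def)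
  have "height_le J (system_height (card J) (card I) B) y"
  proof (rule unique_solution_height[OF J(1) fin(2) B, where c = c])
    show "lin_form J (fst (c i)) y = of_int (snd (c i))" if "i \<in> I" for i
      using y that lin_form_support[OF fin(1) J(2), of y "fst (c i)"] by (simp add: sol_def J_def)
    show "z v = 0" if "\<And>i. i \<in> I \<Longrightarrow> lin_form J (fst (c i)) z = 0" "v \<in> J" for z :: "'v \<Rightarrow> real" and v
    proof (rule minimal_support_kernel[OF fin(1), where y = y and I = I and a = "\<lambda>i. fst (c i)"])
      fix y' :: "'v \<Rightarrow> real"
      assume "\<And>i. i \<in> I \<Longrightarrow> lin_form V (fst (c i)) y' = lin_form V (fst (c i)) y"
      then have "sol y'" using y by (simp add: sol_def)
      then show "card {v \<in> V. y v \<noteq> 0} \<le> card {v \<in> V. y' v \<noteq> 0}" by (rule minimal)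
    qed (use that in \<open>auto simp: J_def\<close>)
  qed (use coeffs J in auto)
  then have "height_le J (system_height (card V) (card I) B) y"
    by (rule height_le_mono[OF _ system_height_mono[OF card_mono[OF fin(1) J(2)] B]])
  then obtain t n where t: "1 \<le> t" "t \<le> int (system_height (card V) (card I) B)"
    and n: "\<forall>v\<in>J. \<bar>n v\<bar> \<le> int (system_height (card V) (card I) B)"
      "\<forall>v\<in>J. y v = of_int (n v) / of_int t"
    by (rule height_leE)
  have "height_le V (system_height (card V) (card I) B) y"
    unfolding height_le_def
  proof (intro exI[of _ t] exI[of _ "\<lambda>v. if v \<in> J then n v else 0"] conjI ballI)
    show "\<bar>if v \<in> J then n v else 0\<bar> \<le> int (system_height (card V) (card I) B)" for v
      using n(1) by simp
    show "y v = of_int (if v \<in> J then n v else 0) / of_int t" if "v \<in> V" for v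
    proof (cases "v \<in> J")
      case False
      then show ?thesis using that by (simp add: J_def)
    qed (use n(2) in simp)
  qed (fact t)+
  then show thesis using y by (intro that) (auto simp: sol_def)
qed

section \<open>Quadratic programs on polytopes\<close>

definition bil_form :: "'v set \<Rightarrow> ('v \<Rightarrow> 'v \<Rightarrow> int) \<Rightarrow> ('v \<Rightarrow> 'a) \<Rightarrow> ('v \<Rightarrow> 'a) \<Rightarrow> 'a :: comm_ring_1" where
  "bil_form V Q x y = (\<Sum>u\<in>V. \<Sum>v\<in>V. of_int (Q u v) * x u * y v)"

definition quad_fun :: "'v set \<Rightarrow> ('v \<Rightarrow> 'v \<Rightarrow> int) \<Rightarrow> ('v \<Rightarrow> int) \<Rightarrow> ('v \<Rightarrow> 'a) \<Rightarrow> 'a :: comm_ring_1" where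
  "quad_fun V Q g x = bil_form V Q x x + lin_form V g x"

text \<open>There are two bilinear terms because \<open>Q\<close> need not be symmetric.\<close>

definition quad_deriv ::
  "'v set \<Rightarrow> ('v \<Rightarrow> 'v \<Rightarrow> int) \<Rightarrow> ('v \<Rightarrow> int) \<Rightarrow> ('v \<Rightarrow> 'a) \<Rightarrow> ('v \<Rightarrow> 'a) \<Rightarrow> 'a :: comm_ring_1" where
  "quad_deriv V Q g x y = bil_form V Q x y + bil_form V Q y x + lin_form V g y"

lemma bil_form_cong:
  "(\<And>v. v \<in> V \<Longrightarrow> x v = x' v) \<Longrightarrow> (\<And>v. v \<in> V \<Longrightarrow> y v = y' v) \<Longrightarrow>
    bil_form V Q x y = bil_form V Q x' y'"
  by (simp add: bil_form_def)

lemma quad_fun_cong: "(\<And>v. v \<in> V \<Longrightarrow> x v = y v) \<Longrightarrow> quad_fun V Q g x = quad_fun V Q g y"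
  unfolding quad_fun_def by (intro arg_cong2[where f = "(+)"] bil_form_cong lin_form_cong)

lemma bil_form_zero [simp]: "bil_form V (\<lambda>_ _. 0) x y = 0"
  by (simp add: bil_form_def)

lemma bil_form_add_left: "bil_form V Q (\<lambda>v. x v + y v) z = bil_form V Q x z + bil_form V Q y z"
  by (simp add: bil_form_def distrib_left distrib_right sum.distrib)

lemma bil_form_add_right: "bil_form V Q z (\<lambda>v. x v + y v) = bil_form V Q z x + bil_form V Q z y"
  by (simp add: bil_form_def distrib_left sum.distrib)

lemma bil_form_scale_left: "bil_form V Q (\<lambda>v. s * x v) z = s * bil_form V Q x z"
  by (simp add: bil_form_def sum_distrib_left mult_ac)

lemma bil_form_scale_right: "bil_form V Q z (\<lambda>v. s * x v) = s * bil_form V Q z x"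
  by (simp add: bil_form_def sum_distrib_left mult_ac)

lemma bil_form_sum_left:
  "bil_form V Q (\<lambda>v. \<Sum>i\<in>I. f i v) z = (\<Sum>i\<in>I. bil_form V Q (f i) z)"
  by (induction I rule: infinite_finite_induct)
    (simp_all add: bil_form_add_left, simp_all add: bil_form_def)

lemma bil_form_sum_right:
  "bil_form V Q z (\<lambda>v. \<Sum>i\<in>I. f i v) = (\<Sum>i\<in>I. bil_form V Q z (f i))"
  by (induction I rule: infinite_finite_induct)
    (simp_all add: bil_form_add_right, simp_all add: bil_form_def)

lemma of_int_bil_form:
  "of_int (bil_form V Q x y) = bil_form V Q (\<lambda>v. of_int (x v)) (\<lambda>v. of_int (y v))"
  by (simp add: bil_form_def)

lemmas form_linear_simps =
  lin_form_add lin_form_scale bil_form_add_left bil_form_add_right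
  bil_form_scale_left bil_form_scale_right

lemma quad_deriv_eq_sum:
  "quad_deriv V Q g x y = (\<Sum>u\<in>V. y u * ((\<Sum>v\<in>V. of_int (Q u v + Q v u) * x v) + of_int (g u)))"
proof -
  have "bil_form V Q x y = (\<Sum>u\<in>V. y u * (\<Sum>v\<in>V. of_int (Q v u) * x v))"
    unfolding bil_form_def by (subst sum.swap) (simp add: sum_distrib_left mult_ac)
  moreover have "bil_form V Q y x = (\<Sum>u\<in>V. y u * (\<Sum>v\<in>V. of_int (Q u v) * x v))"
    by (simp add: bil_form_def sum_distrib_left mult_ac)
  moreover have "lin_form V g y = (\<Sum>u\<in>V. y u * of_int (g u))"
    by (simp add: lin_form_def mult.commute)
  ultimately show ?thesis
    by (simp add: quad_deriv_def sum.distrib distrib_left distrib_right)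
qed

lemma quad_deriv_diff_left:
  fixes x x' y :: "'v \<Rightarrow> 'a :: comm_ring_1"
  shows "quad_deriv V Q g x y - quad_deriv V Q g x' y =
    bil_form V Q (\<lambda>v. x v - x' v) y + bil_form V Q y (\<lambda>v. x v - x' v)"
proof -
  have "bil_form V Q x z = bil_form V Q (\<lambda>v. x v - x' v) z + bil_form V Q x' z" for z
    using bil_form_add_left[of V Q "\<lambda>v. x v - x' v" x' z] by simp
  moreover have "bil_form V Q z x = bil_form V Q z (\<lambda>v. x v - x' v) + bil_form V Q z x'" for z
    using bil_form_add_right[of V Q z "\<lambda>v. x v - x' v" x'] by simp
  ultimately show ?thesis by (simp add: quad_deriv_def)
qed

lemma quad_fun_add_scaled:
  "quad_fun V Q g (\<lambda>v. x v + s * y v) =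
      quad_fun V Q g x + s * quad_deriv V Q g x y + s\<^sup>2 * bil_form V Q y y"
  by (simp add: quad_fun_def quad_deriv_def form_linear_simps power2_eq_square algebra_simps)

definition polyhedron_of :: "'v set \<Rightarrow> 'v constraint set \<Rightarrow> ('v \<Rightarrow> real) set" where
  "polyhedron_of V Cs = {x. \<forall>c\<in>Cs. lin_form V (fst c) x \<le> of_int (snd c)}"

lemma polyhedron_ofD: "x \<in> polyhedron_of V Cs \<Longrightarrow> c \<in> Cs \<Longrightarrow> lin_form V (fst c) x \<le> of_int (snd c)"
  by (simp add: polyhedron_of_def)

lemma polyhedron_of_cong:
  "(\<And>v. v \<in> V \<Longrightarrow> x v = y v) \<Longrightarrow> x \<in> polyhedron_of V Cs \<longleftrightarrow> y \<in> polyhedron_of V Cs"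
  unfolding polyhedron_of_def using lin_form_cong[of V x y] by simp

lemma polyhedron_of_Un: "polyhedron_of V (Cs \<union> Cs') = polyhedron_of V Cs \<inter> polyhedron_of V Cs'"
  by (auto simp: polyhedron_of_def)

definition equations :: "'v constraint set \<Rightarrow> 'v constraint set" where
  "equations S = S \<union> (\<lambda>c. (\<lambda>v. - fst c v, - snd c)) ` S"

lemma polyhedron_of_equations:
  "polyhedron_of V (equations S) = {x. \<forall>c\<in>S. lin_form V (fst c) x = of_int (snd c)}"
  by (auto simp: polyhedron_of_def equations_def lin_form_minus_left ball_Un intro: antisym)

lemma finite_equations: "finite S \<Longrightarrow> finite (equations S)"
  by (simp add: equations_def)

lemma card_equations_le:
  assumes "finite S"
  shows "card (equations S) \<le> 2 * card S"
  using card_Un_le[of S "(\<lambda>c. (\<lambda>v. - fst c v, - snd c)) ` S"]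
    card_image_le[OF assms, of "\<lambda>c. (\<lambda>v. - fst c v, - snd c)"]
  by (simp add: equations_def)

definition cube :: "'v set \<Rightarrow> nat \<Rightarrow> ('v \<Rightarrow> 'a :: linordered_idom) set" where
  "cube V s = {x. \<forall>v\<in>V. \<bar>x v\<bar> \<le> 2 ^ s}"

lemma cubeI: "(\<And>v. v \<in> V \<Longrightarrow> \<bar>x v\<bar> \<le> 2 ^ s) \<Longrightarrow> x \<in> cube V s"
  by (simp add: cube_def)

lemma cubeD: "x \<in> cube V s \<Longrightarrow> v \<in> V \<Longrightarrow> \<bar>x v\<bar> \<le> 2 ^ s"
  by (simp add: cube_def)

lemma power2_le_trans:
  fixes x :: "'a :: linordered_idom"
  shows "x \<le> 2 ^ i \<Longrightarrow> i \<le> j \<Longrightarrow> x \<le> 2 ^ j"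
  by (erule order_trans) (simp add: power_increasing)

lemma abs_of_int_le_power: "\<bar>i\<bar> \<le> 2 ^ k \<Longrightarrow> \<bar>of_int i :: 'a :: linordered_idom\<bar> \<le> 2 ^ k"
  by (simp flip: of_int_abs)

lemma abs_mult_le_power:
  fixes x y :: "'a :: linordered_idom"
  shows "\<bar>x\<bar> \<le> 2 ^ i \<Longrightarrow> \<bar>y\<bar> \<le> 2 ^ j \<Longrightarrow> \<bar>x * y\<bar> \<le> 2 ^ (i + j)"
  unfolding abs_mult power_add by (intro mult_mono) auto

lemma abs_sum_le_power:
  fixes f :: "'a \<Rightarrow> 'b :: linordered_idom"
  assumes "card A \<le> n" "\<And>a. a \<in> A \<Longrightarrow> \<bar>f a\<bar> \<le> 2 ^ k"
  shows "\<bar>sum f A\<bar> \<le> 2 ^ (n + k)"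
proof -
  have "\<bar>sum f A\<bar> \<le> (\<Sum>a\<in>A. \<bar>f a\<bar>)" by (rule sum_abs)
  also have "\<dots> \<le> of_nat (card A) * 2 ^ k" using assms(2) by (intro sum_bounded_above) auto
  also have "\<dots> \<le> 2 ^ n * 2 ^ k"
  proof (rule mult_right_mono)
    have "(of_nat (card A) :: 'b) \<le> of_nat n" using assms(1) by simp
    also have "\<dots> \<le> 2 ^ n" by (simp add: less_imp_le)
    finally show "(of_nat (card A) :: 'b) \<le> 2 ^ n" .
  qed simp
  finally show ?thesis by (simp add: power_add)
qed

lemma cube_mono: "s \<le> t \<Longrightarrow> x \<in> cube V s \<Longrightarrow> x \<in> cube V t"
  unfolding cube_def by (auto intro: power2_le_trans)

lemma zero_mem_cube [simp]: "(\<lambda>_. 0) \<in> cube V s"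
  by (simp add: cube_def)

lemma of_int_mem_cube: "(\<lambda>v. real_of_int (r v)) \<in> cube V s \<longleftrightarrow> r \<in> cube V s"
  by (simp add: cube_def flip: of_int_abs)

definition constraints_le :: "'v set \<Rightarrow> 'v constraint set \<Rightarrow> nat \<Rightarrow> bool" where
  "constraints_le V Cs s \<longleftrightarrow> (\<forall>c\<in>Cs. fst c \<in> cube V s \<and> \<bar>snd c\<bar> \<le> 2 ^ s)"

lemma constraints_le_Un:
  "constraints_le V (Cs \<union> Cs') s \<longleftrightarrow> constraints_le V Cs s \<and> constraints_le V Cs' s"
  by (auto simp: constraints_le_def)

lemma constraints_le_equations: "constraints_le V (equations S) s \<longleftrightarrow> constraints_le V S s"
  by (auto simp: constraints_le_def equations_def cube_def)

lemma constraints_le_mono: "constraints_le V Cs s \<Longrightarrow> s \<le> t \<Longrightarrow> constraints_le V Cs t"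
  unfolding constraints_le_def by (auto intro: cube_mono power2_le_trans)

definition polyhedron_size_le :: "'v set \<Rightarrow> 'v constraint set \<Rightarrow> nat \<Rightarrow> bool" where
  "polyhedron_size_le V Cs s \<longleftrightarrow>
     finite V \<and> finite Cs \<and> card V + card Cs \<le> s \<and> constraints_le V Cs s"

lemma polyhedron_size_le_mono:
  "polyhedron_size_le V Cs s \<Longrightarrow> s \<le> t \<Longrightarrow> polyhedron_size_le V Cs t"
  unfolding polyhedron_size_le_def using constraints_le_mono by fastforce

definition quad_size_le :: "'v set \<Rightarrow> ('v \<Rightarrow> 'v \<Rightarrow> int) \<Rightarrow> ('v \<Rightarrow> int) \<Rightarrow> nat \<Rightarrow> bool" where
  "quad_size_le V Q g s \<longleftrightarrow> (\<forall>u\<in>V. Q u \<in> cube V s) \<and> g \<in> cube V s"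

lemma quad_size_le_mono: "quad_size_le V Q g s \<Longrightarrow> s \<le> t \<Longrightarrow> quad_size_le V Q g t"
  unfolding quad_size_le_def by (auto intro: cube_mono)

definition minimizers ::
  "'v set \<Rightarrow> 'v constraint set \<Rightarrow> ('v \<Rightarrow> 'v \<Rightarrow> int) \<Rightarrow> ('v \<Rightarrow> int) \<Rightarrow> ('v \<Rightarrow> real) set" where
  "minimizers V Cs Q g =
     {x \<in> polyhedron_of V Cs. \<forall>y\<in>polyhedron_of V Cs. quad_fun V Q g x \<le> quad_fun V Q g y}"

lemma continuous_on_lin_form: "continuous_on A (lin_form V a :: ('v \<Rightarrow> real) \<Rightarrow> real)"
  unfolding lin_form_def
  by (intro continuous_intros continuous_on_subset[OF continuous_on_product_coordinates]) simp

lemma continuous_on_quad_fun: "continuous_on A (quad_fun V Q g :: ('v \<Rightarrow> real) \<Rightarrow> real)"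
  unfolding quad_fun_def bil_form_def
  by (intro continuous_intros continuous_on_lin_form
      continuous_on_subset[OF continuous_on_product_coordinates]) simp_all

lemma closed_polyhedron_of: "closed (polyhedron_of V Cs)"
proof -
  have "polyhedron_of V Cs = (\<Inter>c\<in>Cs. {x. lin_form V (fst c) x \<le> real_of_int (snd c)})"
    by (auto simp: polyhedron_of_def)
  moreover have "closed {x. lin_form V (fst c) x \<le> real_of_int (snd c)}" for c :: "'a constraint"
    by (rule closed_Collect_le[OF continuous_on_lin_form continuous_on_const])
  ultimately show ?thesis by auto
qed

definition bounded_on :: "'v set \<Rightarrow> ('v \<Rightarrow> real) set \<Rightarrow> bool" where
  "bounded_on V S \<longleftrightarrow> (\<exists>\<gamma>. \<forall>x\<in>S. \<forall>v\<in>V. \<bar>x v\<bar> \<le> \<gamma>)"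

lemma bounded_on_subset_cube: "S \<subseteq> cube V s \<Longrightarrow> bounded_on V S"
  unfolding bounded_on_def by (intro exI[of _ "2 ^ s"]) (auto simp: cube_def)

lemma minimizers_nonempty:
  assumes x0: "x0 \<in> polyhedron_of V Cs"
    and bounded: "bounded_on V (polyhedron_of V Cs)"
  obtains x where "x \<in> minimizers V Cs Q g"
proof -
  obtain \<gamma> where \<gamma>: "\<And>x v. x \<in> polyhedron_of V Cs \<Longrightarrow> v \<in> V \<Longrightarrow> \<bar>x v\<bar> \<le> \<gamma>"
    using bounded unfolding bounded_on_def by blast
  define box where "box = PiE UNIV (\<lambda>v. if v \<in> V then {-\<gamma>..\<gamma>} else {0})"
  have "compactin (product_topology (\<lambda>_. euclidean) UNIV) box"
    unfolding box_def compactin_PiE by auto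
  then have "compact (box \<inter> polyhedron_of V Cs)"
    by (intro compact_Int_closed closed_polyhedron_of) (simp add: euclidean_product_topology)
  define restr where "restr y = (\<lambda>v. if v \<in> V then y v else (0::real))" for y
  have restr_in: "restr y \<in> box \<inter> polyhedron_of V Cs" if y: "y \<in> polyhedron_of V Cs" for y
  proof
    have "restr y v \<in> (if v \<in> V then {-\<gamma>..\<gamma>} else {0})" for v
      using \<gamma>[OF y, of v] by (auto simp: restr_def abs_le_iff)
    then show "restr y \<in> box" by (auto simp: box_def)
    show "restr y \<in> polyhedron_of V Cs"
      using y polyhedron_of_cong[of V "restr y" y Cs] by (simp add: restr_def)
  qed
  have quad_restr: "quad_fun V Q g (restr y) = quad_fun V Q g y" for y
    by (rule quad_fun_cong) (simp add: restr_def)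
  obtain x where x: "x \<in> box \<inter> polyhedron_of V Cs"
    and least: "\<And>y. y \<in> box \<inter> polyhedron_of V Cs \<Longrightarrow> quad_fun V Q g x \<le> quad_fun V Q g y"
    using continuous_attains_inf[OF \<open>compact (box \<inter> polyhedron_of V Cs)\<close> _ continuous_on_quad_fun]
      restr_in[OF x0] by blast
  have "quad_fun V Q g x \<le> quad_fun V Q g y" if "y \<in> polyhedron_of V Cs" for y
    using least[OF restr_in[OF that]] by (simp only: quad_restr)
  then show thesis using x by (intro that[of x]) (simp add: minimizers_def)
qed

definition active :: "'v set \<Rightarrow> 'v constraint set \<Rightarrow> ('v \<Rightarrow> real) \<Rightarrow> 'v constraint set" where
  "active V Cs x = {c \<in> Cs. lin_form V (fst c) x = of_int (snd c)}"

lemma active_directions_feasible: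
  assumes fin: "finite Cs" and x: "x \<in> polyhedron_of V Cs"
    and y: "\<And>c. c \<in> active V Cs x \<Longrightarrow> lin_form V (fst c) y = 0"
  obtains d :: real where "0 < d" "\<And>s. \<bar>s\<bar> < d \<Longrightarrow> (\<lambda>v. x v + s * y v) \<in> polyhedron_of V Cs"
proof -
  have "\<forall>\<^sub>F s in nhds 0. lin_form V (fst c) x + s * lin_form V (fst c) y \<le> of_int (snd c)"
    if c: "c \<in> Cs" for c
  proof (cases "c \<in> active V Cs x")
    case True
    then show ?thesis using y polyhedron_ofD[OF x c] by simp
  next
    case False
    then have "lin_form V (fst c) x < of_int (snd c)"
      using polyhedron_ofD[OF x c] c by (simp add: active_def)
    moreover have "((\<lambda>s. lin_form V (fst c) x + s * lin_form V (fst c) y)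
        \<longlongrightarrow> lin_form V (fst c) x + 0 * lin_form V (fst c) y) (nhds 0)"
      by (intro tendsto_intros filterlim_ident)
    ultimately have "\<forall>\<^sub>F s in nhds 0.
        lin_form V (fst c) x + s * lin_form V (fst c) y < of_int (snd c)"
      by (intro order_tendstoD(2)) auto
    then show ?thesis by (rule eventually_mono) simp
  qed
  then have "\<forall>\<^sub>F s in nhds 0. \<forall>c\<in>Cs.
      lin_form V (fst c) x + s * lin_form V (fst c) y \<le> of_int (snd c)"
    using fin by (simp add: eventually_ball_finite)
  then obtain d where "0 < d"
      "\<And>s. \<bar>s\<bar> < d \<Longrightarrow> \<forall>c\<in>Cs. lin_form V (fst c) x + s * lin_form V (fst c) y \<le> of_int (snd c)"
    by (auto simp: eventually_nhds_metric dist_real_def)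
  then show thesis
    by (intro that[of d]) (simp_all add: polyhedron_of_def lin_form_add lin_form_scale)
qed

lemma linear_coeff_nonneg:
  fixes G K d :: real
  assumes "0 < d" and nonneg: "\<And>s. 0 < s \<Longrightarrow> s < d \<Longrightarrow> 0 \<le> s * G + s\<^sup>2 * K"
  shows "0 \<le> G"
proof (rule tendsto_lowerbound)
  have "((\<lambda>s. G + s * K) \<longlongrightarrow> G + 0 * K) (at_right 0)" by (intro tendsto_intros)
  then show "((\<lambda>s. G + s * K) \<longlongrightarrow> G) (at_right 0)" by simp
  have "\<forall>\<^sub>F s in at_right 0. s \<in> {0<..<d}"
    using \<open>0 < d\<close> by (rule eventually_at_right_real)
  then show "\<forall>\<^sub>F s in at_right 0. 0 \<le> G + s * K"
  proof (rule eventually_mono)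
    fix s assume s: "s \<in> {0<..<d}"
    then have "0 \<le> s * (G + s * K)" using nonneg[of s] by (simp add: power2_eq_square algebra_simps)
    then show "0 \<le> G + s * K" using s by (simp add: zero_le_mult_iff)
  qed
qed simp

lemma minimizer_stationary:
  assumes fin: "finite Cs" and x: "x \<in> minimizers V Cs Q g"
    and y: "\<And>c. c \<in> active V Cs x \<Longrightarrow> lin_form V (fst c) y = 0"
  shows "quad_deriv V Q g x y = 0"
proof -
  have x_mem: "x \<in> polyhedron_of V Cs" using x by (simp add: minimizers_def)
  obtain d where "0 < d" and feasible: "\<And>s. \<bar>s\<bar> < d \<Longrightarrow> (\<lambda>v. x v + s * y v) \<in> polyhedron_of V Cs"
    using active_directions_feasible[OF fin x_mem y] by blast
  have nonneg: "0 \<le> s * quad_deriv V Q g x y + s\<^sup>2 * bil_form V Q y y" if "\<bar>s\<bar> < d" for s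
    using x feasible[OF that] quad_fun_add_scaled[of V Q g x s y] by (auto simp: minimizers_def)
  have "0 \<le> quad_deriv V Q g x y"
    by (rule linear_coeff_nonneg[OF \<open>0 < d\<close> nonneg]) simp
  moreover have "0 \<le> - quad_deriv V Q g x y"
  proof (rule linear_coeff_nonneg[OF \<open>0 < d\<close>])
    show "0 \<le> s * - quad_deriv V Q g x y + s\<^sup>2 * bil_form V Q y y" if "0 < s" "s < d" for s
      using nonneg[of "- s"] that by simp
  qed
  ultimately show ?thesis by simp
qed

definition linear_functional :: "(('v \<Rightarrow> real) \<Rightarrow> real) \<Rightarrow> bool" where
  "linear_functional f \<longleftrightarrow> (\<forall>x y s. f (\<lambda>v. x v + s * y v) = f x + s * f y)"

lemma linear_functional_lin_form: "linear_functional (lin_form V a)"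
  by (simp add: linear_functional_def lin_form_add lin_form_scale)

lemma linear_functional_quad_deriv: "linear_functional (quad_deriv V Q g x)"
  by (simp add: linear_functional_def quad_deriv_def form_linear_simps algebra_simps)

lemma linear_functional_diff_scaled:
  "linear_functional f \<Longrightarrow> linear_functional g \<Longrightarrow> linear_functional (\<lambda>x. g x - k * f x)"
  by (simp add: linear_functional_def algebra_simps)

lemma functional_in_span:
  assumes "finite E" and "\<And>i. i \<in> E \<Longrightarrow> linear_functional (f i)" and "linear_functional g"
    and "\<And>x. (\<And>i. i \<in> E \<Longrightarrow> f i x = 0) \<Longrightarrow> g x = 0"
  shows "\<exists>l. \<forall>x. g x = (\<Sum>i\<in>E. l i * f i x)"
  using assms
proof (induction E arbitrary: g rule: finite_induct)
  case empty
  then show ?case by simp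
next
  case (insert e E)
  have "\<exists>k. \<forall>x. (\<forall>i\<in>E. f i x = 0) \<longrightarrow> g x = k * f e x"
  proof (cases "\<exists>u. (\<forall>i\<in>E. f i u = 0) \<and> f e u \<noteq> 0")
    case True
    then obtain u where u: "\<And>i. i \<in> E \<Longrightarrow> f i u = 0" "f e u \<noteq> 0" by blast
    have "g x = g u / f e u * f e x" if x: "\<And>i. i \<in> E \<Longrightarrow> f i x = 0" for x
    proof -
      let ?x' = "\<lambda>v. x v + - (f e x / f e u) * u v"
      have "f i ?x' = f i x - f e x / f e u * f i u" if "i \<in> insert e E" for i
        using insert.prems(1)[OF that] unfolding linear_functional_def by (simp only:)
      then have "g ?x' = 0" using u x by (intro insert.prems(3)) auto
      moreover have "g ?x' = g x - f e x / f e u * g u"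
        using insert.prems(2) unfolding linear_functional_def by (simp only:)
      ultimately show ?thesis by simp
    qed
    then show ?thesis by blast
  next
    case False
    then show ?thesis using insert.prems(3) by (intro exI[of _ 0]) auto
  qed
  then obtain k where k: "\<And>x. (\<And>i. i \<in> E \<Longrightarrow> f i x = 0) \<Longrightarrow> g x = k * f e x" by blast
  have "\<exists>l. \<forall>x. g x - k * f e x = (\<Sum>i\<in>E. l i * f i x)"
    using insert.prems k by (intro insert.IH linear_functional_diff_scaled) auto
  then obtain l where l: "\<And>x. g x - k * f e x = (\<Sum>i\<in>E. l i * f i x)" by blast
  have "g x = (\<Sum>i\<in>insert e E. (l(e := k)) i * f i x)" for x
  proof -
    have "(\<Sum>i\<in>E. (l(e := k)) i * f i x) = (\<Sum>i\<in>E. l i * f i x)"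
      using insert.hyps by (intro sum.cong) auto
    then show ?thesis using l[of x] insert.hyps by simp
  qed
  then show ?case by blast
qed

text \<open>Treating the multipliers as additional unknowns turns the first-order conditions into
  an integer linear system.\<close>

definition kkt_solution ::
  "'v set \<Rightarrow> 'v constraint set \<Rightarrow> ('v \<Rightarrow> 'v \<Rightarrow> int) \<Rightarrow> ('v \<Rightarrow> int) \<Rightarrow>
    ('v + 'v constraint \<Rightarrow> real) \<Rightarrow> bool" where
  "kkt_solution V E Q g X \<longleftrightarrow>
     (\<forall>c\<in>E. lin_form V (fst c) (X \<circ> Inl) = of_int (snd c)) \<and>
     (\<forall>y. quad_deriv V Q g (X \<circ> Inl) y = (\<Sum>c\<in>E. X (Inr c) * lin_form V (fst c) y))"

definition kkt_row :: "('v \<Rightarrow> 'v \<Rightarrow> int) \<Rightarrow> ('v \<Rightarrow> int) \<Rightarrow> 'v + 'v constraint \<Rightarrow>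
    ('v + 'v constraint) constraint" where
  "kkt_row Q g r = (case r of
     Inl u \<Rightarrow> (case_sum (\<lambda>v. Q u v + Q v u) (\<lambda>c. - fst c u), - g u)
   | Inr c \<Rightarrow> (case_sum (fst c) (\<lambda>_. 0), snd c))"

lemma sum_mult_eq_iff:
  fixes f h :: "'v \<Rightarrow> real"
  assumes "finite V"
  shows "(\<forall>y. (\<Sum>u\<in>V. y u * f u) = (\<Sum>u\<in>V. y u * h u)) \<longleftrightarrow> (\<forall>u\<in>V. f u = h u)"
proof
  assume sums: "\<forall>y. (\<Sum>u\<in>V. y u * f u) = (\<Sum>u\<in>V. y u * h u)"
  show "\<forall>u\<in>V. f u = h u"
  proof
    fix u assume u: "u \<in> V"
    have "(\<Sum>w\<in>V. (if w = u then 1 else 0) * k w) = k u" for k :: "'v \<Rightarrow> real"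
      using u assms by (simp add: if_distrib[of "\<lambda>a. a * _"] cong: if_cong)
    then show "f u = h u" using sums[rule_format, of "\<lambda>w. if w = u then 1 else 0"] by simp
  qed
qed simp

lemma kkt_solution_iff_rows:
  assumes fin: "finite V" "finite E"
  shows "kkt_solution V E Q g X \<longleftrightarrow>
    (\<forall>r\<in>V <+> E. lin_form (V <+> E) (fst (kkt_row Q g r)) X = of_int (snd (kkt_row Q g r)))"
proof -
  let ?grad = "\<lambda>u. (\<Sum>v\<in>V. of_int (Q u v + Q v u) * X (Inl v)) + of_int (g u)"
  have split: "lin_form (V <+> E) a X =
      (\<Sum>v\<in>V. of_int (a (Inl v)) * X (Inl v)) + (\<Sum>c\<in>E. of_int (a (Inr c)) * X (Inr c))"
    for a using fin by (simp add: lin_form_def sum.Plus)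
  have row_Inl: "lin_form (V <+> E) (fst (kkt_row Q g (Inl u))) X =
      of_int (snd (kkt_row Q g (Inl u))) \<longleftrightarrow>
      ?grad u = (\<Sum>c\<in>E. X (Inr c) * of_int (fst c u))" for u
    by (auto simp: split kkt_row_def sum_negf mult.commute)
  have row_Inr: "lin_form (V <+> E) (fst (kkt_row Q g (Inr c))) X =
      of_int (snd (kkt_row Q g (Inr c))) \<longleftrightarrow>
      lin_form V (fst c) (X \<circ> Inl) = of_int (snd c)" for c
    unfolding split by (simp add: kkt_row_def lin_form_def)
  have "quad_deriv V Q g (X \<circ> Inl) y = (\<Sum>u\<in>V. y u * ?grad u)" for y
    by (simp add: quad_deriv_eq_sum)
  moreover have "(\<Sum>c\<in>E. X (Inr c) * lin_form V (fst c) y) =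
      (\<Sum>u\<in>V. y u * (\<Sum>c\<in>E. X (Inr c) * of_int (fst c u)))" for y
    by (simp add: lin_form_def sum_distrib_left sum.swap[of _ V E] mult_ac)
  ultimately have "(\<forall>y. quad_deriv V Q g (X \<circ> Inl) y = (\<Sum>c\<in>E. X (Inr c) * lin_form V (fst c) y)) \<longleftrightarrow>
      (\<forall>u\<in>V. ?grad u = (\<Sum>c\<in>E. X (Inr c) * of_int (fst c u)))"
    by (simp only: sum_mult_eq_iff[OF fin(1)])
  then show ?thesis
    unfolding kkt_solution_def using row_Inl row_Inr by (auto simp: Plus_def ball_Un)
qed

lemma minimizer_kkt:
  assumes "finite Cs" and x: "x \<in> minimizers V Cs Q g"
  obtains l where "kkt_solution V (active V Cs x) Q g (case_sum x l)"
proof -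
  have "\<exists>l. \<forall>y. quad_deriv V Q g x y = (\<Sum>c\<in>active V Cs x. l c * lin_form V (fst c) y)"
    using assms by (intro functional_in_span linear_functional_lin_form linear_functional_quad_deriv
        minimizer_stationary) (auto simp: active_def)
  then obtain l where "\<And>y. quad_deriv V Q g x y = (\<Sum>c\<in>active V Cs x. l c * lin_form V (fst c) y)"
    by blast
  moreover have "case_sum x l \<circ> Inl = x" by auto
  ultimately have "kkt_solution V (active V Cs x) Q g (case_sum x l)"
    by (simp add: kkt_solution_def) (simp add: active_def)
  then show thesis by (rule that)
qed

lemma kkt_solution_diff:
  fixes X Y :: "'v + 'v constraint \<Rightarrow> real"
  assumes X: "kkt_solution V E Q g X" and Y: "kkt_solution V E Q g Y"
  defines "\<eta> \<equiv> \<lambda>v. Y (Inl v) - X (Inl v)"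
  shows "\<And>c. c \<in> E \<Longrightarrow> lin_form V (fst c) \<eta> = 0" and "bil_form V Q \<eta> \<eta> = 0"
proof -
  show tangent: "lin_form V (fst c) \<eta> = 0" if "c \<in> E" for c
    using X Y that unfolding \<eta>_def lin_form_diff by (simp add: kkt_solution_def comp_def)
  have "2 * bil_form V Q \<eta> \<eta> = quad_deriv V Q g (Y \<circ> Inl) \<eta> - quad_deriv V Q g (X \<circ> Inl) \<eta>"
    unfolding quad_deriv_diff_left by (simp add: \<eta>_def)
  also have "\<dots> = 0" using X Y tangent by (simp add: kkt_solution_def)
  finally show "bil_form V Q \<eta> \<eta> = 0" by simp
qed

lemma ray_hits_constraint:
  assumes "finite Cs" and x: "x \<in> polyhedron_of V Cs" and "\<exists>c\<in>Cs. 0 < lin_form V (fst c) y"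
  obtains s c where "0 \<le> s" "(\<lambda>v. x v + s * y v) \<in> polyhedron_of V Cs"
    "c \<in> active V Cs (\<lambda>v. x v + s * y v)" "0 < lin_form V (fst c) y"
proof -
  define Cp where "Cp = {c \<in> Cs. 0 < lin_form V (fst c) y}"
  define r where "r c = (of_int (snd c) - lin_form V (fst c) x) / lin_form V (fst c) y" for c
  have Cp: "finite Cp" "Cp \<noteq> {}" using assms by (auto simp: Cp_def)
  obtain c where c: "c \<in> Cp" and least: "\<And>c'. c' \<in> Cp \<Longrightarrow> r c \<le> r c'"
    using arg_min_if_finite[OF Cp, of r] by (metis not_le)
  have r_nonneg: "0 \<le> r c" using c x by (auto simp: r_def Cp_def polyhedron_of_def)
  have "lin_form V (fst c') x + r c * lin_form V (fst c') y \<le> of_int (snd c')"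
    if c': "c' \<in> Cs" for c'
  proof (cases "c' \<in> Cp")
    case True
    then have "r c * lin_form V (fst c') y \<le> r c' * lin_form V (fst c') y"
      using least by (intro mult_right_mono) (auto simp: Cp_def)
    also have "\<dots> = of_int (snd c') - lin_form V (fst c') x" using True by (simp add: r_def Cp_def)
    finally show ?thesis by simp
  next
    case False
    then have "r c * lin_form V (fst c') y \<le> 0"
      using c' r_nonneg by (auto simp: Cp_def mult_nonneg_nonpos)
    then show ?thesis using polyhedron_ofD[OF x c'] by simp
  qed
  moreover have "lin_form V (fst c) x + r c * lin_form V (fst c) y = of_int (snd c)"
    using c by (simp add: r_def Cp_def)
  ultimately show thesis
    using r_nonneg c by (intro that[of "r c" c])
      (auto simp: polyhedron_of_def active_def lin_form_add lin_form_scale Cp_def)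
qed

lemma bounded_polyhedron_direction:
  fixes y :: "'v \<Rightarrow> real"
  assumes x: "x \<in> polyhedron_of V Cs"
    and bounded: "bounded_on V (polyhedron_of V Cs)"
    and v: "v \<in> V" "y v \<noteq> 0"
  shows "\<exists>c\<in>Cs. 0 < lin_form V (fst c) y"
proof (rule ccontr)
  assume no_constraint: "\<not> ?thesis"
  obtain \<gamma> where \<gamma>: "\<And>x v. x \<in> polyhedron_of V Cs \<Longrightarrow> v \<in> V \<Longrightarrow> \<bar>x v\<bar> \<le> \<gamma>"
    using bounded unfolding bounded_on_def by blast
  define s where "s = (\<gamma> + \<bar>x v\<bar> + 1) / \<bar>y v\<bar>"
  have "0 \<le> \<gamma>" using \<gamma>[OF x v(1)] by linarith
  then have "0 \<le> s" by (simp add: s_def)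
  have "lin_form V (fst c) x + s * lin_form V (fst c) y \<le> of_int (snd c)" if "c \<in> Cs" for c
    using polyhedron_ofD[OF x that] no_constraint that \<open>0 \<le> s\<close>
      mult_nonneg_nonpos[of s "lin_form V (fst c) y"] by force
  then have "\<bar>x v + s * y v\<bar> \<le> \<gamma>"
    using \<gamma>[of "\<lambda>v. x v + s * y v"] v(1)
    by (simp add: polyhedron_of_def lin_form_add lin_form_scale)
  moreover have "\<bar>s * y v\<bar> = \<gamma> + \<bar>x v\<bar> + 1"
    using v(2) \<open>0 \<le> \<gamma>\<close> by (simp add: s_def abs_mult)
  ultimately show False by linarith
qed

text \<open>Along the difference of two solutions the objective is constant, and following it until it
  meets a further constraint would enlarge the active set.\<close>

lemma maximal_active_kkt_unique:
  assumes fin: "finite Cs" and x: "x \<in> minimizers V Cs Q g"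
    and maximal: "\<And>y. y \<in> minimizers V Cs Q g \<Longrightarrow> card (active V Cs y) \<le> card (active V Cs x)"
    and bounded: "bounded_on V (polyhedron_of V Cs)"
    and X: "kkt_solution V (active V Cs x) Q g (case_sum x l)"
    and Y: "kkt_solution V (active V Cs x) Q g Y" and v: "v \<in> V"
  shows "Y (Inl v) = x v"
proof (rule ccontr)
  define \<eta> where "\<eta> v = Y (Inl v) - x v" for v
  assume "Y (Inl v) \<noteq> x v"
  then have "\<eta> v \<noteq> 0" by (simp add: \<eta>_def)
  have tangent: "lin_form V (fst c) \<eta> = 0" if "c \<in> active V Cs x" for c
    using kkt_solution_diff(1)[OF X Y that] by (simp add: \<eta>_def[abs_def])
  have "bil_form V Q \<eta> \<eta> = 0"
    using kkt_solution_diff(2)[OF X Y] by (simp add: \<eta>_def[abs_def])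
  then have const: "quad_fun V Q g (\<lambda>v. x v + s * \<eta> v) = quad_fun V Q g x" for s
    using minimizer_stationary[OF fin x tangent] by (simp add: quad_fun_add_scaled)
  have x_mem: "x \<in> polyhedron_of V Cs" using x by (simp add: minimizers_def)
  define move where "move s = (\<lambda>v. x v + s * \<eta> v)" for s
  obtain s c where s: "move s \<in> polyhedron_of V Cs"
    and c: "c \<in> active V Cs (move s)" "0 < lin_form V (fst c) \<eta>"
    using ray_hits_constraint[OF fin x_mem bounded_polyhedron_direction[OF x_mem bounded v], of \<eta>]
      \<open>\<eta> v \<noteq> 0\<close>
    unfolding move_def by blast
  have "move s \<in> minimizers V Cs Q g"
    using s x const by (simp add: minimizers_def move_def)
  moreover have "active V Cs x \<subset> active V Cs (move s)"
  proof
    show "active V Cs x \<subseteq> active V Cs (move s)"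
      using tangent by (auto simp: active_def move_def lin_form_add lin_form_scale)
    show "active V Cs x \<noteq> active V Cs (move s)" using c tangent by (metis less_irrefl)
  qed
  moreover have "finite (active V Cs (move s))" using fin by (simp add: active_def)
  ultimately show False using maximal psubset_card_mono not_le by metis
qed

definition qp_exp :: "nat \<Rightarrow> nat" where
  "qp_exp s = (4 * s + 2) * s"

lemma system_height_le_qp_exp:
  assumes "k \<le> s"
  shows "system_height k k (2 ^ (s + 1)) \<le> 2 ^ qp_exp s"
proof -
  have "k + 1 \<le> 2 ^ s" using assms less_exp[of s] by linarith
  then have "(k + 1) * ((k + 1) * (2 ^ (s + 1))\<^sup>2) \<le> 2 ^ s * (2 ^ s * (2 ^ (s + 1))\<^sup>2)"
    by (intro mult_mono) auto
  also have "\<dots> = 2 ^ (4 * s + 2)"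
    by (simp flip: power_add power_mult add: algebra_simps)
  finally have "system_height k k (2 ^ (s + 1)) \<le> (2 ^ (4 * s + 2)) ^ k"
    unfolding system_height_def by (rule power_mono) simp
  also have "\<dots> \<le> (2 ^ (4 * s + 2)) ^ s" using assms by (intro power_increasing) auto
  finally show ?thesis by (simp only: power_mult qp_exp_def)
qed

lemma kkt_row_le:
  assumes Q: "quad_size_le V Q g s" and E: "constraints_le V E s" and r: "r \<in> V <+> E"
  shows "t \<in> V <+> E \<Longrightarrow> \<bar>fst (kkt_row Q g r) t\<bar> \<le> 2 ^ (s + 1)"
    and "\<bar>snd (kkt_row Q g r)\<bar> \<le> 2 ^ (s + 1)"
proof -
  have double: "\<bar>a\<bar> \<le> 2 ^ (s + 1)" if "\<bar>a\<bar> \<le> 2 ^ s" for a :: int using that by simp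
  have "\<bar>Q u v + Q v u\<bar> \<le> 2 ^ (s + 1)" if "u \<in> V" "v \<in> V" for u v
  proof -
    have "\<bar>Q u v\<bar> \<le> 2 ^ s" "\<bar>Q v u\<bar> \<le> 2 ^ s" using Q that by (auto simp: quad_size_le_def cube_def)
    then show ?thesis by simp
  qed
  then show "t \<in> V <+> E \<Longrightarrow> \<bar>fst (kkt_row Q g r) t\<bar> \<le> 2 ^ (s + 1)"
    using r E double unfolding constraints_le_def cube_def by (auto simp: kkt_row_def)
  show "\<bar>snd (kkt_row Q g r)\<bar> \<le> 2 ^ (s + 1)"
    using r Q E double unfolding constraints_le_def quad_size_le_def cube_def
    by (auto simp: kkt_row_def)
qed

theorem quadratic_program_height:
  fixes V :: "'v set"
  assumes size: "polyhedron_size_le V Cs s" "quad_size_le V Q g s"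
    and x0: "x0 \<in> polyhedron_of V Cs"
    and bounded: "bounded_on V (polyhedron_of V Cs)"
  obtains x where "x \<in> minimizers V Cs Q g" "height_le V (2 ^ qp_exp s) x"
proof -
  have fin: "finite V" "finite Cs" using size by (auto simp: polyhedron_size_le_def)
  obtain x1 where "x1 \<in> minimizers V Cs Q g" using minimizers_nonempty[OF x0 bounded] by blast
  moreover have "card (active V Cs y) < Suc (card Cs)" for y
    using fin by (simp add: active_def card_mono less_Suc_eq_le)
  ultimately obtain x where x: "x \<in> minimizers V Cs Q g"
    and maximal: "\<And>y. y \<in> minimizers V Cs Q g \<Longrightarrow> card (active V Cs y) \<le> card (active V Cs x)"
    using ex_has_greatest_nat[of "\<lambda>x. x \<in> minimizers V Cs Q g" x1 "\<lambda>x. card (active V Cs x)"]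
    by blast
  define E where "E = active V Cs x"
  have E: "E \<subseteq> Cs" "finite E" using fin by (auto simp: E_def active_def)
  define W where "W = V <+> E"
  have "card W = card V + card E" using fin E by (simp add: W_def card_Plus)
  then have card_W: "card W \<le> s"
    using size card_mono[OF fin(2) E(1)] by (simp add: polyhedron_size_le_def)
  have "constraints_le V E s"
    using size(1) E(1)
    by (auto simp: polyhedron_size_le_def constraints_le_def)
  note rows_le = kkt_row_le[OF size(2) this, folded W_def]
  obtain l where X: "kkt_solution V E Q g (case_sum x l)"
    using minimizer_kkt[OF fin(2) x] unfolding E_def by blast
  obtain Y where height: "height_le W (system_height (card W) (card W) (2 ^ (s + 1))) Y"
    and Y: "\<And>r. r \<in> W \<Longrightarrow> lin_form W (fst (kkt_row Q g r)) Y = of_int (snd (kkt_row Q g r))"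
  proof (rule linear_system_height[where V = W and I = W and B = "2 ^ (s + 1)"
        and c = "kkt_row Q g" and x = "case_sum x l"])
    show "lin_form W (fst (kkt_row Q g r)) (case_sum x l) = of_int (snd (kkt_row Q g r))"
      if "r \<in> W" for r
      using X that by (simp add: kkt_solution_iff_rows[OF fin(1) E(2)] W_def)
  qed (use fin E rows_le in \<open>auto simp: W_def\<close>)
  have "kkt_solution V E Q g Y"
    using Y by (simp add: kkt_solution_iff_rows[OF fin(1) E(2)] W_def)
  then have "Y (Inl v) = x v" if "v \<in> V" for v
    using maximal_active_kkt_unique[OF fin(2) x maximal bounded] X that unfolding E_def by blast
  moreover have "height_le V (2 ^ qp_exp s) (\<lambda>v. Y (Inl v))"
    using height_le_mono[OF height system_height_le_qp_exp[OF card_W]]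
    unfolding height_le_def W_def by fastforce
  ultimately have "height_le V (2 ^ qp_exp s) x"
    using height_le_cong[of V x "\<lambda>v. Y (Inl v)"] by simp
  with x show thesis by (rule that)
qed

section \<open>Polyhedra and their recession cones\<close>

definition ray_sum :: "('v \<Rightarrow> int) set \<Rightarrow> (('v \<Rightarrow> int) \<Rightarrow> 'a) \<Rightarrow> 'v \<Rightarrow> 'a :: comm_ring_1" where
  "ray_sum G l v = (\<Sum>r\<in>G. l r * of_int (r v))"

lemma of_int_ray_sum: "of_int (ray_sum G l v) = ray_sum G (\<lambda>r. of_int (l r)) v"
  by (simp add: ray_sum_def)

lemma ray_sum_add_scaled: "ray_sum G (\<lambda>r. k r + s * l r) v = ray_sum G k v + s * ray_sum G l v"
  by (simp add: ray_sum_def distrib_right sum.distrib sum_distrib_left mult.assoc)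

lemma lin_form_ray_sum: "lin_form V a (ray_sum G l) = (\<Sum>r\<in>G. l r * of_int (lin_form V a r))"
  by (simp add: ray_sum_def[abs_def] lin_form_sum lin_form_scale of_int_lin_form)

lemma bil_form_ray_sum:
  "bil_form V Q (ray_sum G k) (ray_sum G l) = bil_form G (bil_form V Q) k l"
  by (simp add: ray_sum_def[abs_def] bil_form_sum_left bil_form_sum_right bil_form_scale_left
      bil_form_scale_right bil_form_def[of G] of_int_bil_form sum_distrib_left mult_ac)

lemma ray_sum_insert:
  assumes "finite G"
  shows "ray_sum (insert y G) (\<lambda>r. (if r \<in> G then l r else 0) + (if r = y then \<rho> else 0)) v =
    ray_sum G l v + \<rho> * of_int (y v)"
proof -
  have "ray_sum (insert y G) (\<lambda>r. (if r \<in> G then l r else 0) + (if r = y then \<rho> else 0)) v =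
      (\<Sum>r\<in>insert y G. if r \<in> G then l r * of_int (r v) else 0) +
      (\<Sum>r\<in>insert y G. if r = y then \<rho> * of_int (r v) else 0)"
    unfolding ray_sum_def sum.distrib[symmetric] by (intro sum.cong) (auto simp: distrib_right)
  then show ?thesis
    using assms by (simp add: ray_sum_def Int_absorb1 subset_insertI flip: sum.inter_restrict)
qed

lemma ray_sum_floor_frac:
  fixes l :: "('v \<Rightarrow> int) \<Rightarrow> real"
  assumes "finite G" "R \<subseteq> G"
  shows "ray_sum G l w =
    ray_sum G (\<lambda>y. if y \<in> R then frac (l y) else l y) w + ray_sum R (\<lambda>y. of_int \<lfloor>l y\<rfloor>) w"
proof -
  have "ray_sum R (\<lambda>y. real_of_int \<lfloor>l y\<rfloor>) w =
      (\<Sum>y\<in>G. if y \<in> R then of_int \<lfloor>l y\<rfloor> * of_int (y w) else 0)"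
    using assms by (simp add: ray_sum_def Int_absorb1 flip: sum.inter_restrict)
  then show ?thesis
    unfolding ray_sum_def
    by (simp flip: sum.distrib) (intro sum.cong, auto simp: frac_def algebra_simps)
qed

lemma ray_sum_height_zero:
  fixes k :: "('v \<Rightarrow> int) \<Rightarrow> 'a :: comm_ring_1"
  assumes "\<And>y. y \<in> G \<Longrightarrow> y None = 0"
  shows "ray_sum ((\<lambda>y v. y (Some v)) ` G) k v = ray_sum G (\<lambda>y. k (\<lambda>v. y (Some v))) (Some v)"
proof -
  have "inj_on (\<lambda>y v. y (Some v)) G"
  proof (rule inj_onI, rule ext)
    fix y y' w assume y: "y \<in> G" "y' \<in> G" "(\<lambda>v. y (Some v)) = (\<lambda>v. y' (Some v))"
    show "y w = y' w" using fun_cong[OF y(3)] assms[OF y(1)] assms[OF y(2)] by (cases w) auto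
  qed
  then show ?thesis by (simp add: ray_sum_def sum.reindex)
qed

lemma ray_sum_height_zero_floor:
  fixes l :: "('v option \<Rightarrow> int) \<Rightarrow> real"
  assumes "\<And>y. y \<in> G \<Longrightarrow> y None = 0" "\<And>y. y \<in> G \<Longrightarrow> 0 \<le> l y"
  shows "ray_sum ((\<lambda>y v. y (Some v)) ` G) (\<lambda>r. real (nat \<lfloor>l (case_option 0 r)\<rfloor>)) v =
    ray_sum G (\<lambda>y. of_int \<lfloor>l y\<rfloor>) (Some v)"
proof -
  have inverse: "case_option 0 (\<lambda>v. y (Some v)) = y" if "y \<in> G" for y
    using assms(1)[OF that] by (auto simp: fun_eq_iff split: option.split)
  have "ray_sum ((\<lambda>y v. y (Some v)) ` G) (\<lambda>r. real (nat \<lfloor>l (case_option 0 r)\<rfloor>)) v =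
      ray_sum G (\<lambda>y. real (nat \<lfloor>l (case_option 0 (\<lambda>v. y (Some v)))\<rfloor>)) (Some v)"
    by (rule ray_sum_height_zero) (rule assms(1))
  also have "\<dots> = ray_sum G (\<lambda>y. of_int \<lfloor>l y\<rfloor>) (Some v)"
    unfolding ray_sum_def using assms(2) by (intro sum.cong) (auto simp: inverse)
  finally show ?thesis .
qed

lemma ray_sum_mem_cube:
  fixes l :: "('v \<Rightarrow> int) \<Rightarrow> 'a :: linordered_idom"
  assumes "card G \<le> n" "G \<subseteq> cube V e" "\<And>r. r \<in> G \<Longrightarrow> \<bar>l r\<bar> \<le> 1"
  shows "ray_sum G l \<in> cube V (n + e)"
proof (rule cubeI)
  fix v assume "v \<in> V"
  then have "\<bar>l r * of_int (r v)\<bar> \<le> 2 ^ (0 + e)" if "r \<in> G" for r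
    using assms(2,3) that by (intro abs_mult_le_power abs_of_int_le_power) (auto simp: cube_def)
  then show "\<bar>ray_sum G l v\<bar> \<le> 2 ^ (n + e)"
    unfolding ray_sum_def using assms(1) by (intro abs_sum_le_power) auto
qed

lemma abs_ray_sum_le:
  fixes l :: "('v \<Rightarrow> int) \<Rightarrow> 'a :: linordered_idom"
  assumes "\<And>r. r \<in> G \<Longrightarrow> 0 \<le> l r" "\<And>r. r \<in> G \<Longrightarrow> \<bar>r v\<bar> \<le> B"
  shows "\<bar>ray_sum G l v\<bar> \<le> (\<Sum>r\<in>G. l r) * of_int B"
proof -
  have "\<bar>ray_sum G l v\<bar> \<le> (\<Sum>r\<in>G. \<bar>l r * of_int (r v)\<bar>)"
    unfolding ray_sum_def by (rule sum_abs)
  also have "\<dots> \<le> (\<Sum>r\<in>G. l r * of_int B)"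
  proof (rule sum_mono)
    fix r assume "r \<in> G"
    then have "\<bar>of_int (r v) :: 'a\<bar> \<le> of_int B" "0 \<le> l r"
      using assms by (simp_all flip: of_int_abs)
    then show "\<bar>l r * of_int (r v)\<bar> \<le> l r * of_int B" by (simp add: abs_mult mult_left_mono)
  qed
  finally show ?thesis by (simp add: sum_distrib_right)
qed

definition polyhedral_cone :: "'v set \<Rightarrow> ('v \<Rightarrow> int) set \<Rightarrow> ('v \<Rightarrow> 'a :: linordered_idom) set" where
  "polyhedral_cone V As = {u. \<forall>a\<in>As. lin_form V a u \<le> 0}"

abbreviation recession_cone :: "'v set \<Rightarrow> 'v constraint set \<Rightarrow> ('v \<Rightarrow> 'a :: linordered_idom) set" where
  "recession_cone V Cs \<equiv> polyhedral_cone V (fst ` Cs)"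

lemma of_int_mem_polyhedral_cone:
  "(\<lambda>v. real_of_int (y v)) \<in> polyhedral_cone V As \<longleftrightarrow> y \<in> polyhedral_cone V As"
  by (simp add: polyhedral_cone_def flip: of_int_lin_form)

lemma polyhedron_of_homogeneous: "polyhedron_of V ((\<lambda>a. (a, 0)) ` As) = polyhedral_cone V As"
  by (simp add: polyhedron_of_def polyhedral_cone_def)

lemma polyhedral_cone_ray_sum:
  fixes l :: "('v \<Rightarrow> int) \<Rightarrow> 'a :: linordered_idom"
  assumes "G \<subseteq> polyhedral_cone V As" "\<And>r. r \<in> G \<Longrightarrow> 0 \<le> l r"
  shows "ray_sum G l \<in> polyhedral_cone V As"
proof -
  have "lin_form V a (ray_sum G l) \<le> 0" if "a \<in> As" for a
    unfolding lin_form_ray_sum using assms that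
    by (intro sum_nonpos mult_nonneg_nonpos) (auto simp: polyhedral_cone_def)
  then show ?thesis by (simp add: polyhedral_cone_def)
qed

lemma polyhedron_add_recession:
  assumes "z \<in> polyhedron_of V Cs" "y \<in> recession_cone V Cs" "0 \<le> s"
  shows "(\<lambda>v. z v + s * y v) \<in> polyhedron_of V Cs"
proof -
  have "lin_form V (fst c) z + s * lin_form V (fst c) y \<le> of_int (snd c)" if "c \<in> Cs" for c
    using polyhedron_ofD[OF assms(1) that] assms(2,3) that
      mult_nonneg_nonpos[of s "lin_form V (fst c) y"] by (force simp: polyhedral_cone_def)
  then show ?thesis by (simp add: polyhedron_of_def lin_form_add lin_form_scale)
qed

definition orthant :: "'v set \<Rightarrow> ('v \<Rightarrow> int) \<Rightarrow> ('v \<Rightarrow> real) set" where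
  "orthant V \<sigma> = {u. \<forall>v\<in>V. 0 \<le> of_int (\<sigma> v) * u v}"

definition orthant_forms :: "'v set \<Rightarrow> ('v \<Rightarrow> int) \<Rightarrow> ('v \<Rightarrow> int) set" where
  "orthant_forms V \<sigma> = (\<lambda>u v. - \<sigma> u * unit_form u v) ` V"

lemma polyhedral_cone_orthant_forms:
  assumes "finite V"
  shows "polyhedral_cone V (orthant_forms V \<sigma>) = orthant V \<sigma>"
proof -
  have "lin_form V (\<lambda>v. - \<sigma> u * unit_form u v) x = - (of_int (\<sigma> u) * x u)"
    if "u \<in> V" for u and x :: "'a \<Rightarrow> real"
  proof -
    have "lin_form V (\<lambda>v. - \<sigma> u * unit_form u v) x = - of_int (\<sigma> u) * lin_form V (unit_form u) x"
      by (simp add: lin_form_def sum_distrib_left sum_negf mult.assoc)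
    then show ?thesis using assms that by (simp add: lin_form_unit_form)
  qed
  then show ?thesis by (simp add: polyhedral_cone_def orthant_def orthant_forms_def)
qed

lemma card_orthant_forms_le: "finite V \<Longrightarrow> card (orthant_forms V \<sigma>) \<le> card V"
  unfolding orthant_forms_def by (rule card_image_le)

lemma abs_le_lin_form_orthant:
  assumes "finite V" "u \<in> orthant V \<sigma>" "\<And>v. v \<in> V \<Longrightarrow> \<bar>\<sigma> v\<bar> = 1" "v \<in> V"
  shows "\<bar>u v\<bar> \<le> lin_form V \<sigma> u"
proof -
  have "real_of_int (\<sigma> v) = 1 \<or> real_of_int (\<sigma> v) = - 1" using assms(3)[OF assms(4)] by auto
  moreover have "0 \<le> of_int (\<sigma> v) * u v" using assms(2,4) by (simp add: orthant_def)
  ultimately have "\<bar>u v\<bar> = of_int (\<sigma> v) * u v" by auto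
  also have "\<dots> \<le> lin_form V \<sigma> u"
    unfolding lin_form_def using assms by (intro member_le_sum) (auto simp: orthant_def)
  finally show ?thesis .
qed

locale cone_in_orthant =
  fixes V :: "'v set" and As :: "('v \<Rightarrow> int) set" and \<sigma> :: "'v \<Rightarrow> int" and s :: nat
  assumes finite_V: "finite V" and finite_As: "finite As"
    and card_le: "card V + 3 * card As + 2 \<le> s"
    and coeff_le: "As \<subseteq> cube V s"
    and sign: "\<And>v. v \<in> V \<Longrightarrow> \<bar>\<sigma> v\<bar> = 1"
    and cone_orthant: "polyhedral_cone V As \<subseteq> orthant V \<sigma>"
begin

lemma abs_le_sign_form:
  fixes u :: "'v \<Rightarrow> real"
  shows "u \<in> polyhedral_cone V As \<Longrightarrow> v \<in> V \<Longrightarrow> \<bar>u v\<bar> \<le> lin_form V \<sigma> u"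
  using abs_le_lin_form_orthant[of V u \<sigma> v] finite_V sign cone_orthant by blast

definition face_slice :: "('v \<Rightarrow> real) \<Rightarrow> 'v constraint set" where
  "face_slice u = (\<lambda>a. (a, 0)) ` As \<union>
     equations (insert (\<sigma>, 1) ((\<lambda>a. (a, 0)) ` {a \<in> As. lin_form V a u = 0}))"

lemma polyhedron_of_face_slice:
  "x \<in> polyhedron_of V (face_slice u) \<longleftrightarrow> x \<in> polyhedral_cone V As \<and>
     lin_form V \<sigma> x = 1 \<and> (\<forall>a\<in>As. lin_form V a u = 0 \<longrightarrow> lin_form V a x = 0)"
  by (auto simp: face_slice_def polyhedron_of_Un polyhedron_of_equations polyhedron_of_homogeneous)

lemma face_slice_size: "polyhedron_size_le V (face_slice u) s"
proof -
  let ?E = "{a \<in> As. lin_form V a u = 0}"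
  have "finite ?E" using finite_As by simp
  have "card (face_slice u) \<le> card As + 2 * card (insert (\<sigma>, 1) ((\<lambda>a. (a, 0::int)) ` ?E))"
    unfolding face_slice_def using finite_As
    by (intro order_trans[OF card_Un_le] add_mono card_image_le card_equations_le) auto
  also have "card (insert (\<sigma>, 1) ((\<lambda>a. (a, 0::int)) ` ?E)) \<le> 1 + card ?E"
    using card_image_le[OF \<open>finite ?E\<close>, of "\<lambda>a. (a, 0::int)"] \<open>finite ?E\<close>
    by (simp add: card_insert_if)
  also have "card ?E \<le> card As" using finite_As by (intro card_mono) auto
  finally have "card (face_slice u) \<le> 3 * card As + 2" by simp
  moreover have "constraints_le V (face_slice u) s"
    unfolding face_slice_def constraints_le_Un constraints_le_equations
    using coeff_le sign by (auto simp: constraints_le_def cube_def)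
  moreover have "finite (face_slice u)"
    using finite_As by (simp add: face_slice_def finite_equations)
  ultimately show ?thesis using finite_V card_le by (simp add: polyhedron_size_le_def)
qed

lemma ex_face_generator:
  fixes u :: "'v \<Rightarrow> real"
  assumes u: "u \<in> polyhedral_cone V As" and nonzero: "\<exists>v\<in>V. u v \<noteq> 0"
  obtains y :: "'v \<Rightarrow> int" where "y \<in> polyhedral_cone V As" "y \<in> cube V (qp_exp s)"
    "\<And>a. a \<in> As \<Longrightarrow> lin_form V a u = 0 \<Longrightarrow> lin_form V a y = 0" "0 < lin_form V \<sigma> y"
proof -
  define h where "h = lin_form V \<sigma> u"
  have "0 < h"
    using nonzero abs_le_sign_form[OF u] unfolding h_def by force
  then have "lin_form V a (\<lambda>v. u v / h) = lin_form V a u / h" for a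
    using lin_form_scale[of V a "1 / h" u] by simp
  then have "(\<lambda>v. u v / h) \<in> polyhedron_of V (face_slice u)"
    using u \<open>0 < h\<close>
    by (auto simp: polyhedron_of_face_slice polyhedral_cone_def h_def[symmetric] divide_nonpos_pos)
  moreover have "polyhedron_of V (face_slice u) \<subseteq> cube V 0"
    using abs_le_sign_form by (force simp: polyhedron_of_face_slice cube_def)
  then have "bounded_on V (polyhedron_of V (face_slice u))" by (rule bounded_on_subset_cube)
  moreover have "quad_size_le V (\<lambda>_ _. 0) (\<lambda>_. 0) s" by (simp add: quad_size_le_def)
  ultimately obtain x where x: "x \<in> polyhedron_of V (face_slice u)"
    and height: "height_le V (2 ^ qp_exp s) x"
    using quadratic_program_height[OF face_slice_size] unfolding minimizers_def by blast
  obtain t :: int and y where t: "1 \<le> t"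
    and y: "\<forall>v\<in>V. \<bar>y v\<bar> \<le> int (2 ^ qp_exp s)" "\<forall>v\<in>V. x v = of_int (y v) / of_int t"
    using height by (rule height_leE)
  have lin_y: "real_of_int (lin_form V a y) = of_int t * lin_form V a x" for a
  proof -
    have "lin_form V a (\<lambda>v. real_of_int (y v)) = lin_form V a (\<lambda>v. of_int t * x v)"
      using t y(2) by (intro lin_form_cong) simp
    then show ?thesis by (simp add: of_int_lin_form lin_form_scale)
  qed
  show thesis
  proof (rule that[of y])
    show "y \<in> polyhedral_cone V As"
      unfolding of_int_mem_polyhedral_cone[symmetric] unfolding polyhedral_cone_def
      using x t lin_y
      by (auto simp: of_int_lin_form[symmetric] polyhedron_of_face_slice polyhedral_cone_def
        mult_nonneg_nonpos)
    show "lin_form V a y = 0" if "a \<in> As" "lin_form V a u = 0" for a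
      using lin_y[of a] x that by (simp add: polyhedron_of_face_slice)
    show "0 < lin_form V \<sigma> y"
      using lin_y[of \<sigma>] x t by (simp add: polyhedron_of_face_slice)
  qed (use y(1) in \<open>simp add: cube_def\<close>)
qed

lemma ex_negative_form:
  fixes y :: "'v \<Rightarrow> int"
  assumes "0 < lin_form V \<sigma> y"
  shows "\<exists>a\<in>As. lin_form V a y < 0"
proof (rule ccontr)
  assume "\<not> ?thesis"
  then have "(\<lambda>v. - real_of_int (y v)) \<in> polyhedral_cone V As"
    by (auto simp: polyhedral_cone_def lin_form_minus not_less simp flip: of_int_lin_form)
  then have "0 \<le> lin_form V \<sigma> (\<lambda>v. - real_of_int (y v))"
    unfolding lin_form_def using cone_orthant by (intro sum_nonneg) (auto simp: orthant_def)
  then show False using assms by (simp add: lin_form_minus flip: of_int_lin_form)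
qed

lemma ex_cone_remainder:
  fixes u :: "'v \<Rightarrow> real" and y :: "'v \<Rightarrow> int"
  assumes u: "u \<in> polyhedral_cone V As" and y: "0 < lin_form V \<sigma> y"
  obtains \<rho> :: real and a where "0 \<le> \<rho>" "(\<lambda>v. u v - \<rho> * of_int (y v)) \<in> polyhedral_cone V As"
    "a \<in> As" "lin_form V a y < 0" "lin_form V a (\<lambda>v. u v - \<rho> * of_int (y v)) = 0"
proof -
  define C where "C = (\<lambda>a. (a, 0::int)) ` As"
  have C: "polyhedron_of V C = polyhedral_cone V As"
    unfolding C_def by (rule polyhedron_of_homogeneous)
  have neg: "lin_form V a (\<lambda>v. - real_of_int (y v)) = - of_int (lin_form V a y)" for a
    by (simp add: lin_form_minus of_int_lin_form)
  obtain \<rho> c where "0 \<le> \<rho>" "(\<lambda>v. u v + \<rho> * - real_of_int (y v)) \<in> polyhedron_of V C"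
    "c \<in> active V C (\<lambda>v. u v + \<rho> * - real_of_int (y v))"
    "0 < lin_form V (fst c) (\<lambda>v. - real_of_int (y v))"
    using ray_hits_constraint[of C u V "\<lambda>v. - real_of_int (y v)"] u finite_As ex_negative_form[OF y]
    unfolding C neg by (auto simp: C_def)
  then show thesis
    by (intro that[of \<rho> "fst c"]) (auto simp: C neg, auto simp: active_def C_def)
qed

lemma cone_decomposition:
  fixes u :: "'v \<Rightarrow> real"
  assumes "u \<in> polyhedral_cone V As"
  shows "\<exists>G l. finite G \<and> card G \<le> card {a \<in> As. lin_form V a u \<noteq> 0} \<and>
    G \<subseteq> polyhedral_cone V As \<inter> cube V (qp_exp s) \<and>
    (\<forall>y\<in>G. 0 \<le> l y) \<and> (\<forall>v\<in>V. u v = ray_sum G l v)"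
  using assms
proof (induction "card {a \<in> As. lin_form V a u \<noteq> 0}" arbitrary: u rule: less_induct)
  case less
  let ?nz = "\<lambda>u. {a \<in> As. lin_form V a u \<noteq> (0::real)}"
  show ?case
  proof (cases "\<exists>v\<in>V. u v \<noteq> 0")
    case False
    then show ?thesis by (intro exI[of _ "{}"]) (auto simp: ray_sum_def)
  next
    case True
    obtain y :: "'v \<Rightarrow> int" where y: "y \<in> polyhedral_cone V As" "y \<in> cube V (qp_exp s)"
      and face: "\<And>a. a \<in> As \<Longrightarrow> lin_form V a u = 0 \<Longrightarrow> lin_form V a y = 0" and "0 < lin_form V \<sigma> y"
      using ex_face_generator[OF less.prems True] by blast
    obtain \<rho> :: real and a where "0 \<le> \<rho>"
      and u': "(\<lambda>v. u v - \<rho> * of_int (y v)) \<in> polyhedral_cone V As"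
      and a: "a \<in> As" "lin_form V a y < 0" "lin_form V a (\<lambda>v. u v - \<rho> * of_int (y v)) = 0"
      using ex_cone_remainder[OF less.prems \<open>0 < lin_form V \<sigma> y\<close>] by blast
    define u' where "u' v = u v - \<rho> * of_int (y v)" for v
    have "?nz u' \<subseteq> ?nz u"
      using face unfolding u'_def[abs_def] lin_form_diff lin_form_scale of_int_lin_form[symmetric]
      by auto
    moreover have "a \<in> ?nz u - ?nz u'" using a face[of a] by (auto simp: u'_def[abs_def])
    ultimately have fewer: "card (?nz u') < card (?nz u)"
      using finite_As by (intro psubset_card_mono) auto
    obtain G l
      where G: "finite G" "card G \<le> card (?nz u')" "G \<subseteq> polyhedral_cone V As \<inter> cube V (qp_exp s)"
      "\<And>y. y \<in> G \<Longrightarrow> 0 \<le> l y"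
      and u'_sum: "\<And>v. v \<in> V \<Longrightarrow> u' v = ray_sum G l v"
      using less.hyps[OF fewer] u' unfolding u'_def[abs_def, symmetric] by blast
    define l' where "l' r = (if r \<in> G then l r else 0) + (if r = y then \<rho> else 0)" for r
    have "ray_sum (insert y G) l' v = u v" if "v \<in> V" for v
      using ray_sum_insert[OF G(1), of y l \<rho> v] u'_sum[OF that]
      by (simp add: l'_def[abs_def] u'_def)
    moreover have "card (insert y G) \<le> card (?nz u)"
      using G(1,2) fewer
      by (simp add: card_insert_if)
    moreover have "0 \<le> l' r" if "r \<in> insert y G" for r using G(4) \<open>0 \<le> \<rho>\<close> by (simp add: l'_def)
    ultimately show ?thesis
      using G y by (intro exI[of _ "insert y G"] exI[of _ l']) auto
  qed
qed

end

definition ray_exp :: "nat \<Rightarrow> nat" where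
  "ray_exp s = qp_exp (4 * s + 6)"

definition homogenized_forms :: "'v set \<Rightarrow> 'v constraint set \<Rightarrow> ('v option \<Rightarrow> int) \<Rightarrow>
    ('v option \<Rightarrow> int) set" where
  "homogenized_forms V Cs \<sigma> = homogenize ` Cs \<union> orthant_forms (option_set V) \<sigma>"

lemma mem_cone_homogenized_forms:
  fixes y :: "'v option \<Rightarrow> real"
  assumes "finite V"
  shows "y \<in> polyhedral_cone (option_set V) (homogenized_forms V Cs \<sigma>) \<longleftrightarrow>
    (\<forall>c\<in>Cs. lin_form V (fst c) (\<lambda>v. y (Some v)) \<le> of_int (snd c) * y None) \<and>
    y \<in> orthant (option_set V) \<sigma>"
  using assms
  by (auto simp: homogenized_forms_def polyhedral_cone_def ball_Un lin_form_homogenize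
      simp flip: polyhedral_cone_orthant_forms)

lemma homogenized_forms_size:
  assumes size: "polyhedron_size_le V Cs s"
  shows "finite (homogenized_forms V Cs \<sigma>)" "card (homogenized_forms V Cs \<sigma>) \<le> s + 1"
proof -
  have fin: "finite V" "finite Cs" and "card V + card Cs \<le> s"
    using size by (auto simp: polyhedron_size_le_def)
  then show "card (homogenized_forms V Cs \<sigma>) \<le> s + 1"
    using card_Un_le[of "homogenize ` Cs" "orthant_forms (option_set V) \<sigma>"]
      card_image_le[of Cs homogenize] card_orthant_forms_le[of "option_set V" \<sigma>]
    by (simp add: homogenized_forms_def card_option_set)
  show "finite (homogenized_forms V Cs \<sigma>)"
    using fin by (simp add: homogenized_forms_def orthant_forms_def)
qed

lemma cone_in_orthant_homogenized_forms:
  assumes size: "polyhedron_size_le V Cs s" and sign: "\<And>w. \<bar>\<sigma> w\<bar> = 1"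
  shows "cone_in_orthant (option_set V) (homogenized_forms V Cs \<sigma>) \<sigma> (4 * s + 6)"
proof
  have fin: "finite V" and card: "card V \<le> s" and coeffs: "constraints_le V Cs s"
    using size by (auto simp: polyhedron_size_le_def)
  show "finite (option_set V)" using fin by simp
  show "finite (homogenized_forms V Cs \<sigma>)" by (rule homogenized_forms_size[OF size])
  show "card (option_set V) + 3 * card (homogenized_forms V Cs \<sigma>) + 2 \<le> 4 * s + 6"
    using card homogenized_forms_size(2)[OF size, of \<sigma>] fin by (simp add: card_option_set)
  have "homogenize c \<in> cube (option_set V) s" if "c \<in> Cs" for c
    using coeffs that by (auto simp: constraints_le_def cube_def intro: abs_homogenize_le)
  moreover have "orthant_forms (option_set V) \<sigma> \<subseteq> cube (option_set V) s"
    using sign by (auto simp: orthant_forms_def cube_def unit_form_def)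
  ultimately have "homogenized_forms V Cs \<sigma> \<subseteq> cube (option_set V) s"
    by (auto simp: homogenized_forms_def)
  then show "homogenized_forms V Cs \<sigma> \<subseteq> cube (option_set V) (4 * s + 6)"
    by (auto intro: cube_mono[rotated])
  show "polyhedral_cone (option_set V) (homogenized_forms V Cs \<sigma>) \<subseteq> orthant (option_set V) \<sigma>"
    using mem_cone_homogenized_forms[OF fin] by blast
qed (simp add: sign)

lemma homogenized_generators:
  fixes x :: "'v \<Rightarrow> real"
  assumes size: "polyhedron_size_le V Cs s" and x: "x \<in> polyhedron_of V Cs"
  obtains G l where "finite G" "card G \<le> s + 1" "G \<subseteq> cube (option_set V) (ray_exp s)"
    "\<forall>y\<in>G. 0 \<le> l y \<and> 0 \<le> y None"
    "\<And>y c. y \<in> G \<Longrightarrow> c \<in> Cs \<Longrightarrow> lin_form V (fst c) (\<lambda>v. y (Some v)) \<le> snd c * y None"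
    "ray_sum G l None = (1::real)" "\<And>v. v \<in> V \<Longrightarrow> x v = ray_sum G l (Some v)"
proof -
  have fin: "finite V" using size by (simp add: polyhedron_size_le_def)
  define X where "X = case_option 1 x"
  define \<sigma> :: "'v option \<Rightarrow> int" where "\<sigma> w = (if 0 \<le> X w then 1 else - 1)" for w
  define As where "As = homogenized_forms V Cs \<sigma>"
  note cone_iff = mem_cone_homogenized_forms[OF fin, of _ Cs \<sigma>, folded As_def]
  interpret cone_in_orthant "option_set V" As \<sigma> "4 * s + 6"
    unfolding As_def using size by (rule cone_in_orthant_homogenized_forms) (simp add: \<sigma>_def)
  have "X \<in> polyhedral_cone (option_set V) As"
    using x by (auto simp: cone_iff X_def \<sigma>_def orthant_def polyhedron_of_def)
  then obtain G l where G: "finite G" "card G \<le> card {a \<in> As. lin_form (option_set V) a X \<noteq> 0}"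
      "G \<subseteq> polyhedral_cone (option_set V) As \<inter> cube (option_set V) (ray_exp s)"
    and l: "\<forall>y\<in>G. 0 \<le> l y" and sum: "\<forall>w\<in>option_set V. X w = ray_sum G l w"
    using cone_decomposition[of X] unfolding ray_exp_def by blast
  have "card {a \<in> As. lin_form (option_set V) a X \<noteq> 0} \<le> card As"
    using finite_As by (intro card_mono) auto
  then have "card G \<le> s + 1"
    using G(2) homogenized_forms_size(2)[OF size, of \<sigma>] by (simp add: As_def)
  moreover have "0 \<le> y None \<and> (\<forall>c\<in>Cs. lin_form V (fst c) (\<lambda>v. y (Some v)) \<le> snd c * y None)"
    if "y \<in> G" for y
  proof -
    have "(\<lambda>w. real_of_int (y w)) \<in> polyhedral_cone (option_set V) As"
      using G(3) that by (auto simp: of_int_mem_polyhedral_cone)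
    then show ?thesis
      unfolding cone_iff
      by (auto simp: orthant_def \<sigma>_def X_def dest!: bspec[of _ _ None]
        simp flip: of_int_lin_form of_int_mult)
  qed
  moreover have "ray_sum G l None = 1" "\<And>v. v \<in> V \<Longrightarrow> x v = ray_sum G l (Some v)"
    using bspec[OF sum, of None] bspec[OF sum, of "Some v" for v] by (simp_all add: X_def)
  ultimately show thesis using G(1,3) l by (intro that[of G l]) auto
qed

lemma homogeneous_combination_mem_polyhedron:
  fixes l :: "('v option \<Rightarrow> int) \<Rightarrow> real"
  assumes l: "\<And>y. y \<in> G \<Longrightarrow> 0 \<le> l y"
    and row: "\<And>y c. y \<in> G \<Longrightarrow> c \<in> Cs \<Longrightarrow> lin_form V (fst c) (\<lambda>v. y (Some v)) \<le> snd c * y None"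
    and one: "ray_sum G l None = 1"
  shows "(\<lambda>v. ray_sum G l (Some v)) \<in> polyhedron_of V Cs"
  unfolding polyhedron_of_def
proof (intro CollectI ballI)
  fix c assume c: "c \<in> Cs"
  have "lin_form V (fst c) (\<lambda>v. ray_sum G l (Some v)) =
      (\<Sum>y\<in>G. l y * of_int (lin_form V (fst c) (\<lambda>v. y (Some v))))"
    by (simp add: ray_sum_def lin_form_sum lin_form_scale of_int_lin_form)
  also have "\<dots> \<le> (\<Sum>y\<in>G. l y * of_int (snd c * y None))"
    using row[OF _ c] l by (intro sum_mono mult_left_mono) (simp_all only: of_int_le_iff)
  also have "\<dots> = of_int (snd c) * ray_sum G l None"
    by (simp add: ray_sum_def sum_distrib_left mult_ac)
  finally show "lin_form V (fst c) (\<lambda>v. ray_sum G l (Some v)) \<le> of_int (snd c)" by (simp add: one)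
qed

text \<open>A generator of positive height enters \<open>(x, 1)\<close> with coefficient at most \<open>1\<close>, so only the
  generators of height \<open>0\<close> contribute an unbounded amount.\<close>

lemma generator_coeff_le_one:
  fixes l :: "('w \<Rightarrow> int) \<Rightarrow> real"
  assumes "finite G" and nonneg: "\<forall>y\<in>G. 0 \<le> l y \<and> 0 \<le> y w" and sum: "ray_sum G l w = 1"
    and y: "y \<in> G" "y w \<noteq> 0"
  shows "l y \<le> 1"
proof -
  have "1 \<le> y w" "0 \<le> l y" using nonneg y by force+
  then have "l y \<le> l y * of_int (y w)" by (simp add: mult_le_cancel_left1)
  also have "\<dots> \<le> ray_sum G l w"
    unfolding ray_sum_def using assms(1) nonneg y(1) by (intro member_le_sum) auto
  finally show ?thesis using sum by simp
qed

lemma polyhedron_decomposition: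
  fixes V :: "'v set" and x :: "'v \<Rightarrow> real"
  assumes size: "polyhedron_size_le V Cs s" and x: "x \<in> polyhedron_of V Cs"
  obtains I K z where "finite I" "card I \<le> s + 1" "I \<subseteq> recession_cone V Cs"
    "I \<subseteq> cube V (ray_exp s)" "z \<in> polyhedron_of V Cs" "z \<in> cube V (s + 1 + ray_exp s)"
    "\<forall>v\<in>V. x v = z v + ray_sum I (\<lambda>r. real (K r)) v"
proof -
  obtain G l where G: "finite G" "card G \<le> s + 1" "G \<subseteq> cube (option_set V) (ray_exp s)"
    and nonneg: "\<forall>y\<in>G. 0 \<le> l y \<and> 0 \<le> y None"
    and row: "\<And>y c. y \<in> G \<Longrightarrow> c \<in> Cs \<Longrightarrow> lin_form V (fst c) (\<lambda>v. y (Some v)) \<le> snd c * y None"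
    and one: "ray_sum G l None = (1::real)" and x_sum: "\<And>v. v \<in> V \<Longrightarrow> x v = ray_sum G l (Some v)"
    using homogenized_generators[OF size x] by blast
  define rays where "rays = {y \<in> G. y None = 0}"
  define restr :: "('v option \<Rightarrow> int) \<Rightarrow> 'v \<Rightarrow> int" where "restr = (\<lambda>y v. y (Some v))"
  define K where "K r = nat \<lfloor>l (case_option 0 r)\<rfloor>" for r
  define \<theta> where "\<theta> y = (if y \<in> rays then frac (l y) else l y)" for y
  define z where "z v = ray_sum G \<theta> (Some v)" for v
  have \<theta>_bounds: "0 \<le> \<theta> y" "\<theta> y \<le> 1" if "y \<in> G" for y
    using nonneg that generator_coeff_le_one[OF G(1) nonneg one, of y]
    by (auto simp: \<theta>_def rays_def frac_ge_0 less_imp_le[OF frac_lt_1])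
  show thesis
  proof (rule that[of "restr ` rays" z K])
    have rays: "rays \<subseteq> G" by (auto simp: rays_def)
    then show "finite (restr ` rays)" "card (restr ` rays) \<le> s + 1"
      using G card_image_le[of rays restr] card_mono[of G rays] finite_subset by fastforce+
    show "restr ` rays \<subseteq> recession_cone V Cs"
      using row by (force simp: rays_def restr_def polyhedral_cone_def)
    show "restr ` rays \<subseteq> cube V (ray_exp s)"
      using G(3) by (auto simp: rays_def restr_def cube_def)
    have "ray_sum G \<theta> None = 1"
      unfolding one[symmetric] ray_sum_def by (intro sum.cong) (auto simp: \<theta>_def rays_def)
    then show "z \<in> polyhedron_of V Cs"
      unfolding z_def[abs_def] using \<theta>_bounds(1) row
      by (intro homogeneous_combination_mem_polyhedron)
    have "ray_sum G \<theta> \<in> cube (option_set V) (s + 1 + ray_exp s)"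
      using G(2,3) \<theta>_bounds by (intro ray_sum_mem_cube) auto
    then show "z \<in> cube V (s + 1 + ray_exp s)" by (simp add: z_def cube_def)
    show "\<forall>v\<in>V. x v = z v + ray_sum (restr ` rays) (\<lambda>r. real (K r)) v"
      using x_sum ray_sum_floor_frac[OF G(1) rays, of l]
        ray_sum_height_zero_floor[of rays l] nonneg rays
      by (auto simp: z_def \<theta>_def[abs_def] rays_def restr_def K_def[abs_def])
  qed
qed

section \<open>Size estimates\<close>

lemma of_int_neg_le_minus_one:
  assumes "real_of_int i < 0"
  shows "real_of_int i \<le> - 1"
proof -
  have "i \<le> - 1" using assms by simp
  then show ?thesis by linarith
qed

lemma abs_lin_form_le:
  fixes x :: "'v \<Rightarrow> 'a :: linordered_idom"
  assumes "card V \<le> s" "a \<in> cube V s" "x \<in> cube V \<xi>"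
  shows "\<bar>lin_form V a x\<bar> \<le> 2 ^ (2 * s + \<xi>)"
proof -
  have "\<bar>lin_form V a x\<bar> \<le> 2 ^ (s + (s + \<xi>))"
    unfolding lin_form_def using assms
    by (intro abs_sum_le_power abs_mult_le_power abs_of_int_le_power) (auto simp: cube_def)
  then show ?thesis by (simp add: mult_2 add.assoc)
qed

lemma abs_bil_form_le:
  fixes x y :: "'v \<Rightarrow> 'a :: linordered_idom"
  assumes "card V \<le> s" "\<And>u. u \<in> V \<Longrightarrow> Q u \<in> cube V s" "x \<in> cube V \<xi>" "y \<in> cube V \<eta>"
  shows "\<bar>bil_form V Q x y\<bar> \<le> 2 ^ (3 * s + \<xi> + \<eta>)"
proof -
  have "\<bar>bil_form V Q x y\<bar> \<le> 2 ^ (s + (s + (s + \<xi> + \<eta>)))"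
    unfolding bil_form_def using assms
    by (intro abs_sum_le_power abs_mult_le_power abs_of_int_le_power) (auto simp: cube_def)
  then show ?thesis by (simp add: numeral_3_eq_3 add.assoc)
qed

lemma abs_quad_fun_le:
  fixes x :: "'v \<Rightarrow> 'a :: linordered_idom"
  assumes "card V \<le> s" and Q: "quad_size_le V Q g s" and x: "x \<in> cube V \<xi>"
  shows "\<bar>quad_fun V Q g x\<bar> \<le> 2 ^ (3 * s + 2 * \<xi> + 1)"
proof -
  let ?k = "3 * s + 2 * \<xi>"
  have "\<bar>bil_form V Q x x\<bar> \<le> 2 ^ ?k"
    by (rule power2_le_trans[OF abs_bil_form_le[of V s Q x \<xi> x \<xi>]])
      (use assms in \<open>auto simp: quad_size_le_def\<close>)
  moreover have "\<bar>lin_form V g x\<bar> \<le> 2 ^ ?k"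
    by (rule power2_le_trans[OF abs_lin_form_le[of V s g x \<xi>]])
      (use assms in \<open>auto simp: quad_size_le_def\<close>)
  ultimately have "\<bar>quad_fun V Q g x\<bar> \<le> 2 * 2 ^ ?k" unfolding quad_fun_def by linarith
  then show ?thesis by simp
qed

lemma abs_quad_deriv_le:
  fixes x y :: "'v \<Rightarrow> 'a :: linordered_idom"
  assumes "card V \<le> s" and Q: "quad_size_le V Q g s"
    and x: "x \<in> cube V \<xi>" and y: "y \<in> cube V \<eta>"
  shows "\<bar>quad_deriv V Q g x y\<bar> \<le> 2 ^ (3 * s + \<xi> + \<eta> + 2)"
proof -
  let ?k = "3 * s + \<xi> + \<eta>"
  have "\<bar>bil_form V Q x y\<bar> \<le> 2 ^ ?k" "\<bar>bil_form V Q y x\<bar> \<le> 2 ^ ?k"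
    by (rule power2_le_trans[OF abs_bil_form_le[of V s Q x \<xi> y \<eta>]],
        use assms in \<open>auto simp: quad_size_le_def\<close>)
      (rule power2_le_trans[OF abs_bil_form_le[of V s Q y \<eta> x \<xi>]],
        use assms in \<open>auto simp: quad_size_le_def\<close>)
  moreover have "\<bar>lin_form V g y\<bar> \<le> 2 ^ ?k"
    by (rule power2_le_trans[OF abs_lin_form_le[of V s g y \<eta>]])
      (use assms in \<open>auto simp: quad_size_le_def\<close>)
  ultimately have "\<bar>quad_deriv V Q g x y\<bar> \<le> 4 * 2 ^ ?k" unfolding quad_deriv_def by linarith
  then show ?thesis by (simp add: power_add)
qed

section \<open>Mixed-integer points\<close>

definition mixed_integer_points :: "'v set \<Rightarrow> 'v set \<Rightarrow> 'v constraint set \<Rightarrow> ('v \<Rightarrow> real) set" where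
  "mixed_integer_points V P Cs = {x \<in> polyhedron_of V Cs. \<forall>v\<in>P. x v \<in> \<int>}"

lemma mixed_integer_points_add_recession:
  assumes z: "z \<in> mixed_integer_points V P Cs" and r: "r \<in> recession_cone V Cs"
  shows "(\<lambda>v. z v + of_nat k * of_int (r v)) \<in> mixed_integer_points V P Cs"
  using z r polyhedron_add_recession[of z V Cs "\<lambda>v. of_int (r v)" "of_nat k"]
  by (auto simp: mixed_integer_points_def of_int_mem_polyhedral_cone)

definition box_constraints :: "'v set \<Rightarrow> nat \<Rightarrow> 'v constraint set" where
  "box_constraints V s = (\<lambda>v. (unit_form v, 2 ^ s)) ` V \<union> (\<lambda>v. (\<lambda>w. - unit_form v w, 2 ^ s)) ` V"

lemma polyhedron_of_box:
  assumes "finite V"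
  shows "polyhedron_of V (box_constraints V s) = cube V s"
  using assms
  by (auto simp: polyhedron_of_def box_constraints_def cube_def ball_Un lin_form_minus_left
    lin_form_unit_form abs_le_iff)

lemma box_constraints_size:
  assumes "finite V"
  shows "finite (box_constraints V s)" "card (box_constraints V s) \<le> 2 * card V"
    "constraints_le V (box_constraints V s) s"
proof -
  show "card (box_constraints V s) \<le> 2 * card V"
    unfolding box_constraints_def mult_2 using assms
    by (intro order_trans[OF card_Un_le] add_mono card_image_le)
qed (use assms in \<open>auto simp: box_constraints_def constraints_le_def unit_form_def cube_def\<close>)

definition fibre_constraints :: "'v set \<Rightarrow> 'v set \<Rightarrow> 'v constraint set \<Rightarrow> ('v \<Rightarrow> real) \<Rightarrow> nat \<Rightarrow>
    'v constraint set" where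
  "fibre_constraints V P Cs x s =
     Cs \<union> (equations ((\<lambda>v. (unit_form v, \<lfloor>x v\<rfloor>)) ` P) \<union> box_constraints V s)"

lemma polyhedron_of_fibre:
  assumes "finite V" and P: "P \<subseteq> V" and x: "\<forall>v\<in>P. x v \<in> \<int>"
  shows "w \<in> polyhedron_of V (fibre_constraints V P Cs x s) \<longleftrightarrow>
    w \<in> polyhedron_of V Cs \<and> (\<forall>v\<in>P. w v = x v) \<and> w \<in> cube V s"
proof -
  have coordinate: "lin_form V (unit_form v) w = w v" if "v \<in> P" for v
    using lin_form_unit_form[OF assms(1)] P that by blast
  have floor_x: "of_int \<lfloor>x v\<rfloor> = x v" if "v \<in> P" for v using x that by simp
  show ?thesis
    by (auto simp: fibre_constraints_def polyhedron_of_Un polyhedron_of_equations coordinate floor_x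
        polyhedron_of_box[OF assms(1)])
qed

lemma fibre_constraints_size:
  assumes size: "polyhedron_size_le V Cs s" and P: "P \<subseteq> V"
    and x: "\<forall>v\<in>P. x v \<in> \<int>" "x \<in> cube V s"
  shows "polyhedron_size_le V (fibre_constraints V P Cs x s) (5 * s)"
proof -
  let ?fix = "(\<lambda>v. (unit_form v, \<lfloor>x v\<rfloor>)) ` P"
  have fin: "finite V" "finite Cs" "finite P"
    using size P finite_subset by (auto simp: polyhedron_size_le_def)
  have "card ?fix \<le> card V"
    using card_image_le[OF fin(3)] card_mono[OF fin(1) P] order_trans
    by blast
  then have "card (equations ?fix) \<le> 2 * card V" using card_equations_le[of ?fix] fin(3) by simp
  then have "card (fibre_constraints V P Cs x s) \<le> card Cs + (2 * card V + 2 * card V)"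
    unfolding fibre_constraints_def using box_constraints_size(2)[OF fin(1)]
    by (intro order_trans[OF card_Un_le] add_mono) auto
  moreover have "\<bar>\<lfloor>x v\<rfloor>\<bar> \<le> 2 ^ s" if "v \<in> P" for v
  proof -
    have "\<bar>real_of_int \<lfloor>x v\<rfloor>\<bar> \<le> 2 ^ s" using x P that by (auto simp: cube_def)
    then show ?thesis by (simp flip: of_int_abs)
  qed
  then have "constraints_le V ?fix s" by (auto simp: constraints_le_def unit_form_def cube_def)
  then have "constraints_le V (fibre_constraints V P Cs x s) s"
    using size box_constraints_size(3)[OF fin(1)]
    by (simp add: fibre_constraints_def constraints_le_Un constraints_le_equations
      polyhedron_size_le_def)
  then have "constraints_le V (fibre_constraints V P Cs x s) (5 * s)"
    by (rule constraints_le_mono) simp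
  moreover have "finite (fibre_constraints V P Cs x s)"
    using fin by (simp add: fibre_constraints_def finite_equations box_constraints_size)
  ultimately show ?thesis using size by (simp add: polyhedron_size_le_def)
qed

lemma fibre_minimizer_height:
  assumes size: "polyhedron_size_le V Cs s" "quad_size_le V Q g s" and P: "P \<subseteq> V"
    and x: "x \<in> mixed_integer_points V P Cs" "x \<in> cube V s"
  obtains y where "y \<in> mixed_integer_points V P Cs" "y \<in> cube V s"
    "height_le V (2 ^ qp_exp (5 * s)) y" "quad_fun V Q g y \<le> quad_fun V Q g x"
proof -
  let ?F = "fibre_constraints V P Cs x s"
  have x_int: "\<forall>v\<in>P. x v \<in> \<int>" using x(1) by (simp add: mixed_integer_points_def)
  have "finite V" using size(1) by (simp add: polyhedron_size_le_def)
  note fibre = polyhedron_of_fibre[OF this P x_int, where Cs = Cs and s = s]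
  have x_fibre: "x \<in> polyhedron_of V ?F" using x by (simp add: fibre mixed_integer_points_def)
  have bounded: "bounded_on V (polyhedron_of V ?F)"
    by (rule bounded_on_subset_cube[of _ _ s]) (use fibre in blast)
  obtain y where y: "y \<in> minimizers V ?F Q g" "height_le V (2 ^ qp_exp (5 * s)) y"
    using quadratic_program_height[OF fibre_constraints_size[OF size(1) P x_int x(2)]
        quad_size_le_mono[OF size(2)] x_fibre bounded] by auto
  then have "y \<in> polyhedron_of V ?F" "quad_fun V Q g y \<le> quad_fun V Q g x"
    using x_fibre by (auto simp: minimizers_def)
  then show thesis
    using y(2) x_int by (intro that[of y]) (auto simp: fibre mixed_integer_points_def)
qed

definition feasible_points :: "'v set \<Rightarrow> 'v set \<Rightarrow> 'v constraint set \<Rightarrow> ('v \<Rightarrow> 'v \<Rightarrow> int) \<Rightarrow> ('v \<Rightarrow> int) \<Rightarrow>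
    int \<Rightarrow> ('v \<Rightarrow> real) set" where
  "feasible_points V P Cs H c d = {x \<in> mixed_integer_points V P Cs.
    quad_fun V H c x + of_int d \<le> 0}"

lemma feasible_points_cong:
  assumes "P \<subseteq> V" "\<And>v. v \<in> V \<Longrightarrow> x v = y v"
  shows "x \<in> feasible_points V P Cs H c d \<longleftrightarrow> y \<in> feasible_points V P Cs H c d"
  using assms polyhedron_of_cong[of V x y Cs] quad_fun_cong[of V x y H c]
  by (auto simp: feasible_points_def mixed_integer_points_def subset_iff)

locale miqp =
  fixes V P :: "'v set" and Cs :: "'v constraint set" and H :: "'v \<Rightarrow> 'v \<Rightarrow> int" and c :: "'v \<Rightarrow> int"
    and d :: int and s :: nat
  assumes polyhedron_size: "polyhedron_size_le V Cs s" and quad_size: "quad_size_le V H c s"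
    and const_size: "\<bar>d\<bar> \<le> 2 ^ s" and integer_vars: "P \<subseteq> V"
begin

lemma finite_V: "finite V" and card_V: "card V \<le> s"
  using polyhedron_size by (auto simp: polyhedron_size_le_def)

lemma miqp_mono: "s \<le> t \<Longrightarrow> miqp V P Cs H c d t"
  using polyhedron_size quad_size const_size integer_vars
  by unfold_locales (auto intro: polyhedron_size_le_mono quad_size_le_mono power2_le_trans)

lemma abs_objective_le:
  assumes "x \<in> cube V \<xi>"
  shows "\<bar>quad_fun V H c x + real_of_int d\<bar> \<le> 2 ^ (3 * s + 2 * \<xi> + 2)"
proof -
  have "\<bar>quad_fun V H c x\<bar> \<le> 2 ^ (3 * s + 2 * \<xi> + 1)"
    by (rule abs_quad_fun_le[OF card_V quad_size assms])
  moreover have "\<bar>real_of_int d\<bar> \<le> 2 ^ (3 * s + 2 * \<xi> + 1)"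
    using abs_of_int_le_power[OF const_size] by (rule power2_le_trans) simp
  ultimately show ?thesis by simp
qed

end

section \<open>Descent along recession directions\<close>

definition hessian_row :: "'v set \<Rightarrow> ('v \<Rightarrow> 'v \<Rightarrow> int) \<Rightarrow> ('v \<Rightarrow> int) \<Rightarrow> 'v \<Rightarrow> int" where
  "hessian_row V Q r v = (\<Sum>u\<in>V. (Q u v + Q v u) * r u)"

lemma quad_deriv_int_direction:
  "quad_deriv V Q g x (\<lambda>v. of_int (r v)) =
      lin_form V (hessian_row V Q r) x + of_int (lin_form V g r)"
proof -
  have "(\<Sum>u\<in>V. of_int (r u) * (\<Sum>v\<in>V. of_int (Q u v + Q v u) * x v)) =
      lin_form V (hessian_row V Q r) x"
    unfolding sum_distrib_left by (subst sum.swap)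
      (simp add: lin_form_def hessian_row_def sum_distrib_left sum_distrib_right mult_ac)
  then show ?thesis
    by (simp add: quad_deriv_eq_sum distrib_left sum.distrib) (simp add: lin_form_def mult.commute)
qed

lemma hessian_row_mem_cube:
  assumes "card V \<le> s" "quad_size_le V Q g s" "r \<in> cube V s"
  shows "hessian_row V Q r \<in> cube V (3 * s + 1)"
proof (rule cubeI)
  fix v assume "v \<in> V"
  have "\<bar>(Q u v + Q v u) * r u\<bar> \<le> 2 ^ ((s + 1) + s)" if "u \<in> V" for u
  proof (rule abs_mult_le_power)
    have "\<bar>Q u v\<bar> \<le> 2 ^ s" "\<bar>Q v u\<bar> \<le> 2 ^ s"
      using assms that \<open>v \<in> V\<close>
      by (auto simp: quad_size_le_def cube_def)
    then show "\<bar>Q u v + Q v u\<bar> \<le> 2 ^ (s + 1)" by simp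
  qed (use assms that in \<open>simp add: cube_def\<close>)
  then have "\<bar>hessian_row V Q r v\<bar> \<le> 2 ^ (s + ((s + 1) + s))"
    unfolding hessian_row_def using assms(1) by (intro abs_sum_le_power)
  then show "\<bar>hessian_row V Q r v\<bar> \<le> 2 ^ (3 * s + 1)" by (rule power2_le_trans) simp
qed

lemma quad_deriv_neg_le:
  assumes t: "1 \<le> t" and y: "\<forall>v\<in>V. y v = of_int (n v) / of_int t"
    and neg: "quad_deriv V Q g y (\<lambda>v. of_int (r v)) < (0::real)"
  shows "of_int t * quad_deriv V Q g y (\<lambda>v. of_int (r v)) \<le> - 1"
proof -
  have "of_int t * lin_form V (hessian_row V Q r) y =
      lin_form V (hessian_row V Q r) (\<lambda>v. of_int (n v))"
    unfolding lin_form_scale[symmetric] using y t by (intro lin_form_cong) simp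
  then have integral: "of_int t * quad_deriv V Q g y (\<lambda>v. of_int (r v)) =
      real_of_int (lin_form V (hessian_row V Q r) n + t * lin_form V g r)"
    by (simp add: quad_deriv_int_direction distrib_left of_int_lin_form)
  have "of_int t * quad_deriv V Q g y (\<lambda>v. of_int (r v)) < 0"
    using t neg by (simp add: mult_pos_neg)
  then show ?thesis unfolding integral by (rule of_int_neg_le_minus_one)
qed

lemma height_le_add_ray:
  assumes y: "height_le V A y" and r: "\<And>v. v \<in> V \<Longrightarrow> \<bar>r v\<bar> \<le> int R"
  shows "height_le V (A + A * T * R) (\<lambda>v. y v + real T * of_int (r v))"
proof -
  obtain t n where t: "1 \<le> t" "t \<le> int A" and n: "\<forall>v\<in>V. \<bar>n v\<bar> \<le> int A"
    and yn: "\<forall>v\<in>V. y v = of_int (n v) / of_int t"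
    using y by (rule height_leE)
  have bound: "\<bar>n v + t * (int T * r v)\<bar> \<le> int (A + A * T * R)" if "v \<in> V" for v
  proof -
    have "\<bar>t * (int T * r v)\<bar> \<le> int A * (int T * int R)"
      unfolding abs_mult using t r[OF that] by (intro mult_mono) auto
    then show ?thesis using n that abs_triangle_ineq[of "n v" "t * (int T * r v)"]
      by (simp add: mult.assoc) force
  qed
  have "y v + real T * of_int (r v) = of_int (n v + t * (int T * r v)) / of_int t" if "v \<in> V" for v
    using t(1) yn that by (simp add: add_divide_distrib)
  moreover have "t \<le> int (A + A * T * R)" using t(2) by (rule order_trans) (simp del: of_nat_mult)
  ultimately show ?thesis
    unfolding height_le_def using t(1) bound
    by (intro exI[of _ t] exI[of _ "\<lambda>v. n v + t * (int T * r v)"]) blast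
qed

lemma long_step_nonpos:
  fixes q G h B T t :: real
  assumes q: "\<bar>q\<bar> \<le> B" and G: "\<bar>G\<bar> \<le> B" and T: "1 \<le> T" "2 * B \<le> T" "B * t \<le> T" and t: "1 \<le> t"
    and descent: "h \<le> - 1 \<or> h = 0 \<and> t * G \<le> - 1"
  shows "q + T * G + T\<^sup>2 * h \<le> 0"
  using descent
proof
  assume h: "h \<le> - 1"
  have "T\<^sup>2 * h \<le> - (T * T)" using mult_left_mono[OF h, of "T\<^sup>2"] by (simp add: power2_eq_square)
  moreover have "T * G \<le> T * B" using G T(1) by (intro mult_left_mono) auto
  moreover have "T * (2 * B) \<le> T * T" using T by (intro mult_left_mono) auto
  moreover have "1 * B \<le> T * B" using T(1) q by (intro mult_right_mono) auto
  ultimately show ?thesis using q by simp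
next
  assume h: "h = 0 \<and> t * G \<le> - 1"
  then have "G \<le> 0" using t by (smt (verit) mult_nonneg_nonneg)
  then have "T * G \<le> (B * t) * G" using T(3) by (intro mult_right_mono_neg) auto
  also have "\<dots> = B * (t * G)" by (simp add: mult.assoc)
  also have "\<dots> \<le> B * (- 1)" using h q by (intro mult_left_mono) auto
  finally show ?thesis using h q by simp
qed

definition descent_exp :: "nat \<Rightarrow> nat" where
  "descent_exp s = 2 * qp_exp (5 * (3 * s + 1)) + 10 * s + 6"

context miqp
begin

lemma ex_small_point_deriv_le:
  assumes z: "z \<in> mixed_integer_points V P Cs" "z \<in> cube V s" and r: "r \<in> cube V s"
  obtains y where "y \<in> mixed_integer_points V P Cs" "y \<in> cube V (3 * s + 1)"
    "height_le V (2 ^ qp_exp (5 * (3 * s + 1))) y"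
    "quad_deriv V H c y (\<lambda>v. of_int (r v)) \<le> quad_deriv V H c z (\<lambda>v. of_int (r v))"
proof -
  have row_size: "quad_size_le V (\<lambda>_ _. 0) (hessian_row V H r) (3 * s + 1)"
    using hessian_row_mem_cube[OF card_V quad_size r] by (simp add: quad_size_le_def)
  have Cs_size: "polyhedron_size_le V Cs (3 * s + 1)"
    by (rule polyhedron_size_le_mono[OF polyhedron_size]) simp
  have z_le: "z \<in> cube V (3 * s + 1)" by (rule cube_mono[OF _ z(2)]) simp
  obtain y where "y \<in> mixed_integer_points V P Cs" "y \<in> cube V (3 * s + 1)"
    "height_le V (2 ^ qp_exp (5 * (3 * s + 1))) y"
    "quad_fun V (\<lambda>_ _. 0) (hessian_row V H r) y \<le> quad_fun V (\<lambda>_ _. 0) (hessian_row V H r) z"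
    using fibre_minimizer_height[OF Cs_size row_size integer_vars z(1) z_le] by blast
  then show thesis by (intro that[of y]) (simp_all add: quad_fun_def quad_deriv_int_direction)
qed

lemma descent_step_nonpos:
  assumes y: "y \<in> cube V (3 * s + 1)" and r: "r \<in> cube V s"
    and t: "1 \<le> t" "t \<le> 2 ^ e" "\<forall>v\<in>V. y v = of_int (n v) / of_int t"
    and descent: "bil_form V H r r < 0 \<or>
      bil_form V H r r = 0 \<and> quad_deriv V H c y (\<lambda>v. of_int (r v)) < 0"
  shows "quad_fun V H c (\<lambda>v. y v + 2 ^ (9 * s + e + 5) * of_int (r v)) + real_of_int d \<le> 0"
proof -
  let ?\<rho> = "\<lambda>v. real_of_int (r v)" and ?B = "(2::real) ^ (9 * s + 4)"
  have "quad_fun V H c y + real_of_int d + 2 ^ (9 * s + e + 5) * quad_deriv V H c y ?\<rho> +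
      (2 ^ (9 * s + e + 5))\<^sup>2 * bil_form V H ?\<rho> ?\<rho> \<le> 0"
  proof (rule long_step_nonpos[where B = ?B and t = t])
    show "\<bar>quad_fun V H c y + real_of_int d\<bar> \<le> ?B"
      using abs_objective_le[OF y] by (rule power2_le_trans) simp
    have "?\<rho> \<in> cube V s" using r by (simp add: of_int_mem_cube)
    from abs_quad_deriv_le[OF card_V quad_size y this] show "\<bar>quad_deriv V H c y ?\<rho>\<bar> \<le> ?B"
      by (rule power2_le_trans) simp
    have power_split: "(2::real) ^ (9 * s + e + 5) = 2 * (?B * 2 ^ e)"
      by (simp add: power_add)
    show "2 * ?B \<le> 2 ^ (9 * s + e + 5)" unfolding power_split by simp
    have "?B * real_of_int t \<le> ?B * 2 ^ e" using t(2) by (intro mult_left_mono) simp_all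
    also have "\<dots> \<le> 2 ^ (9 * s + e + 5)" unfolding power_split by simp
    finally show "?B * real_of_int t \<le> 2 ^ (9 * s + e + 5)" .
    show "(1::real) \<le> 2 ^ (9 * s + e + 5)" by (rule one_le_power) simp
    show "bil_form V H ?\<rho> ?\<rho> \<le> - 1 \<or> bil_form V H ?\<rho> ?\<rho> = 0 \<and> t * quad_deriv V H c y ?\<rho> \<le> - 1"
      using descent quad_deriv_neg_le[OF t(1,3)] by (auto simp flip: of_int_bil_form)
  qed (use t(1) in simp)
  then show ?thesis by (simp add: quad_fun_add_scaled)
qed

lemma descent_feasible:
  assumes z: "z \<in> mixed_integer_points V P Cs" "z \<in> cube V s"
    and r: "r \<in> recession_cone V Cs" "r \<in> cube V s"
    and descent: "bil_form V H r r < 0 \<or>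
      bil_form V H r r = 0 \<and> quad_deriv V H c z (\<lambda>v. of_int (r v)) < 0"
  shows "\<exists>x\<in>feasible_points V P Cs H c d. height_le V (2 ^ descent_exp s) x"
proof -
  define e where "e = qp_exp (5 * (3 * s + 1))"
  define T where "T = (2::nat) ^ (9 * s + e + 5)"
  obtain y where y: "y \<in> mixed_integer_points V P Cs" "y \<in> cube V (3 * s + 1)"
    and height: "height_le V (2 ^ e) y"
    and deriv_le: "quad_deriv V H c y (\<lambda>v. of_int (r v)) \<le> quad_deriv V H c z (\<lambda>v. of_int (r v))"
    using ex_small_point_deriv_le[OF z r(2)] unfolding e_def by blast
  obtain t n where t: "1 \<le> t" "t \<le> int (2 ^ e)" "\<forall>v\<in>V. y v = of_int (n v) / of_int t"
    using height by (rule height_leE)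
  have "quad_fun V H c (\<lambda>v. y v + real T * of_int (r v)) + real_of_int d \<le> 0"
    using descent_step_nonpos[OF y(2) r(2) t(1) _ t(3), of e] t(2) descent deriv_le
    by (auto simp: T_def)
  then have "(\<lambda>v. y v + real T * of_int (r v)) \<in> feasible_points V P Cs H c d"
    using mixed_integer_points_add_recession[OF y(1) r(1)] by (simp add: feasible_points_def)
  moreover have "height_le V (2 ^ descent_exp s) (\<lambda>v. y v + real T * of_int (r v))"
  proof (rule height_le_mono[OF height_le_add_ray[OF height, of r "2 ^ s" T]])
    have "2 ^ e + 2 ^ e * T * 2 ^ s = 2 ^ e + 2 ^ (2 * e + 10 * s + 5)"
      by (simp add: T_def algebra_simps flip: power_add)
    also have "\<dots> \<le> 2 ^ (2 * e + 10 * s + 5) + 2 ^ (2 * e + 10 * s + 5)"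
      by (intro add_mono power_increasing) auto
    also have "\<dots> = 2 ^ descent_exp s" by (simp add: descent_exp_def e_def flip: mult_2 power_Suc)
    finally show "2 ^ e + 2 ^ e * T * 2 ^ s \<le> 2 ^ descent_exp s" .
  qed (use r(2) in \<open>simp add: cube_def\<close>)
  ultimately show ?thesis by blast
qed

lemma mixed_integer_decomposition:
  assumes x: "x \<in> mixed_integer_points V P Cs"
  obtains I K z where "finite I" "card I \<le> s + 1" "I \<subseteq> recession_cone V Cs" "I \<subseteq> cube V (ray_exp s)"
    "z \<in> mixed_integer_points V P Cs" "z \<in> cube V (s + 1 + ray_exp s)"
    "\<forall>v\<in>V. x v = z v + ray_sum I (\<lambda>r. real (K r)) v"
proof -
  have x_mem: "x \<in> polyhedron_of V Cs" and x_int: "\<forall>v\<in>P. x v \<in> \<int>"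
    using x by (auto simp: mixed_integer_points_def)
  obtain I K z
    where I: "finite I" "card I \<le> s + 1" "I \<subseteq> recession_cone V Cs" "I \<subseteq> cube V (ray_exp s)"
    and z: "z \<in> polyhedron_of V Cs" "z \<in> cube V (s + 1 + ray_exp s)"
    and x_eq: "\<forall>v\<in>V. x v = z v + ray_sum I (\<lambda>r. real (K r)) v"
    by (rule polyhedron_decomposition[OF polyhedron_size x_mem])
  have "z v = x v - of_int (ray_sum I (\<lambda>r. int (K r)) v)" if "v \<in> P" for v
    using x_eq integer_vars that by (auto simp: of_int_ray_sum)
  then have "z \<in> mixed_integer_points V P Cs"
    using z(1) x_int
    by (simp add: mixed_integer_points_def)
  from that[OF I this z(2) x_eq] show thesis .
qed

end

section \<open>Quadratic forms on the standard simplex\<close>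

definition simplex_constraints :: "'j set \<Rightarrow> 'j constraint set" where
  "simplex_constraints J = (\<lambda>a. (a, 0)) ` orthant_forms J (\<lambda>_. 1) \<union> equations {(\<lambda>_. 1, 1)}"

lemma polyhedron_of_simplex:
  assumes "finite J"
  shows "polyhedron_of J (simplex_constraints J) = {x. (\<forall>i\<in>J. 0 \<le> x i) \<and> (\<Sum>i\<in>J. x i) = 1}"
  using assms
  by (auto simp: simplex_constraints_def polyhedron_of_Un polyhedron_of_equations
      polyhedron_of_homogeneous polyhedral_cone_orthant_forms orthant_def lin_form_def)

lemma simplex_constraints_size:
  assumes "finite J"
  shows "polyhedron_size_le J (simplex_constraints J) (2 * card J + 2)"
proof -
  have fin: "finite (orthant_forms J (\<lambda>_. 1))" using assms by (simp add: orthant_forms_def)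
  have "card (simplex_constraints J) \<le> card J + 2 * card {(\<lambda>_::'a. 1::int, 1::int)}"
    unfolding simplex_constraints_def
    by (intro order_trans[OF card_Un_le] add_mono card_equations_le
        order_trans[OF card_image_le[OF fin] card_orthant_forms_le[OF assms]]) simp
  moreover have "finite (simplex_constraints J)"
    using fin by (simp add: simplex_constraints_def finite_equations)
  moreover have "constraints_le J (simplex_constraints J) 0"
    unfolding simplex_constraints_def constraints_le_Un constraints_le_equations
    by (auto simp: constraints_le_def cube_def orthant_forms_def unit_form_def)
  ultimately show ?thesis
    using assms constraints_le_mono[of J _ 0] by (simp add: polyhedron_size_le_def)
qed

lemma simplex_minimizer_homogeneous:
  assumes J: "finite J" and x: "x \<in> minimizers J (simplex_constraints J) M (\<lambda>_. 0)"
    and \<mu>: "\<And>i. i \<in> J \<Longrightarrow> 0 \<le> \<mu> i"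
  shows "(sum \<mu> J)\<^sup>2 * bil_form J M x x \<le> bil_form J M \<mu> \<mu>"
proof (cases "0 < sum \<mu> J")
  case True
  then have "(\<lambda>i. (1 / sum \<mu> J) * \<mu> i) \<in> polyhedron_of J (simplex_constraints J)"
    using \<mu> by (simp add: polyhedron_of_simplex[OF J] flip: sum_divide_distrib)
  then have "bil_form J M x x \<le> bil_form J M (\<lambda>i. (1 / sum \<mu> J) * \<mu> i) (\<lambda>i. (1 / sum \<mu> J) * \<mu> i)"
    using x by (simp add: minimizers_def quad_fun_def)
  then show ?thesis
    unfolding bil_form_scale_left bil_form_scale_right using True
    by (simp add: field_simps power2_eq_square)
next
  case False
  then have "sum \<mu> J = 0" using sum_nonneg[of J \<mu>] \<mu> by fastforce
  then have "\<mu> i = 0" if "i \<in> J" for i using \<mu> J that by (simp add: sum_nonneg_eq_0_iff)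
  then show ?thesis using \<open>sum \<mu> J = 0\<close> by (simp add: bil_form_def)
qed

lemma simplex_minimizer_height:
  assumes J: "finite J" "J \<noteq> {}" "card J \<le> s" and M: "\<And>i. i \<in> J \<Longrightarrow> M i \<in> cube J s"
  obtains x where "x \<in> minimizers J (simplex_constraints J) M (\<lambda>_. 0)"
    "height_le J (2 ^ qp_exp (2 * s + 2)) x"
proof -
  note S_iff = polyhedron_of_simplex[OF J(1)]
  have size: "polyhedron_size_le J (simplex_constraints J) (2 * s + 2)"
    using simplex_constraints_size[OF J(1)] by (rule polyhedron_size_le_mono) (use J(3) in simp)
  have "quad_size_le J M (\<lambda>_. 0) (2 * s + 2)"
    using M cube_mono[of s "2 * s + 2"] by (auto simp: quad_size_le_def)
  moreover have "(\<lambda>_. 1 / real (card J)) \<in> polyhedron_of J (simplex_constraints J)"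
    using J by (simp add: S_iff card_gt_0_iff)
  moreover have "polyhedron_of J (simplex_constraints J) \<subseteq> cube J 0"
    using J(1) member_le_sum[of _ J] by (fastforce simp: S_iff cube_def)
  ultimately show thesis
    using quadratic_program_height[OF size _ _ bounded_on_subset_cube] that by blast
qed

lemma simplex_form_minimizer:
  fixes M :: "'j \<Rightarrow> 'j \<Rightarrow> int"
  assumes J: "finite J" "J \<noteq> {}" "card J \<le> s" and M: "\<And>i. i \<in> J \<Longrightarrow> M i \<in> cube J s"
  obtains n :: "'j \<Rightarrow> nat" where "1 \<le> (\<Sum>i\<in>J. n i)" "(\<Sum>i\<in>J. n i) \<le> 2 ^ qp_exp (2 * s + 2)"
    "\<And>\<mu> :: 'j \<Rightarrow> real. (\<And>i. i \<in> J \<Longrightarrow> 0 \<le> \<mu> i) \<Longrightarrow>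
      (\<Sum>i\<in>J. \<mu> i)\<^sup>2 * bil_form J M (\<lambda>i. real (n i)) (\<lambda>i. real (n i)) \<le>
      (real (\<Sum>i\<in>J. n i))\<^sup>2 * bil_form J M \<mu> \<mu>"
proof -
  obtain x where x: "x \<in> minimizers J (simplex_constraints J) M (\<lambda>_. 0)"
    and height: "height_le J (2 ^ qp_exp (2 * s + 2)) x"
    using simplex_minimizer_height[OF J M] .
  obtain t :: int and k where t: "1 \<le> t" "t \<le> int (2 ^ qp_exp (2 * s + 2))"
    and k: "\<forall>i\<in>J. x i = of_int (k i) / of_int t"
    using height by (rule height_leE)
  have x_simplex: "\<forall>i\<in>J. 0 \<le> x i" "(\<Sum>i\<in>J. x i) = 1"
    using x polyhedron_of_simplex[OF J(1)] by (auto simp: minimizers_def)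
  define n where "n i = nat (k i)" for i
  have n: "real (n i) = t * x i" if "i \<in> J" for i
  proof -
    have "0 \<le> k i" using x_simplex(1) k t(1) that by (auto simp: zero_le_divide_iff)
    then show ?thesis using k t(1) that by (simp add: n_def)
  qed
  have sum_n: "real (\<Sum>i\<in>J. n i) = t"
    using x_simplex(2) by (simp add: n flip: sum_distrib_left)
  have form_n: "bil_form J M (\<lambda>i. real (n i)) (\<lambda>i. real (n i)) = (of_int t)\<^sup>2 * bil_form J M x x"
  proof -
    have "bil_form J M (\<lambda>i. real (n i)) (\<lambda>i. real (n i)) = bil_form J M (\<lambda>i. t * x i) (\<lambda>i. t * x i)"
      using n by (intro bil_form_cong) auto
    then show ?thesis by (simp add: bil_form_scale_left bil_form_scale_right power2_eq_square)
  qed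
  show thesis
  proof (rule that[of n])
    have "int (\<Sum>i\<in>J. n i) = t" using sum_n by linarith
    then have "int 1 \<le> int (\<Sum>i\<in>J. n i)" "int (\<Sum>i\<in>J. n i) \<le> int (2 ^ qp_exp (2 * s + 2))"
      using t by simp_all
    then show "1 \<le> (\<Sum>i\<in>J. n i)" "(\<Sum>i\<in>J. n i) \<le> 2 ^ qp_exp (2 * s + 2)"
      by (simp_all only: of_nat_le_iff)
    fix \<mu> :: "'j \<Rightarrow> real" assume "\<And>i. i \<in> J \<Longrightarrow> 0 \<le> \<mu> i"
    then have "(of_int t)\<^sup>2 * ((sum \<mu> J)\<^sup>2 * bil_form J M x x) \<le> (of_int t)\<^sup>2 * bil_form J M \<mu> \<mu>"
      using simplex_minimizer_homogeneous[OF J(1) x] by (intro mult_left_mono) auto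
    then show "(\<Sum>i\<in>J. \<mu> i)\<^sup>2 * bil_form J M (\<lambda>i. real (n i)) (\<lambda>i. real (n i)) \<le>
        (real (\<Sum>i\<in>J. n i))\<^sup>2 * bil_form J M \<mu> \<mu>"
      unfolding form_n sum_n by (simp add: mult_ac)
  qed
qed

section \<open>Bounding the ray multiplicities\<close>

lemma bil_form_flat_direction:
  fixes \<omega> \<kappa> :: "'v \<Rightarrow> real"
  assumes flat: "bil_form V Q \<omega> \<omega> = 0"
    and nonneg: "\<And>s. 0 < s \<Longrightarrow> 0 \<le> bil_form V Q (\<lambda>v. \<omega> v + s * \<kappa> v) (\<lambda>v. \<omega> v + s * \<kappa> v)"
  shows "0 \<le> bil_form V Q \<omega> \<kappa> + bil_form V Q \<kappa> \<omega>"
proof (rule linear_coeff_nonneg[of 1])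
  show "0 \<le> s * (bil_form V Q \<omega> \<kappa> + bil_form V Q \<kappa> \<omega>) + s\<^sup>2 * bil_form V Q \<kappa> \<kappa>" if "0 < s" for s
    using nonneg[OF that] flat by (simp add: form_linear_simps power2_eq_square algebra_simps)
qed simp

lemma quad_fun_diff_flat_le:
  fixes z \<omega> \<kappa> :: "'v \<Rightarrow> real"
  assumes "bil_form V Q \<omega> \<omega> = 0" "0 \<le> bil_form V Q \<omega> \<kappa> + bil_form V Q \<kappa> \<omega>"
    "0 \<le> quad_deriv V Q g z \<omega>"
  shows "quad_fun V Q g (\<lambda>v. z v + (\<kappa> v - \<omega> v)) \<le> quad_fun V Q g (\<lambda>v. z v + \<kappa> v)"
proof -
  have "0 \<le> quad_deriv V Q g (\<lambda>v. z v + \<kappa> v) \<omega>"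
    using assms(2,3) by (simp add: quad_deriv_def bil_form_add_left bil_form_add_right)
  then show ?thesis
    using quad_fun_add_scaled[of V Q g "\<lambda>v. z v + \<kappa> v" "- 1" \<omega>] assms(1)
    by (simp add: algebra_simps)
qed

lemma le_if_square_le:
  fixes \<sigma> A B :: real
  assumes "1 \<le> A" "1 \<le> B" and square: "\<sigma>\<^sup>2 \<le> A * (B + \<sigma> * B)"
  shows "\<sigma> \<le> 2 * A * B"
proof (cases "\<sigma> \<le> 1")
  case True
  have "1 * 1 \<le> A * B" using assms(1,2) by (intro mult_mono) auto
  then show ?thesis using True by simp
next
  case False
  have "A * (B + \<sigma> * B) \<le> A * (\<sigma> * B + \<sigma> * B)"
    using assms(1,2) False by (intro mult_left_mono add_right_mono) auto
  with square have "\<sigma> * \<sigma> \<le> \<sigma> * (2 * A * B)" by (simp add: power2_eq_square algebra_simps)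
  then show ?thesis using False by simp
qed

lemma ray_sum_of_nat:
  "(\<lambda>v. real_of_int (ray_sum J (\<lambda>r. int (n r)) v)) = ray_sum J (\<lambda>r. real (n r))"
  by (simp add: of_int_ray_sum fun_eq_iff)

lemma ray_sum_diff_subset:
  fixes K n :: "('v \<Rightarrow> int) \<Rightarrow> nat"
  assumes "finite I" "J \<subseteq> I" "\<And>r. r \<in> J \<Longrightarrow> n r \<le> K r"
  shows "ray_sum I (\<lambda>r. real (K r - (if r \<in> J then n r else 0))) v =
    ray_sum I (\<lambda>r. real (K r)) v - ray_sum J (\<lambda>r. real (n r)) v"
proof -
  have "ray_sum J (\<lambda>r. real (n r)) v = (\<Sum>r\<in>I. if r \<in> J then real (n r) * of_int (r v) else 0)"
    using assms(1,2) by (simp add: ray_sum_def sum.inter_restrict[symmetric] Int_absorb1)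
  then have "ray_sum I (\<lambda>r. real (K r)) v - ray_sum J (\<lambda>r. real (n r)) v =
      (\<Sum>r\<in>I. real (K r) * of_int (r v) - (if r \<in> J then real (n r) * of_int (r v) else 0))"
    by (simp add: ray_sum_def sum_subtractf)
  also have "\<dots> = ray_sum I (\<lambda>r. real (K r - (if r \<in> J then n r else 0))) v"
    unfolding ray_sum_def using assms(3)
    by (intro sum.cong) (auto simp: left_diff_distrib of_nat_diff)
  finally show ?thesis by simp
qed

lemma ray_sum_subset_diff:
  assumes "finite I" "J \<subseteq> I"
  shows "ray_sum I l v = ray_sum (I - J) l v + ray_sum J l v"
  unfolding ray_sum_def using assms by (simp add: sum.subset_diff[of J I])

lemma quad_deriv_ray_sum:
  "quad_deriv V Q g x (ray_sum J l) = (\<Sum>r\<in>J. l r * quad_deriv V Q g x (\<lambda>v. of_int (r v)))"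
  by (simp add: quad_deriv_def ray_sum_def[abs_def] bil_form_sum_left bil_form_sum_right
      lin_form_sum bil_form_scale_left bil_form_scale_right lin_form_scale distrib_left sum.distrib)

definition simplex_exp :: "nat \<Rightarrow> nat" where
  "simplex_exp s = qp_exp (2 * (3 * s + 2 * ray_exp s + 1) + 2)"

definition point_exp :: "nat \<Rightarrow> nat" where
  "point_exp s = s + 1 + ray_exp s + simplex_exp s"

locale miqp_rays = miqp V P Cs H c d s
  for V P :: "'v set" and Cs H c d s +
  fixes I :: "('v \<Rightarrow> int) set"
  assumes finite_I: "finite I" and card_I: "card I \<le> s + 1"
    and rays_recession: "I \<subseteq> recession_cone V Cs" and rays_le: "I \<subseteq> cube V (ray_exp s)"
begin

abbreviation ray_form :: "('v \<Rightarrow> int) set \<Rightarrow> (('v \<Rightarrow> int) \<Rightarrow> 'b) \<Rightarrow> 'b :: comm_ring_1" where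
  "ray_form J \<mu> \<equiv> bil_form V H (ray_sum J \<mu>) (ray_sum J \<mu>)"

abbreviation expand :: "('v \<Rightarrow> real) \<Rightarrow> (('v \<Rightarrow> int) \<Rightarrow> nat) \<Rightarrow> 'v \<Rightarrow> real" where
  "expand z K \<equiv> \<lambda>v. z v + ray_sum I (\<lambda>r. real (K r)) v"

lemma ray_simplex_minimizer:
  assumes J: "J \<subseteq> I" "J \<noteq> {}"
  obtains n :: "('v \<Rightarrow> int) \<Rightarrow> nat" where "1 \<le> (\<Sum>r\<in>J. n r)" "(\<Sum>r\<in>J. n r) \<le> 2 ^ simplex_exp s"
    "\<And>\<mu>. (\<And>r. r \<in> J \<Longrightarrow> 0 \<le> \<mu> r) \<Longrightarrow>
      (\<Sum>r\<in>J. \<mu> r)\<^sup>2 * ray_form J (\<lambda>r. real (n r)) \<le>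
      (real (\<Sum>r\<in>J. n r))\<^sup>2 * ray_form J \<mu>"
proof -
  have J_size: "finite J" "card J \<le> 3 * s + 2 * ray_exp s + 1"
    using J(1) finite_I card_I card_mono[OF finite_I J(1)] finite_subset by auto
  have form_le: "bil_form V H r \<in> cube J (3 * s + 2 * ray_exp s + 1)" if "r \<in> J" for r
  proof (rule cubeI)
    fix r' assume "r' \<in> J"
    then have "\<bar>bil_form V H r r'\<bar> \<le> 2 ^ (3 * s + ray_exp s + ray_exp s)"
      using card_V quad_size rays_le J(1) that
      by (intro abs_bil_form_le) (auto simp: quad_size_le_def)
    then show "\<bar>bil_form V H r r'\<bar> \<le> 2 ^ (3 * s + 2 * ray_exp s + 1)" by (rule power2_le_trans) simp
  qed
  show thesis
    using simplex_form_minimizer[where M = "bil_form V H", OF J_size(1) J(2) J_size(2) form_le,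
        folded simplex_exp_def bil_form_ray_sum]
      that by blast
qed

lemma abs_quad_deriv_ray_sum_le:
  fixes l :: "('v \<Rightarrow> int) \<Rightarrow> real"
  assumes J: "J \<subseteq> I" and l: "\<And>r. r \<in> J \<Longrightarrow> 0 \<le> l r" and x: "x \<in> cube V \<xi>"
  shows "\<bar>quad_deriv V H c x (ray_sum J l)\<bar> \<le> (\<Sum>r\<in>J. l r) * 2 ^ (3 * s + \<xi> + ray_exp s + 2)"
proof -
  have "\<bar>l r * quad_deriv V H c x (\<lambda>v. of_int (r v))\<bar> \<le> l r * 2 ^ (3 * s + \<xi> + ray_exp s + 2)"
    if "r \<in> J" for r
  proof -
    have "(\<lambda>v. real_of_int (r v)) \<in> cube V (ray_exp s)"
      using rays_le J that unfolding of_int_mem_cube by blast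
    from abs_quad_deriv_le[OF card_V quad_size x this] show ?thesis
      using l[OF that] by (simp add: abs_mult mult_left_mono)
  qed
  then show ?thesis
    unfolding quad_deriv_ray_sum sum_distrib_right by (intro order_trans[OF sum_abs] sum_mono)
qed

lemma small_combination:
  assumes J: "J \<subseteq> I" and n: "(\<Sum>r\<in>J. n r) \<le> 2 ^ simplex_exp s"
  shows "ray_sum J (\<lambda>r. int (n r)) \<in> recession_cone V Cs"
    and "ray_sum J (\<lambda>r. int (n r)) \<in> cube V (point_exp s)"
proof -
  show "ray_sum J (\<lambda>r. int (n r)) \<in> recession_cone V Cs"
    using J rays_recession by (intro polyhedral_cone_ray_sum) auto
  show "ray_sum J (\<lambda>r. int (n r)) \<in> cube V (point_exp s)"
  proof (rule cubeI)
    fix v assume "v \<in> V"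
    then have "\<bar>ray_sum J (\<lambda>r. int (n r)) v\<bar> \<le> (\<Sum>r\<in>J. int (n r)) * of_int (2 ^ ray_exp s)"
      using J rays_le by (intro abs_ray_sum_le) (auto simp: cube_def)
    also have "\<dots> \<le> 2 ^ simplex_exp s * 2 ^ ray_exp s"
      using n by (intro mult_mono) (simp_all add: sum_nonneg flip: of_nat_sum)
    finally have "\<bar>ray_sum J (\<lambda>r. int (n r)) v\<bar> \<le> 2 ^ (simplex_exp s + ray_exp s)"
      by (simp add: power_add)
    then show "\<bar>ray_sum J (\<lambda>r. int (n r)) v\<bar> \<le> 2 ^ point_exp s"
      by (rule power2_le_trans) (simp add: point_exp_def)
  qed
qed

definition expansions :: "(('v \<Rightarrow> real) \<times> (('v \<Rightarrow> int) \<Rightarrow> nat)) set" where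
  "expansions = {(z, K). z \<in> mixed_integer_points V P Cs \<and> z \<in> cube V (point_exp s) \<and>
     quad_fun V H c (expand z K) + of_int d \<le> 0}"

definition minimal_expansion :: "('v \<Rightarrow> real) \<Rightarrow> (('v \<Rightarrow> int) \<Rightarrow> nat) \<Rightarrow> bool" where
  "minimal_expansion z K \<longleftrightarrow> (z, K) \<in> expansions \<and> (\<forall>(z', K')\<in>expansions. (\<Sum>r\<in>I. K r) \<le> (\<Sum>r\<in>I. K' r))"

lemma ex_minimal_expansion:
  assumes "e \<in> expansions"
  obtains z K where "minimal_expansion z K"
  using ex_has_least_nat[of "\<lambda>e. e \<in> expansions" e "\<lambda>e. \<Sum>r\<in>I. snd e r"] assms
  unfolding minimal_expansion_def by fastforce

definition large_rays :: "(('v \<Rightarrow> int) \<Rightarrow> nat) \<Rightarrow> ('v \<Rightarrow> int) set" where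
  "large_rays K = {r \<in> I. 2 ^ simplex_exp s \<le> K r}"

lemma large_rays_subset: "large_rays K \<subseteq> I"
  by (auto simp: large_rays_def)

lemma expansion_feasible:
  assumes "(z, K) \<in> expansions"
  shows "expand z K \<in> feasible_points V P Cs H c d"
proof -
  have "ray_sum I (\<lambda>r. int (K r)) \<in> recession_cone V Cs"
    using rays_recession by (rule polyhedral_cone_ray_sum) simp
  then show ?thesis
    using assms mixed_integer_points_add_recession[of z V P Cs "ray_sum I (\<lambda>r. int (K r))" 1]
    by (simp add: expansions_def feasible_points_def of_int_ray_sum)
qed

end

locale miqp_no_descent = miqp_rays V P Cs H c d s I
  for V P :: "'v set" and Cs H c d s I +
  assumes curvature_nonneg:
      "\<And>\<rho> :: 'v \<Rightarrow> int. \<rho> \<in> recession_cone V Cs \<Longrightarrow> \<rho> \<in> cube V (point_exp s) \<Longrightarrow> 0 \<le> bil_form V H \<rho> \<rho>"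
    and slope_nonneg:
      "\<And>z \<rho>. z \<in> mixed_integer_points V P Cs \<Longrightarrow> z \<in> cube V (point_exp s) \<Longrightarrow>
       \<rho> \<in> recession_cone V Cs \<Longrightarrow> \<rho> \<in> cube V (point_exp s) \<Longrightarrow> bil_form V H \<rho> \<rho> = 0 \<Longrightarrow>
       0 \<le> quad_deriv V H c z (\<lambda>v. of_int (\<rho> v))"
begin

lemma ray_form_nonneg:
  fixes \<mu> :: "('v \<Rightarrow> int) \<Rightarrow> real"
  assumes J: "J \<subseteq> I" and \<mu>: "\<And>r. r \<in> J \<Longrightarrow> 0 \<le> \<mu> r"
  shows "0 \<le> ray_form J \<mu>"
proof (cases "J = {}")
  case True
  then show ?thesis by (simp add: ray_sum_def[abs_def] bil_form_def)
next
  case False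
  obtain n where n: "1 \<le> (\<Sum>r\<in>J. n r)" "(\<Sum>r\<in>J. n r) \<le> 2 ^ simplex_exp s"
    and least: "(\<Sum>r\<in>J. \<mu> r)\<^sup>2 * ray_form J (\<lambda>r. real (n r)) \<le>
      (real (\<Sum>r\<in>J. n r))\<^sup>2 * ray_form J \<mu>"
    using ray_simplex_minimizer[OF J False] \<mu> by metis
  have "0 \<le> ray_form J (\<lambda>r. int (n r))"
    by (rule curvature_nonneg[OF small_combination[OF J n(2)]])
  then have "0 \<le> ray_form J (\<lambda>r. real (n r))"
    by (simp flip: ray_sum_of_nat of_int_bil_form)
  then have "0 \<le> (real (\<Sum>r\<in>J. n r))\<^sup>2 * ray_form J \<mu>"
    using least by (meson mult_nonneg_nonneg order_trans zero_le_power2)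
  moreover have "0 < real (\<Sum>r\<in>J. n r)" using n(1) by (subst of_nat_0_less_iff) simp
  ultimately show ?thesis by (simp only: zero_le_mult_iff zero_less_power) (simp add: not_le)
qed

text \<open>At a zero of a copositive form the derivatives into the orthant are nonnegative.\<close>

lemma expansion_subtract_flat:
  assumes zK: "(z, K) \<in> expansions" and J: "J \<subseteq> I"
    and n: "(\<Sum>r\<in>J. n r) \<le> 2 ^ simplex_exp s" "\<And>r. r \<in> J \<Longrightarrow> n r \<le> K r"
    and flat: "ray_form J (\<lambda>r. int (n r)) = 0"
  shows "(z, \<lambda>r. K r - (if r \<in> J then n r else 0)) \<in> expansions"
proof -
  let ?\<kappa> = "ray_sum I (\<lambda>r. real (K r))" and ?\<omega> = "ray_sum J (\<lambda>r. real (n r))"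
  have flat_real: "bil_form V H ?\<omega> ?\<omega> = 0"
    using flat by (simp flip: ray_sum_of_nat of_int_bil_form)
  have "0 \<le> bil_form V H ?\<omega> ?\<kappa> + bil_form V H ?\<kappa> ?\<omega>"
  proof (rule bil_form_flat_direction[OF flat_real])
    fix \<tau> :: real assume "0 < \<tau>"
    define \<mu> where "\<mu> r = (if r \<in> J then real (n r) else 0) + \<tau> * real (K r)" for r
    have "ray_sum I (\<lambda>r. if r \<in> J then real (n r) else 0) = ?\<omega>"
      using finite_I J by (auto simp: ray_sum_def fun_eq_iff intro!: sum.mono_neutral_cong_right)
    then have "ray_sum I \<mu> = (\<lambda>v. ?\<omega> v + \<tau> * ?\<kappa> v)"
      by (simp add: \<mu>_def[abs_def] ray_sum_add_scaled fun_eq_iff)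
    moreover have "0 \<le> ray_form I \<mu>"
      using \<open>0 < \<tau>\<close> by (intro ray_form_nonneg) (auto simp: \<mu>_def)
    ultimately show "0 \<le> bil_form V H (\<lambda>v. ?\<omega> v + \<tau> * ?\<kappa> v) (\<lambda>v. ?\<omega> v + \<tau> * ?\<kappa> v)" by simp
  qed
  moreover have "0 \<le> quad_deriv V H c z ?\<omega>"
    using slope_nonneg[OF _ _ small_combination[OF J n(1)] flat] zK
    by (simp add: expansions_def ray_sum_of_nat)
  ultimately have "quad_fun V H c (\<lambda>v. z v + (?\<kappa> v - ?\<omega> v)) \<le> quad_fun V H c (\<lambda>v. z v + ?\<kappa> v)"
    by (rule quad_fun_diff_flat_le[OF flat_real])
  then show ?thesis
    using zK ray_sum_diff_subset[OF finite_I J n(2)] by (simp add: expansions_def)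
qed

lemma minimal_expansion_form_ge_one:
  assumes min: "minimal_expansion z K" and J: "J \<subseteq> large_rays K"
    and n: "1 \<le> (\<Sum>r\<in>J. n r)" "(\<Sum>r\<in>J. n r) \<le> 2 ^ simplex_exp s"
  shows "1 \<le> ray_form J (\<lambda>r. int (n r))"
proof (rule ccontr)
  assume less_one: "\<not> ?thesis"
  have JI: "J \<subseteq> I" using J large_rays_subset by blast
  have "finite J" using JI finite_I by (rule finite_subset)
  have "0 \<le> ray_form J (\<lambda>r. int (n r))"
    by (rule curvature_nonneg[OF small_combination[OF JI n(2)]])
  then have flat: "ray_form J (\<lambda>r. int (n r)) = 0"
    using less_one by simp
  define K' where "K' r = K r - (if r \<in> J then n r else 0)" for r
  have n_le: "n r \<le> K r" if "r \<in> J" for r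
  proof -
    have "n r \<le> (\<Sum>r\<in>J. n r)" using \<open>finite J\<close> that by (intro member_le_sum) auto
    then show ?thesis using n(2) J that by (force simp: large_rays_def)
  qed
  have "(z, K') \<in> expansions"
    using expansion_subtract_flat[OF _ JI n(2) n_le flat] min
    by (simp add: minimal_expansion_def K'_def[abs_def])
  then have "(\<Sum>r\<in>I. K r) \<le> (\<Sum>r\<in>I. K' r)" using min by (auto simp: minimal_expansion_def)
  moreover have "(\<Sum>r\<in>I. K r) = (\<Sum>r\<in>I. K' r) + (\<Sum>r\<in>I. if r \<in> J then n r else 0)"
    unfolding sum.distrib[symmetric] using n_le by (intro sum.cong) (auto simp: K'_def)
  moreover have "(\<Sum>r\<in>I. if r \<in> J then n r else 0) = (\<Sum>r\<in>J. n r)"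
    using finite_I JI by (simp add: sum.inter_restrict[symmetric] Int_absorb1)
  ultimately show False using n(1) by linarith
qed

lemma large_rays_square_le:
  assumes min: "minimal_expansion z K"
  defines "J \<equiv> large_rays K"
  shows "(\<Sum>r\<in>J. real (K r))\<^sup>2 \<le> 2 ^ (2 * simplex_exp s) * ray_form J (\<lambda>r. real (K r))"
proof (cases "J = {}")
  case True
  then show ?thesis by (simp add: ray_sum_def[abs_def] bil_form_def)
next
  case False
  have JI: "J \<subseteq> I" unfolding J_def by (rule large_rays_subset)
  obtain n where n: "1 \<le> (\<Sum>r\<in>J. n r)" "(\<Sum>r\<in>J. n r) \<le> 2 ^ simplex_exp s"
    and least: "(\<Sum>r\<in>J. real (K r))\<^sup>2 * ray_form J (\<lambda>r. real (n r)) \<le>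
      (real (\<Sum>r\<in>J. n r))\<^sup>2 * ray_form J (\<lambda>r. real (K r))"
    using ray_simplex_minimizer[OF JI False] of_nat_0_le_iff by metis
  have "1 \<le> ray_form J (\<lambda>r. int (n r))"
    using minimal_expansion_form_ge_one[OF min _ n] by (simp add: J_def)
  then have "1 \<le> ray_form J (\<lambda>r. real (n r))"
    by (simp flip: ray_sum_of_nat of_int_bil_form)
  then have "(\<Sum>r\<in>J. real (K r))\<^sup>2 * 1 \<le> (\<Sum>r\<in>J. real (K r))\<^sup>2 * ray_form J (\<lambda>r. real (n r))"
    by (intro mult_left_mono) auto
  also note least
  also have "(real (\<Sum>r\<in>J. n r))\<^sup>2 * ray_form J (\<lambda>r. real (K r)) \<le>
      2 ^ (2 * simplex_exp s) * ray_form J (\<lambda>r. real (K r))"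
  proof (rule mult_right_mono)
    have "real (\<Sum>r\<in>J. n r) \<le> real (2 ^ simplex_exp s)" using n(2) by (simp only: of_nat_le_iff)
    then have "(real (\<Sum>r\<in>J. n r))\<^sup>2 \<le> (2 ^ simplex_exp s)\<^sup>2"
      by (intro power_mono) (auto simp: sum_nonneg)
    then show "(real (\<Sum>r\<in>J. n r))\<^sup>2 \<le> 2 ^ (2 * simplex_exp s)"
      by (simp add: power_mult[symmetric] mult.commute)
    show "0 \<le> ray_form J (\<lambda>r. real (K r))" using JI by (rule ray_form_nonneg) simp
  qed
  finally show ?thesis by simp
qed

lemma small_part_mem_cube:
  assumes "(z, K) \<in> expansions"
  shows "(\<lambda>v. z v + ray_sum (I - large_rays K) (\<lambda>r. real (K r)) v) \<in> cube V (point_exp s + 1)"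
proof (rule cubeI)
  fix v assume v: "v \<in> V"
  let ?S = "I - large_rays K"
  have "real (K r) \<le> 2 ^ simplex_exp s" if "r \<in> ?S" for r
  proof -
    have "K r \<le> 2 ^ simplex_exp s" using that by (auto simp: large_rays_def)
    then have "real (K r) \<le> real (2 ^ simplex_exp s)" by (simp only: of_nat_le_iff)
    then show ?thesis by simp
  qed
  then have sum_le: "\<bar>\<Sum>r\<in>?S. real (K r)\<bar> \<le> 2 ^ ((s + 1) + simplex_exp s)"
    using card_I card_mono[OF finite_I, of ?S] by (intro abs_sum_le_power) auto
  have "\<bar>ray_sum ?S (\<lambda>r. real (K r)) v\<bar> \<le> (\<Sum>r\<in>?S. real (K r)) * of_int (2 ^ ray_exp s)"
    using rays_le v by (intro abs_ray_sum_le) (auto simp: cube_def)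
  also have "\<dots> \<le> 2 ^ ((s + 1) + simplex_exp s) * of_int (2 ^ ray_exp s)"
    using sum_le by (intro mult_right_mono) auto
  also have "\<dots> = 2 ^ point_exp s" by (simp add: point_exp_def power_add mult_ac)
  finally have "\<bar>ray_sum ?S (\<lambda>r. real (K r)) v\<bar> \<le> 2 ^ point_exp s" .
  moreover have "\<bar>z v\<bar> \<le> 2 ^ point_exp s" using assms v by (auto simp: expansions_def cube_def)
  ultimately show "\<bar>z v + ray_sum ?S (\<lambda>r. real (K r)) v\<bar> \<le> 2 ^ (point_exp s + 1)" by simp
qed

lemma large_rays_sum_le:
  assumes min: "minimal_expansion z K"
  shows "(\<Sum>r\<in>large_rays K. real (K r)) \<le> 2 ^ (7 * point_exp s + 5)"
proof -
  define J where "J = large_rays K"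
  define z' where "z' v = z v + ray_sum (I - J) (\<lambda>r. real (K r)) v" for v
  let ?\<kappa> = "ray_sum J (\<lambda>r. real (K r))"
  let ?\<sigma> = "\<Sum>r\<in>J. real (K r)"
  define k where "k = 5 * point_exp s + 4"
  have zK: "(z, K) \<in> expansions" using min by (simp add: minimal_expansion_def)
  have z': "z' \<in> cube V (point_exp s + 1)"
    using small_part_mem_cube[OF zK] by (simp add: z'_def[abs_def] J_def)
  have s_le: "s \<le> point_exp s" "ray_exp s \<le> point_exp s" by (simp_all add: point_exp_def)
  have objective: "\<bar>quad_fun V H c z' + of_int d\<bar> \<le> 2 ^ k"
    using abs_objective_le[OF z'] by (rule power2_le_trans) (use s_le in \<open>simp add: k_def\<close>)
  have "\<bar>quad_deriv V H c z' ?\<kappa>\<bar> \<le> ?\<sigma> * 2 ^ (3 * s + (point_exp s + 1) + ray_exp s + 2)"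
    using large_rays_subset z' by (intro abs_quad_deriv_ray_sum_le) (auto simp: J_def)
  also have "\<dots> \<le> ?\<sigma> * 2 ^ k"
    using s_le by (intro mult_left_mono power_increasing) (auto simp: k_def sum_nonneg)
  finally have slope: "\<bar>quad_deriv V H c z' ?\<kappa>\<bar> \<le> ?\<sigma> * 2 ^ k" .
  have "expand z K = (\<lambda>v. z' v + 1 * ?\<kappa> v)"
    unfolding z'_def J_def ray_sum_subset_diff[OF finite_I large_rays_subset[of K]]
    by (simp add: add.assoc)
  then have "quad_fun V H c (\<lambda>v. z' v + 1 * ?\<kappa> v) + of_int d \<le> 0"
    using zK by (simp add: expansions_def)
  then have "bil_form V H ?\<kappa> ?\<kappa> \<le> 2 ^ k + ?\<sigma> * 2 ^ k"
    using objective slope unfolding quad_fun_add_scaled by simp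
  then have "2 ^ (2 * simplex_exp s) * bil_form V H ?\<kappa> ?\<kappa> \<le>
      2 ^ (2 * simplex_exp s) * (2 ^ k + ?\<sigma> * 2 ^ k)"
    by (intro mult_left_mono) auto
  then have "?\<sigma>\<^sup>2 \<le> 2 ^ (2 * simplex_exp s) * (2 ^ k + ?\<sigma> * 2 ^ k)"
    using large_rays_square_le[OF min] unfolding J_def by linarith
  then have "?\<sigma> \<le> 2 * 2 ^ (2 * simplex_exp s) * 2 ^ k"
    by (intro le_if_square_le) auto
  then have "?\<sigma> \<le> 2 ^ (2 * simplex_exp s + k + 1)" by (simp add: power_add)
  then show ?thesis unfolding J_def by (rule power2_le_trans) (simp add: k_def point_exp_def)
qed

lemma minimal_expansion_mem_cube:
  assumes min: "minimal_expansion z K"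
  shows "expand z K \<in> cube V (8 * point_exp s + 6)"
proof (rule cubeI)
  fix v assume v: "v \<in> V"
  define J where "J = large_rays K"
  have "\<bar>ray_sum J (\<lambda>r. real (K r)) v\<bar> \<le> (\<Sum>r\<in>J. real (K r)) * of_int (2 ^ ray_exp s)"
    using rays_le large_rays_subset v unfolding J_def
    by (intro abs_ray_sum_le) (auto simp: cube_def)
  also have "\<dots> \<le> 2 ^ (7 * point_exp s + 5) * of_int (2 ^ ray_exp s)"
    using large_rays_sum_le[OF min] unfolding J_def by (intro mult_right_mono) auto
  also have "\<dots> = 2 ^ (7 * point_exp s + 5 + ray_exp s)" by (simp add: power_add)
  finally have "\<bar>ray_sum J (\<lambda>r. real (K r)) v\<bar> \<le> 2 ^ (8 * point_exp s + 5)"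
    by (rule power2_le_trans) (simp add: point_exp_def)
  moreover have "\<bar>z v + ray_sum (I - J) (\<lambda>r. real (K r)) v\<bar> \<le> 2 ^ (8 * point_exp s + 5)"
  proof -
    have "(z, K) \<in> expansions" using min by (simp add: minimal_expansion_def)
    from cubeD[OF small_part_mem_cube[OF this] v] show ?thesis
      unfolding J_def by (rule power2_le_trans) simp
  qed
  moreover have "ray_sum I (\<lambda>r. real (K r)) v =
      ray_sum (I - J) (\<lambda>r. real (K r)) v + ray_sum J (\<lambda>r. real (K r)) v"
    unfolding J_def by (rule ray_sum_subset_diff[OF finite_I large_rays_subset])
  moreover have "(2::real) ^ (8 * point_exp s + 6) = 2 * 2 ^ (8 * point_exp s + 5)"
    by (simp flip: power_Suc)
  ultimately show "\<bar>z v + ray_sum I (\<lambda>r. real (K r)) v\<bar> \<le> 2 ^ (8 * point_exp s + 6)"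
    by linarith
qed

lemma feasible_height_if_no_descent:
  assumes "e \<in> expansions"
  shows "\<exists>x\<in>feasible_points V P Cs H c d. height_le V (2 ^ qp_exp (5 * (8 * point_exp s + 6))) x"
proof -
  obtain z K where min: "minimal_expansion z K" using ex_minimal_expansion[OF assms] .
  define x where "x v = z v + ray_sum I (\<lambda>r. real (K r)) v" for v
  have x: "x \<in> feasible_points V P Cs H c d"
    using expansion_feasible[of z K] min by (simp add: minimal_expansion_def x_def[abs_def])
  interpret large: miqp V P Cs H c d "8 * point_exp s + 6"
    by (rule miqp_mono) (simp add: point_exp_def)
  have "x \<in> mixed_integer_points V P Cs" using x by (simp add: feasible_points_def)
  moreover have "x \<in> cube V (8 * point_exp s + 6)"
    using minimal_expansion_mem_cube[OF min] by (simp add: x_def[abs_def])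
  ultimately obtain y where "y \<in> mixed_integer_points V P Cs"
      "height_le V (2 ^ qp_exp (5 * (8 * point_exp s + 6))) y" "quad_fun V H c y \<le> quad_fun V H c x"
    using fibre_minimizer_height[OF large.polyhedron_size large.quad_size integer_vars] by blast
  then show ?thesis using x by (intro bexI[of _ y]) (auto simp: feasible_points_def)
qed

end

definition miqp_exp :: "nat \<Rightarrow> nat" where
  "miqp_exp s = descent_exp (point_exp s) + qp_exp (5 * (8 * point_exp s + 6))"

theorem (in miqp) ex_feasible_height:
  assumes x: "x \<in> feasible_points V P Cs H c d"
  shows "\<exists>y\<in>feasible_points V P Cs H c d. height_le V (2 ^ miqp_exp s) y"
proof (cases "\<exists>y\<in>feasible_points V P Cs H c d. height_le V (2 ^ descent_exp (point_exp s)) y")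
  case True
  then show ?thesis
    using height_le_mono[of V "2 ^ descent_exp (point_exp s)" _ "2 ^ miqp_exp s"]
    by (auto simp: miqp_exp_def power_increasing)
next
  case no_descent: False
  interpret point: miqp V P Cs H c d "point_exp s" by (rule miqp_mono) (simp add: point_exp_def)
  obtain I K z
    where I: "finite I" "card I \<le> s + 1" "I \<subseteq> recession_cone V Cs" "I \<subseteq> cube V (ray_exp s)"
    and z: "z \<in> mixed_integer_points V P Cs" "z \<in> cube V (s + 1 + ray_exp s)"
    and x_eq: "\<forall>v\<in>V. x v = z v + ray_sum I (\<lambda>r. real (K r)) v"
    by (rule mixed_integer_decomposition[of x]) (use x in \<open>simp add: feasible_points_def\<close>)
  have z_small: "z \<in> cube V (point_exp s)" by (rule cube_mono[OF _ z(2)]) (simp add: point_exp_def)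
  interpret miqp_no_descent V P Cs H c d s I
  proof
    fix \<rho> :: "'v \<Rightarrow> int"
    assume \<rho>: "\<rho> \<in> recession_cone V Cs" "\<rho> \<in> cube V (point_exp s)"
    show "0 \<le> bil_form V H \<rho> \<rho>"
      using point.descent_feasible[OF z(1) z_small \<rho>] no_descent by force
    show "0 \<le> quad_deriv V H c y (\<lambda>v. of_int (\<rho> v))"
      if "y \<in> mixed_integer_points V P Cs" "y \<in> cube V (point_exp s)" "bil_form V H \<rho> \<rho> = 0" for y
      using point.descent_feasible[OF that(1,2) \<rho>] that(3) no_descent by force
  qed (fact I)+
  have "quad_fun V H c (expand z K) = quad_fun V H c x"
    by (rule quad_fun_cong) (simp add: x_eq)
  then have "(z, K) \<in> expansions"
    using x z(1) z_small by (simp add: expansions_def feasible_points_def)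
  from feasible_height_if_no_descent[OF this] show ?thesis
    using height_le_mono[of V "2 ^ qp_exp (5 * (8 * point_exp s + 6))" _ "2 ^ miqp_exp s"]
    by (auto simp: miqp_exp_def power_increasing)
qed

section \<open>Encoding sizes\<close>

definition polynomial_fun :: "(nat \<Rightarrow> nat) \<Rightarrow> bool" where
  "polynomial_fun g \<longleftrightarrow> (\<exists>f :: real poly. \<forall>k. real (g k) = poly f (real k))"

lemma polynomial_fun_const: "polynomial_fun (\<lambda>_. a)"
  unfolding polynomial_fun_def by (intro exI[of _ "[:real a:]"]) simp

lemma polynomial_fun_id: "polynomial_fun (\<lambda>k. k)"
  unfolding polynomial_fun_def by (intro exI[of _ "[:0, 1:]"]) simp

lemma polynomial_fun_add: "polynomial_fun g \<Longrightarrow> polynomial_fun h \<Longrightarrow> polynomial_fun (\<lambda>k. g k + h k)"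
  unfolding polynomial_fun_def by (metis of_nat_add poly_add)

lemma polynomial_fun_mult: "polynomial_fun g \<Longrightarrow> polynomial_fun h \<Longrightarrow> polynomial_fun (\<lambda>k. g k * h k)"
  unfolding polynomial_fun_def by (metis of_nat_mult poly_mult)

lemma polynomial_fun_compose: "polynomial_fun g \<Longrightarrow> polynomial_fun h \<Longrightarrow> polynomial_fun (\<lambda>k. g (h k))"
  unfolding polynomial_fun_def by (metis poly_pcompose)

lemmas polynomial_fun_intros =
  polynomial_fun_const polynomial_fun_id polynomial_fun_add polynomial_fun_mult

lemma polynomial_fun_qp_exp: "polynomial_fun qp_exp"
  unfolding qp_exp_def[abs_def] by (intro polynomial_fun_intros)

lemma polynomial_fun_ray_exp: "polynomial_fun ray_exp"
  unfolding ray_exp_def[abs_def]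
  by (intro polynomial_fun_intros polynomial_fun_compose[OF polynomial_fun_qp_exp])

lemma polynomial_fun_simplex_exp: "polynomial_fun simplex_exp"
  unfolding simplex_exp_def[abs_def]
  by (intro polynomial_fun_intros polynomial_fun_ray_exp
      polynomial_fun_compose[OF polynomial_fun_qp_exp])

lemma polynomial_fun_point_exp: "polynomial_fun point_exp"
  unfolding point_exp_def[abs_def]
  by (intro polynomial_fun_intros polynomial_fun_ray_exp polynomial_fun_simplex_exp)

lemma polynomial_fun_descent_exp: "polynomial_fun descent_exp"
  unfolding descent_exp_def[abs_def]
  by (intro polynomial_fun_intros polynomial_fun_compose[OF polynomial_fun_qp_exp])

lemma polynomial_fun_miqp_exp: "polynomial_fun miqp_exp"
  unfolding miqp_exp_def[abs_def]
  by (intro polynomial_fun_intros polynomial_fun_point_exp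
      polynomial_fun_compose[OF polynomial_fun_qp_exp]
      polynomial_fun_compose[OF polynomial_fun_descent_exp])

lemma quotient_of_le:
  fixes r :: rat
  shows "snd (quotient_of r) \<le> 2 ^ rat_complexity r"
    "\<bar>fst (quotient_of r)\<bar> \<le> 2 ^ rat_complexity r"
proof -
  obtain a q where aq: "quotient_of r = (a, q)" by fastforce
  have nat_le: "nat k \<le> 2 ^ rat_complexity r"
    if "floorlog 2 (nat k) \<le> rat_complexity r" for k :: int
    using that by (simp add: floorlog_le_iff)
  have "nat q \<le> 2 ^ rat_complexity r" "nat \<bar>a\<bar> \<le> 2 ^ rat_complexity r"
    by (rule nat_le, simp add: rat_complexity_eq[OF aq])+
  then show "snd (quotient_of r) \<le> 2 ^ rat_complexity r"
    "\<bar>fst (quotient_of r)\<bar> \<le> 2 ^ rat_complexity r"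
    by (simp_all add: aq nat_le_iff)
qed

definition common_denom :: "rat list \<Rightarrow> int" where
  "common_denom L = (\<Prod>r\<leftarrow>L. snd (quotient_of r))"

lemma common_denom_bounds: "1 \<le> common_denom L \<and> common_denom L \<le> 2 ^ (\<Sum>r\<leftarrow>L. rat_complexity r)"
proof (induction L)
  case Nil
  show ?case by (simp add: common_denom_def)
next
  case (Cons r L)
  have "1 * 1 \<le> snd (quotient_of r) * common_denom L"
    using Cons quotient_of_denom_pos'[of r] by (intro mult_mono) auto
  moreover have "snd (quotient_of r) * common_denom L
      \<le> 2 ^ rat_complexity r * 2 ^ (\<Sum>r\<leftarrow>L. rat_complexity r)"
    using Cons quotient_of_le(1)[of r] by (intro mult_mono) auto
  ultimately show ?case by (simp add: common_denom_def power_add)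
qed

lemma common_denom_scales:
  assumes r: "r \<in> set L"
  obtains k :: int
    where "of_int k = r * of_int (common_denom L)" "\<bar>k\<bar> \<le> 2 ^ (2 * (\<Sum>r\<leftarrow>L. rat_complexity r))"
proof -
  let ?S = "\<Sum>r\<leftarrow>L. rat_complexity r"
  obtain a q where aq: "quotient_of r = (a, q)" by fastforce
  have q: "q > 0" using aq by (rule quotient_of_denom_pos)
  have "q dvd common_denom L"
    unfolding common_denom_def using r aq by (intro prod_list_dvd) force
  then obtain m where m: "common_denom L = q * m" by blast
  have "1 \<le> m" using common_denom_bounds[of L] q m by (smt (verit) zero_less_mult_iff)
  then have "m \<le> common_denom L" using q m by (simp add: mult_le_cancel_right1)
  then have "\<bar>m\<bar> \<le> 2 ^ ?S" using common_denom_bounds[of L] \<open>1 \<le> m\<close> by linarith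
  moreover have "\<bar>a\<bar> \<le> 2 ^ ?S"
  proof (rule power2_le_trans)
    show "\<bar>a\<bar> \<le> 2 ^ rat_complexity r" using quotient_of_le(2)[of r] aq by simp
    show "rat_complexity r \<le> ?S" using r by (intro member_le_sum_list) auto
  qed
  ultimately have "\<bar>a * m\<bar> \<le> 2 ^ (2 * ?S)"
    using abs_mult_le_power[of a ?S m ?S] by (simp add: mult_2)
  moreover have "of_int (a * m) = r * of_int (common_denom L)"
    using q quotient_of_div[OF aq] by (simp add: m)
  ultimately show thesis using that by blast
qed

lemma rat_complexity_quotient_le:
  assumes "1 \<le> t" "t \<le> 2 ^ e" "\<bar>a\<bar> \<le> 2 ^ e"
  shows "rat_complexity (of_int a / of_int t) \<le> 2 * e + 3"
proof -
  have bits: "\<exists>B. bits_val B = nat k \<and> length B \<le> e + 1" if "k \<le> 2 ^ e" for k :: int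
  proof -
    obtain B where "bits_val B = nat k" "length B = floorlog 2 (nat k)" using ex_bits_val by blast
    moreover have "nat k < 2 ^ (e + 1)"
    proof (rule le_less_trans)
      show "nat k \<le> 2 ^ e" using that by (simp add: nat_le_iff)
    qed simp
    ultimately show ?thesis by (auto simp: floorlog_le_iff)
  qed
  obtain A T where A: "bits_val A = nat \<bar>a\<bar>" "length A \<le> e + 1"
    and T: "bits_val T = nat t" "length T \<le> e + 1"
    using bits assms(2,3) by meson
  have "encodes_rat (a < 0, A, T) (of_int a / of_int t)"
    using assms(1) by (simp add: A T of_nat_nat)
  then have "rat_complexity (of_int a / of_int t) \<le> rat_code_size (a < 0, A, T)"
    unfolding rat_complexity_def by (intro Least_le) blast
  then show ?thesis using A(2) T(2) by simp
qed

lemma ex_rat_vec_of_height: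
  assumes "height_le {..<n} (2 ^ e) x"
  obtains x0 :: "rat vec" where "x0 \<in> carrier_vec n" "\<forall>j<n. real_of_rat (x0 $ j) = x j"
    "vec_complexity x0 \<le> n * (2 * e + 4)"
proof -
  obtain t k where t: "1 \<le> t" "t \<le> int (2 ^ e)" and k: "\<forall>j\<in>{..<n}. \<bar>k j\<bar> \<le> int (2 ^ e)"
    and x: "\<forall>j\<in>{..<n}. x j = of_int (k j) / of_int t"
    using assms by (rule height_leE)
  define x0 :: "rat vec" where "x0 = Matrix.vec n (\<lambda>j. of_int (k j) / of_int t)"
  have "(\<Sum>j<n. rat_complexity (x0 $ j)) \<le> (\<Sum>j<n. 2 * e + 3)"
    using t k by (intro sum_mono) (auto simp: x0_def intro!: rat_complexity_quotient_le)
  then have "vec_complexity x0 \<le> n * (2 * e + 4)"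
    unfolding vec_complexity_eq by (simp add: x0_def algebra_simps)
  then show thesis using x by (intro that[of x0]) (auto simp: x0_def of_rat_divide)
qed

section \<open>Rational instances\<close>

lemma nth_mem_list_of_vec: "i < dim_vec v \<Longrightarrow> v $ i \<in> set (list_of_vec v)"
  by (auto simp: list_of_vec_map)

definition mat_entries :: "rat mat \<Rightarrow> rat list" where
  "mat_entries M = concat (map list_of_vec (rows M))"

lemma nth_mem_mat_entries:
  assumes "i < dim_row M" "j < dim_col M"
  shows "M $$ (i, j) \<in> set (mat_entries M)"
proof -
  have "row M i \<in> set (rows M)" using assms by (auto simp: rows_def)
  moreover have "M $$ (i, j) \<in> set (list_of_vec (row M i))"
    using nth_mem_list_of_vec[of j "row M i"] assms by simp
  ultimately show ?thesis by (auto simp: mat_entries_def)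
qed

lemma sum_rat_complexity_vec_le: "(\<Sum>r\<leftarrow>list_of_vec v. rat_complexity r) \<le> vec_complexity v"
  unfolding vec_complexity_list by (intro sum_list_mono) simp

lemma sum_rat_complexity_mat_le: "(\<Sum>r\<leftarrow>mat_entries M. rat_complexity r) \<le> mat_complexity M"
proof -
  have "(\<Sum>r\<leftarrow>concat (map list_of_vec vs). rat_complexity r) \<le> (\<Sum>v\<leftarrow>vs. vec_complexity v)" for vs
    by (induction vs) (simp_all add: add_mono sum_rat_complexity_vec_le)
  then show ?thesis unfolding mat_complexity_list mat_entries_def .
qed

locale rational_miqp =
  fixes n p m :: nat and H :: "rat mat" and c :: "rat vec" and d :: rat and A :: "rat mat"
    and b :: "rat vec"
  assumes p_le: "p \<le> n" and H: "H \<in> carrier_mat n n" and c: "c \<in> carrier_vec n"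
    and A: "A \<in> carrier_mat m n" and b: "b \<in> carrier_vec m"
begin

abbreviation \<phi> :: nat where
  "\<phi> \<equiv> miqp_complexity H c d A b"

definition entries :: "rat list" where
  "entries = mat_entries H @ list_of_vec c @ [d] @ mat_entries A @ list_of_vec b"

definition scaled :: "rat \<Rightarrow> int" where
  "scaled r = \<lfloor>r * of_int (common_denom entries)\<rfloor>"

definition scaled_constraints :: "nat constraint set" where
  "scaled_constraints = (\<lambda>i. (\<lambda>j. scaled (A $$ (i, j)), scaled (b $ i))) ` {..<m}"

abbreviation scaled_H :: "nat \<Rightarrow> nat \<Rightarrow> int" where
  "scaled_H \<equiv> \<lambda>i j. scaled (H $$ (i, j))"

abbreviation scaled_c :: "nat \<Rightarrow> int" where
  "scaled_c \<equiv> \<lambda>j. scaled (c $ j)"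

abbreviation scaled_points :: "(nat \<Rightarrow> real) set" where
  "scaled_points \<equiv> feasible_points {..<n} {..<p} scaled_constraints scaled_H scaled_c (scaled d)"

lemma entries_mem:
  "\<And>i j. i < n \<Longrightarrow> j < n \<Longrightarrow> H $$ (i, j) \<in> set entries" "\<And>j. j < n \<Longrightarrow> c $ j \<in> set entries"
  "d \<in> set entries"
  "\<And>i j. i < m \<Longrightarrow> j < n \<Longrightarrow> A $$ (i, j) \<in> set entries" "\<And>i. i < m \<Longrightarrow> b $ i \<in> set entries"
  using H c A b nth_mem_mat_entries[of _ H] nth_mem_mat_entries[of _ A]
    nth_mem_list_of_vec[of _ c] nth_mem_list_of_vec[of _ b]
  by (auto simp: entries_def)

lemma scaled_entry:
  assumes "r \<in> set entries"
  shows "real_of_int (scaled r) = real_of_int (common_denom entries) * real_of_rat r"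
    and "\<bar>scaled r\<bar> \<le> 2 ^ (2 * \<phi>)"
proof -
  obtain k where k: "of_int k = r * of_int (common_denom entries)"
    and k_le: "\<bar>k\<bar> \<le> 2 ^ (2 * (\<Sum>r\<leftarrow>entries. rat_complexity r))"
    using common_denom_scales[OF assms] .
  have scaled_k: "scaled r = k" unfolding scaled_def k[symmetric] by simp
  have "real_of_rat (of_int k) = real_of_rat (r * of_int (common_denom entries))" by (simp only: k)
  then show "real_of_int (scaled r) = real_of_int (common_denom entries) * real_of_rat r"
    by (simp add: scaled_k of_rat_mult mult.commute)
  have "2 * (\<Sum>r\<leftarrow>entries. rat_complexity r) \<le> 2 * \<phi>"
    unfolding entries_def miqp_complexity_def
    using sum_rat_complexity_vec_le[of c] sum_rat_complexity_vec_le[of b]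
      sum_rat_complexity_mat_le[of H] sum_rat_complexity_mat_le[of A] by simp
  with k_le show "\<bar>scaled r\<bar> \<le> 2 ^ (2 * \<phi>)"
    unfolding scaled_k by (rule power2_le_trans)
qed

lemma dims_le_complexity: "n + m \<le> \<phi>"
  using c b by (simp add: miqp_complexity_def vec_complexity_eq)

lemma scaled_miqp:
  "miqp {..<n} {..<p} scaled_constraints scaled_H scaled_c (scaled d) (2 * \<phi>)"
proof
  have "card scaled_constraints \<le> m"
    unfolding scaled_constraints_def using card_image_le[of "{..<m}"] by force
  then show "polyhedron_size_le {..<n} scaled_constraints (2 * \<phi>)"
    using dims_le_complexity entries_mem scaled_entry(2)
    by (auto simp: polyhedron_size_le_def constraints_le_def scaled_constraints_def cube_def)
  show "quad_size_le {..<n} scaled_H scaled_c (2 * \<phi>)"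
    using entries_mem scaled_entry(2) by (auto simp: quad_size_le_def cube_def)
qed (use p_le entries_mem(3) scaled_entry(2) in auto)

lemma scaled_quad_fun:
  assumes y: "y \<in> carrier_vec n"
  shows "quad_fun {..<n} scaled_H scaled_c (\<lambda>j. y $ j) + real_of_int (scaled d) =
    common_denom entries * (y \<bullet> (map_mat of_rat H *\<^sub>v y) + map_vec of_rat c \<bullet> y + of_rat d)"
  using y H c
  by (simp add: quad_fun_def bil_form_def lin_form_def scaled_entry(1) entries_mem
      scalar_prod_def atLeast0LessThan sum_distrib_left distrib_left mult_ac)

lemma scaled_row:
  assumes y: "y \<in> carrier_vec n" and i: "i < m"
  shows "lin_form {..<n} (\<lambda>j. scaled (A $$ (i, j))) (\<lambda>j. y $ j) =
    common_denom entries * (map_mat real_of_rat A *\<^sub>v y) $ i"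
  using y A i
  by (simp add: lin_form_def scaled_entry(1) entries_mem scalar_prod_def atLeast0LessThan
    sum_distrib_left mult_ac)

lemma feasible_iff_scaled:
  assumes y: "y \<in> carrier_vec n"
  shows "y \<in> miqp_feasible n p H c d A b \<longleftrightarrow> (\<lambda>j. y $ j) \<in> scaled_points"
proof -
  have pos: "0 < real_of_int (common_denom entries)" using common_denom_bounds[of entries] by simp
  have "lin_form {..<n} (\<lambda>j. scaled (A $$ (i, j))) (\<lambda>j. y $ j) \<le> real_of_int (scaled (b $ i)) \<longleftrightarrow>
      (map_mat of_rat A *\<^sub>v y) $ i \<le> map_vec of_rat b $ i" if "i < m" for i
    using pos b that by (simp add: scaled_row[OF y that] scaled_entry(1) entries_mem)
  then have "(\<lambda>j. y $ j) \<in> polyhedron_of {..<n} scaled_constraints \<longleftrightarrow>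
      map_mat of_rat A *\<^sub>v y \<le> map_vec of_rat b"
    using A b by (auto simp: polyhedron_of_def scaled_constraints_def less_eq_vec_def)
  moreover have "quad_fun {..<n} scaled_H scaled_c (\<lambda>j. y $ j) + of_int (scaled d) \<le> 0 \<longleftrightarrow>
      y \<bullet> (map_mat of_rat H *\<^sub>v y) + map_vec of_rat c \<bullet> y + of_rat d \<le> 0"
    unfolding scaled_quad_fun[OF y] using pos by (simp add: mult_le_0_iff)
  ultimately show ?thesis
    using y by (auto simp: miqp_feasible_def feasible_points_def mixed_integer_points_def)
qed

lemma ex_feasible_complexity_le:
  assumes "miqp_feasible n p H c d A b \<noteq> {}"
  obtains x0 :: "rat vec" where "map_vec of_rat x0 \<in> miqp_feasible n p H c d A b"
    "vec_complexity x0 \<le> \<phi> * (2 * miqp_exp (2 * \<phi>) + 4)"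
proof -
  interpret miqp "{..<n}" "{..<p}" scaled_constraints scaled_H scaled_c "scaled d" "2 * \<phi>"
    by (rule scaled_miqp)
  obtain x where "x \<in> miqp_feasible n p H c d A b" "x \<in> carrier_vec n"
    using assms(1) by (auto simp: miqp_feasible_def)
  then have "(\<lambda>j. x $ j) \<in> scaled_points" using feasible_iff_scaled by blast
  then obtain y where y: "y \<in> scaled_points" and height: "height_le {..<n} (2 ^ miqp_exp (2 * \<phi>)) y"
    using ex_feasible_height by blast
  obtain x0 where x0: "x0 \<in> carrier_vec n" "\<forall>j<n. real_of_rat (x0 $ j) = y j"
    and size: "vec_complexity x0 \<le> n * (2 * miqp_exp (2 * \<phi>) + 4)"
    using ex_rat_vec_of_height[OF height] .
  show thesis
  proof (rule that[of x0])
    have "(\<lambda>j. map_vec real_of_rat x0 $ j) \<in> scaled_points"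
      using y x0 integer_vars feasible_points_cong[of "{..<p}" "{..<n}"
        "\<lambda>j. map_vec real_of_rat x0 $ j" y] by simp
    then show "map_vec of_rat x0 \<in> miqp_feasible n p H c d A b"
      using x0(1) by (subst feasible_iff_scaled) auto
    have "n * (2 * miqp_exp (2 * \<phi>) + 4) \<le> \<phi> * (2 * miqp_exp (2 * \<phi>) + 4)"
      using dims_le_complexity by (intro mult_le_mono1) simp
    with size show "vec_complexity x0 \<le> \<phi> * (2 * miqp_exp (2 * \<phi>) + 4)" by (rule order_trans)
  qed
qed

end

theorem theorem1:
  shows "\<exists>f :: real poly.
    \<forall>(n::nat) (p::nat) (m::nat) (H :: rat mat) (c :: rat vec) (d :: rat) (A :: rat mat) (b :: rat vec).
      0 < n \<and> 0 < p \<and> p \<le> n \<and>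
      H \<in> carrier_mat n n \<and> transpose_mat H = H \<and> c \<in> carrier_vec n \<and>
      A \<in> carrier_mat m n \<and> b \<in> carrier_vec m \<and>
      miqp_feasible n p H c d A b \<noteq> {} \<longrightarrow>
      (\<exists>x0 :: rat vec.
         map_vec of_rat x0 \<in> miqp_feasible n p H c d A b \<and>
         real (vec_complexity x0) \<le> poly f (real (miqp_complexity H c d A b)))"
proof -
  have "polynomial_fun (\<lambda>k. k * (2 * miqp_exp (2 * k) + 4))"
    by (intro polynomial_fun_intros polynomial_fun_compose[OF polynomial_fun_miqp_exp])
  then obtain f where f: "\<And>k. real (k * (2 * miqp_exp (2 * k) + 4)) = poly f (real k)"
    unfolding polynomial_fun_def by blast
  show ?thesis
  proof (intro exI[of _ f] allI impI, elim conjE)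
    fix n p m :: nat and H A :: "rat mat" and c b :: "rat vec" and d :: rat
    assume "p \<le> n" "H \<in> carrier_mat n n" "c \<in> carrier_vec n" "A \<in> carrier_mat m n"
      "b \<in> carrier_vec m"
      and nonempty: "miqp_feasible n p H c d A b \<noteq> {}"
    then interpret rational_miqp n p m H c d A b by unfold_locales
    show "\<exists>x0 :: rat vec. map_vec of_rat x0 \<in> miqp_feasible n p H c d A b \<and>
        real (vec_complexity x0) \<le> poly f (real (miqp_complexity H c d A b))"
      using ex_feasible_complexity_le[OF nonempty] unfolding f[symmetric] of_nat_le_iff by blast
  qed
qed

end
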